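(* The quantum superalgebra $U_q(\mathfrak g)=U_q(\mathfrak q(n))$ is isomorphic to the unital associative algebra over $\mathbb C(q)$ generated by elements $e_i,f_i,e_{\bar i},f_{\bar i}$ $(i=1,\dots,n-1)$, $k_{\bar l}$ $(l=1,\dots,n)$ and $q^h$ $(h\in P^\vee)$, with the following defining relations (each imposed for all indices for which the generators involved exist): (Cartan and weight relations) $q^0=1$, $q^{h_1+h_2}=q^{h_1}q^{h_2}$ for $h_1,h_2\in P^\vee$; for $h\in P^\vee$: $q^he_iq^{-h}=q^{\alpha_i(h)}e_i$, $q^hf_iq^{-h}=q^{-\alpha_i(h)}f_i$, $q^hk_{\bar i}q^{-h}=k_{\bar i}$, $q^he_{\bar i}q^{-h}=q^{\alpha_i(h)}e_{\bar i}$, $q^hf_{\bar i}q^{-h}=q^{-\alpha_i(h)}f_{\bar i}$; (even $e$, even $f$) $e_if_i-f_ie_i=\frac{1}{q-q^{-1}}\left(q^{k_i-k_{i+1}}-q^{-k_i+k_{i+1}}\right)$; $qe_{i+1}f_i-f_ie_{i+1}=e_if_{i+1}-qf_{i+1}e_i=0$; $e_if_j-f_je_i=0$ if $|i-j|>1$; (even $e$, odd $f$) $e_if_{\bar i}-f_{\bar i}e_i=q^{-k_{i+1}}k_{\bar i}-k_{\overline{i+1}}q^{-k_i}$; $qe_{i+1}f_{\bar i}-f_{\bar i}e_{i+1}=e_if_{\overline{i+1}}-qf_{\overline{i+1}}e_i=0$; $e_if_{\bar j}-f_{\bar j}e_i=0$ if $|i-j|>1$; (odd $e$, even $f$) $e_{\bar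 i}f_i-f_ie_{\bar i}=q^{k_{i+1}}k_{\bar i}-k_{\overline{i+1}}q^{k_i}$; $qe_{\overline{i+1}}f_i-f_ie_{\overline{i+1}}=e_{\bar i}f_{i+1}-qf_{i+1}e_{\bar i}=0$; $e_{\bar i}f_j-f_je_{\bar i}=0$ if $|i-j|>1$; ($k_{\bar i}$ with even root vectors) $k_{\bar i}e_i-qe_ik_{\bar i}=e_{\bar i}q^{-k_i}$; $qk_{\bar i}e_{i-1}-e_{i-1}k_{\bar i}=-q^{-k_i}e_{\overline{i-1}}$; $k_{\bar i}e_j-e_jk_{\bar i}=0$ for $j\ne i,\ j\neq i-1$; $k_{\bar i}f_i-qf_ik_{\bar i}=-f_{\bar i}q^{k_i}$; $qk_{\bar i}f_{i-1}-f_{i-1}k_{\bar i}=q^{k_i}f_{\overline{i-1}}$; $k_{\bar i}f_j-f_jk_{\bar i}=0$ for $j\neq i,\ j\neq i-1$; (odd Cartan) $k_{\bar i}^2=\frac{q^{2k_i}-q^{-2k_i}}{q^2-q^{-2}}$; $k_{\bar i}k_{\bar j}=-k_{\bar j}k_{\bar i}$ for $i\neq j$; (odd $e$, odd $f$) $e_{\bar i}f_{\bar i}+f_{\bar i}e_{\bar i}=\frac{q^{k_i+k_{i+1}}-q^{-k_i-k_{i+1}}}{q-q^{-1}}+(q-q^{-1})k_{\bar i}k_{\overline{i+1}}$; $qe_{\overline{i+1}}f_{\bar i}+f_{\bar i}e_{\overline{i+1}}=e_{\bar i}f_{\overline{i+1}}+qf_{\overline{i+1}}e_{\bar i}=0$;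 $e_{\bar i}f_{\bar j}+f_{\bar j}e_{\bar i}=0$ if $|i-j|>1$; ($k_{\bar i}$ with odd root vectors) $k_{\bar i}e_{\bar i}+qe_{\bar i}k_{\bar i}=e_iq^{-k_i}$; $qk_{\bar i}e_{\overline{i-1}}+e_{\overline{i-1}}k_{\bar i}=q^{-k_i}e_{i-1}$; $k_{\bar i}e_{\bar j}+e_{\bar j}k_{\bar i}=0$ for $j\neq i,\ j\neq i-1$; $k_{\bar i}f_{\bar i}+qf_{\bar i}k_{\bar i}=f_iq^{k_i}$; $qk_{\bar i}f_{\overline{i-1}}+f_{\overline{i-1}}k_{\bar i}=q^{k_i}f_{i-1}$; $k_{\bar i}f_{\bar j}+f_{\bar j}k_{\bar i}=0$ for $j\ne i,\ j\neq i-1$; (quadratic and commutation relations) $e_{\bar i}^2=-\frac{q-q^{-1}}{q+q^{-1}}e_i^2$; $f_{\bar i}^2=\frac{q-q^{-1}}{q+q^{-1}}f_i^2$; $e_ie_j-e_je_i=f_if_j-f_jf_i=e_{\bar i}e_{\bar j}+e_{\bar j}e_{\bar i}=f_{\bar i}f_{\bar j}+f_{\bar j}f_{\bar i}=0$ if $|i-j|>1$; $e_ie_{\bar j}-e_{\bar j}e_i=f_if_{\bar j}-f_{\bar j}f_i=0$ if $|i-j|\neq1$; $e_ie_{i+1}-e_{i+1}e_i=e_{\bar i}e_{\overline{i+1}}+e_{\overline{i+1}}e_{\bar i}$; $f_{i+1}f_i-f_if_{i+1}=f_{\bar i}f_{\overline{i+1}}+f_{\overline{i+1}}f_{\bar i}$;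 $e_ie_{\overline{i+1}}-e_{\overline{i+1}}e_i=e_{\bar i}e_{i+1}-e_{i+1}e_{\bar i}$; $f_{\overline{i+1}}f_i-f_if_{\overline{i+1}}=f_{i+1}f_{\bar i}-f_{\bar i}f_{i+1}$; (Serre-type relations) $qe_i^2e_{i+1}-(q+q^{-1})e_ie_{i+1}e_i+q^{-1}e_{i+1}e_i^2=0$; $qf_i^2f_{i+1}-(q+q^{-1})f_if_{i+1}f_i+q^{-1}f_{i+1}f_i^2=0$; $qe_ie_{i+1}^2-(q+q^{-1})e_{i+1}e_ie_{i+1}+q^{-1}e_{i+1}^2e_i=0$; $qf_if_{i+1}^2-(q+q^{-1})f_{i+1}f_if_{i+1}+q^{-1}f_{i+1}^2f_i=0$; $qe_i^2e_{\overline{i+1}}-(q+q^{-1})e_ie_{\overline{i+1}}e_i+q^{-1}e_{\overline{i+1}}e_i^2=0$; $qf_i^2f_{\overline{i+1}}-(q+q^{-1})f_if_{\overline{i+1}}f_i+q^{-1}f_{\overline{i+1}}f_i^2=0$; $qe_{\bar i}e_{i+1}^2-(q+q^{-1})e_{i+1}e_{\bar i}e_{i+1}+q^{-1}e_{i+1}^2e_{\bar i}=0$; $qf_{\bar i}f_{i+1}^2-(q+q^{-1})f_{i+1}f_{\bar i}f_{i+1}+q^{-1}f_{i+1}^2f_{\bar i}=0$.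
   Context: Let $n$ be a positive integer, $P=\bigoplus_{i=1}^n\mathbb Z\epsilon_i$, $P^\vee=\bigoplus_{i=1}^n\mathbb Zk_i$ with $\epsilon_i(k_j)=\delta_{ij}$, and $\alpha_i=\epsilon_i-\epsilon_{i+1}$ for $1\le i\le n-1$. The algebra $U_q(\mathfrak q(n))$ (Olshanski) is defined as the unital associative algebra over $\mathbb C(q)$ generated by $L_{ij}$, for $i\le j$ with $i,j\in\{\pm1,\dots,\pm n\}$, with defining relations $L_{ii}L_{-i,-i}=L_{-i,-i}L_{ii}=1$ and, for all $i\le j$, $k\le l$ in $\{\pm1,\dots,\pm n\}$, $$\begin{aligned}&(-1)^{p(i,j)p(k,l)}q^{\varphi(j,l)}L_{ij}L_{kl}+\{k\le j<l\}\theta(i,j,k)(q-q^{-1})L_{il}L_{kj}\\&\quad+\{i\le -l<j\le -k\}\theta(-i,-j,k)(q-q^{-1})L_{i,-l}L_{k,-j}\\&=q^{\varphi(i,k)}L_{kl}L_{ij}+\{k<i\le l\}\theta(i,j,k)(q-q^{-1})L_{il}L_{kj}\\&\quad+\{-l\le i<-k\le j\}\theta(-i,-j,k)(q-q^{-1})L_{-i,l}L_{-k,j},\end{aligned}$$ where $\varphi(i,j)=\delta_{|i|,|j|}\,\mathrm{sgn}(j)$, $\theta(i,j,k)=\mathrm{sgn}(\mathrm{sgn}(i)+\mathrm{sgn}(j)+\mathrm{sgn}(k))$, $p(i,j)=0$ if $ij>0$ and $p(i,j)=1$ if $ij<0$, and $\{\cdots\}$ equals $1$ if all the inequalities inside hold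 and $0$ otherwise. In $U_q(\mathfrak q(n))$ one considers the following elements, denoted by the same symbols as the generators in the claim: $q^{k_i}:=L_{i,i}$, $q^{-k_i}:=L_{-i,-i}$, $e_i:=-\frac{1}{q-q^{-1}}L_{-i-1,-i}$, $f_i:=\frac{1}{q-q^{-1}}L_{i,i+1}$, $e_{\bar i}:=-\frac1{q-q^{-1}}L_{-i-1,i}$, $f_{\bar i}:=-\frac1{q-q^{-1}}L_{-i,i+1}$, $k_{\bar i}:=-\frac1{q-q^{-1}}L_{-i,i}$. *)

theory Defs
  imports
    "HOL-Library.Poly_Mapping"
    "HOL-Computational_Algebra.Fraction_Field"
    "HOL-Computational_Algebra.Polynomial"
    "HOL-Algebra.QuotRing"
    "HOL-Algebra.Module"
    "HOL-Algebra.Free_Abelian_Groups"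
begin

section \<open>Algebras over $C(q)$ given by generators and relations\<close>

type_synonym ratfun = "complex poly fract"

definition \<q> :: ratfun where
  "\<q> = Fraction_Field.Fract [:0, 1:] 1"

text \<open>Words form the free monoid. It is written additively because the convolution product
  on finitely supported functions expects a \<^class>\<open>monoid_add\<close> as index type.\<close>

datatype 'g word = Word (letters: "'g list")

instantiation word :: (type) monoid_add
begin

definition zero_word :: "'a word" where
  "0 = Word []"

definition plus_word :: "'a word \<Rightarrow> 'a word \<Rightarrow> 'a word" where
  "u + v = Word (letters u @ letters v)"

instance
  by standard (simp_all add: zero_word_def plus_word_def)

end

type_synonym 'g ncpoly = "'g word \<Rightarrow>\<^sub>0 ratfun"

definition gen :: "'g \<Rightarrow> 'g ncpoly" where
  "gen g = Poly_Mapping.single (Word [g]) 1"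

definition scale :: "ratfun \<Rightarrow> 'g ncpoly \<Rightarrow> 'g ncpoly" (infixr \<open>\<cdot>\<close> 75) where
  "c \<cdot> x = Poly_Mapping.single 0 c * x"

text \<open>A noncommutative algebra is a record \<^typ>\<open>('k, 'a) module\<close> whose ring part is the
  underlying ring. (The locale \<^locale>\<open>algebra\<close> of the library is about commutative
  algebras only.)\<close>

definition free_algebra :: "'g set \<Rightarrow> (ratfun, 'g ncpoly) module" where
  "free_algebra G =
    \<lparr>carrier = {x. \<forall>w \<in> Poly_Mapping.keys x. set (letters w) \<subseteq> G},
     monoid.mult = (*), monoid.one = 1, ring.zero = 0, ring.add = (+), module.smult = (\<cdot>)\<rparr>"

definition quot_algebra :: "('k, 'a) module \<Rightarrow> 'a set \<Rightarrow> ('k, 'a set) module" where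
  "quot_algebra A I =
    \<lparr>carrier = carrier (A Quot I), monoid.mult = monoid.mult (A Quot I), monoid.one = monoid.one (A Quot I),
     ring.zero = ring.zero (A Quot I), ring.add = ring.add (A Quot I),
     module.smult = (\<lambda>c X. \<Union>x\<in>X. I +>\<^bsub>A\<^esub> (c \<odot>\<^bsub>A\<^esub> x))\<rparr>"

definition rel_ideal :: "'g set \<Rightarrow> ('g ncpoly \<Rightarrow> 'g ncpoly \<Rightarrow> bool) \<Rightarrow> 'g ncpoly set" where
  "rel_ideal G R = Idl\<^bsub>free_algebra G\<^esub> {x - y | x y. R x y}"

definition presented_algebra ::
    "'g set \<Rightarrow> ('g ncpoly \<Rightarrow> 'g ncpoly \<Rightarrow> bool) \<Rightarrow> (ratfun, 'g ncpoly set) module" where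
  "presented_algebra G R = quot_algebra (free_algebra G) (rel_ideal G R)"

definition presented_class ::
    "'g set \<Rightarrow> ('g ncpoly \<Rightarrow> 'g ncpoly \<Rightarrow> bool) \<Rightarrow> 'g ncpoly \<Rightarrow> 'g ncpoly set" where
  "presented_class G R x = rel_ideal G R +>\<^bsub>free_algebra G\<^esub> x"

definition algebra_iso :: "('k, 'a) module \<Rightarrow> ('k, 'b) module \<Rightarrow> ('a \<Rightarrow> 'b) set" where
  "algebra_iso A B =
    {h \<in> ring_iso A B. \<forall>c. \<forall>x \<in> carrier A. h (c \<odot>\<^bsub>A\<^esub> x) = c \<odot>\<^bsub>B\<^esub> h x}"


section \<open>Olshanski's algebra $U_q(q(n))$\<close>

datatype olsh_gen = L_gen int int

abbreviation \<L> :: "int \<Rightarrow> int \<Rightarrow> olsh_gen ncpoly" where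
  "\<L> i j \<equiv> gen (L_gen i j)"

definition olsh_index :: "nat \<Rightarrow> int set" where
  "olsh_index n = {i. i \<noteq> 0 \<and> \<bar>i\<bar> \<le> int n}"

definition olsh_gens :: "nat \<Rightarrow> olsh_gen set" where
  "olsh_gens n = {L_gen i j | i j. i \<in> olsh_index n \<and> j \<in> olsh_index n \<and> i \<le> j}"

definition olsh_phi :: "int \<Rightarrow> int \<Rightarrow> int" where
  "olsh_phi i j = (if \<bar>i\<bar> = \<bar>j\<bar> then sgn j else 0)"

definition olsh_theta :: "int \<Rightarrow> int \<Rightarrow> int \<Rightarrow> int" where
  "olsh_theta i j k = sgn (sgn i + sgn j + sgn k)"

definition olsh_parity :: "int \<Rightarrow> int \<Rightarrow> nat" where
  "olsh_parity i j = (if i * j > 0 then 0 else 1)"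

text \<open>In the second rule a monomial whose indices are out of order, i.e.\ which is not a
  monomial in the generators, always occurs with coefficient \<^term>\<open>0\<close>.\<close>

inductive olsh_rel :: "nat \<Rightarrow> olsh_gen ncpoly \<Rightarrow> olsh_gen ncpoly \<Rightarrow> bool" for n :: nat where
  diag: "i \<in> olsh_index n \<Longrightarrow> olsh_rel n (\<L> i i * \<L> (-i) (-i)) 1"
| diag': "i \<in> olsh_index n \<Longrightarrow> olsh_rel n (\<L> (-i) (-i) * \<L> i i) 1"
| exchange:
  "\<lbrakk>i \<in> olsh_index n; j \<in> olsh_index n; k \<in> olsh_index n; l \<in> olsh_index n; i \<le> j; k \<le> l\<rbrakk> \<Longrightarrow>
   olsh_rel n
    (((-1) ^ (olsh_parity i j * olsh_parity k l) * \<q> powi olsh_phi j l) \<cdot> (\<L> i j * \<L> k l)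
      + (of_bool (k \<le> j \<and> j < l) * of_int (olsh_theta i j k) * (\<q> - inverse \<q>))
          \<cdot> (\<L> i l * \<L> k j)
      + (of_bool (i \<le> -l \<and> -l < j \<and> j \<le> -k) * of_int (olsh_theta (-i) (-j) k) * (\<q> - inverse \<q>))
          \<cdot> (\<L> i (-l) * \<L> k (-j)))
    ((\<q> powi olsh_phi i k) \<cdot> (\<L> k l * \<L> i j)
      + (of_bool (k < i \<and> i \<le> l) * of_int (olsh_theta i j k) * (\<q> - inverse \<q>))
          \<cdot> (\<L> i l * \<L> k j)
      + (of_bool (-l \<le> i \<and> i < -k \<and> -k \<le> j) * of_int (olsh_theta (-i) (-j) k) * (\<q> - inverse \<q>))
          \<cdot> (\<L> (-i) l * \<L> (-k) j))"

definition Uq_queer :: "nat \<Rightarrow> (ratfun, olsh_gen ncpoly set) module" where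
  "Uq_queer n = presented_algebra (olsh_gens n) (olsh_rel n)"

definition Uq_class :: "nat \<Rightarrow> olsh_gen ncpoly \<Rightarrow> olsh_gen ncpoly set" where
  "Uq_class n = presented_class (olsh_gens n) (olsh_rel n)"


section \<open>The presentation by Chevalley-type generators\<close>

text \<open>Here \<open>coweights n\<close> is $P^\vee$ with basis \<open>cow i\<close> $= k_i$, and weights are evaluated as
  functionals on it, so that \<open>simple_root i h\<close> is $\alpha_i(h)$.\<close>

definition coweights :: "nat \<Rightarrow> (nat \<Rightarrow>\<^sub>0 int) set" where
  "coweights n = carrier (free_Abelian_group {1..n})"

definition cow :: "nat \<Rightarrow> (nat \<Rightarrow>\<^sub>0 int)" where
  "cow i = Poly_Mapping.single i 1"

definition eps :: "nat \<Rightarrow> (nat \<Rightarrow>\<^sub>0 int) \<Rightarrow> int" where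
  "eps i h = Poly_Mapping.lookup h i"

definition simple_root :: "nat \<Rightarrow> (nat \<Rightarrow>\<^sub>0 int) \<Rightarrow> int" where
  "simple_root i h = eps i h - eps (i + 1) h"

datatype chev_gen =
  E_gen nat | F_gen nat | Ebar_gen nat | Fbar_gen nat | Kbar_gen nat | Q_gen "nat \<Rightarrow>\<^sub>0 int"

abbreviation "\<ee> i \<equiv> gen (E_gen i)"
abbreviation "\<ff> i \<equiv> gen (F_gen i)"
abbreviation "\<ee>bar i \<equiv> gen (Ebar_gen i)"
abbreviation "\<ff>bar i \<equiv> gen (Fbar_gen i)"
abbreviation "\<kk>bar i \<equiv> gen (Kbar_gen i)"
abbreviation "qpow h \<equiv> gen (Q_gen h)"

definition chev_gens :: "nat \<Rightarrow> chev_gen set" where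
  "chev_gens n = E_gen ` {1..<n} \<union> F_gen ` {1..<n} \<union> Ebar_gen ` {1..<n} \<union> Fbar_gen ` {1..<n}
    \<union> Kbar_gen ` {1..n} \<union> Q_gen ` coweights n"

definition apart :: "nat \<Rightarrow> nat \<Rightarrow> bool" where
  "apart i j \<longleftrightarrow> \<bar>int i - int j\<bar> > 1"

text \<open>The guard \<open>i + 1 \<in> {1..<n}\<close> or \<open>i - 1 \<in> {1..<n}\<close> says that the neighbouring simple
  root exists; since \<open>0\<close> is excluded, truncated subtraction plays no role. A chain
  $a = b = 0$ is split into two rules.\<close>

inductive chev_rel :: "nat \<Rightarrow> chev_gen ncpoly \<Rightarrow> chev_gen ncpoly \<Rightarrow> bool" for n :: nat where
  q_zero:
  "chev_rel n (qpow 0) 1"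
| q_add:
  "\<lbrakk>h1 \<in> coweights n; h2 \<in> coweights n\<rbrakk> \<Longrightarrow>
   chev_rel n (qpow (h1 + h2)) (qpow h1 * qpow h2)"
| q_e:
  "\<lbrakk>h \<in> coweights n; i \<in> {1..<n}\<rbrakk> \<Longrightarrow>
   chev_rel n (qpow h * \<ee> i * qpow (- h)) ((\<q> powi (simple_root i h)) \<cdot> \<ee> i)"
| q_f:
  "\<lbrakk>h \<in> coweights n; i \<in> {1..<n}\<rbrakk> \<Longrightarrow>
   chev_rel n (qpow h * \<ff> i * qpow (- h)) ((\<q> powi (- simple_root i h)) \<cdot> \<ff> i)"
| q_kb:
  "\<lbrakk>h \<in> coweights n; i \<in> {1..n}\<rbrakk> \<Longrightarrow>
   chev_rel n (qpow h * \<kk>bar i * qpow (- h)) (\<kk>bar i)"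
| q_eb:
  "\<lbrakk>h \<in> coweights n; i \<in> {1..<n}\<rbrakk> \<Longrightarrow>
   chev_rel n (qpow h * \<ee>bar i * qpow (- h)) ((\<q> powi (simple_root i h)) \<cdot> \<ee>bar i)"
| q_fb:
  "\<lbrakk>h \<in> coweights n; i \<in> {1..<n}\<rbrakk> \<Longrightarrow>
   chev_rel n (qpow h * \<ff>bar i * qpow (- h)) ((\<q> powi (- simple_root i h)) \<cdot> \<ff>bar i)"
| e_f:
  "i \<in> {1..<n} \<Longrightarrow>
   chev_rel n
     (\<ee> i * \<ff> i - \<ff> i * \<ee> i)
     ((1 / (\<q> - inverse \<q>)) \<cdot> (qpow (cow i - cow (i + 1)) - qpow (- cow i + cow (i + 1))))"
| e_f_up:
  "\<lbrakk>i \<in> {1..<n}; i + 1 \<in> {1..<n}\<rbrakk> \<Longrightarrow>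
   chev_rel n (\<q> \<cdot> (\<ee> (i + 1) * \<ff> i) - \<ff> i * \<ee> (i + 1)) 0"
| e_f_dn:
  "\<lbrakk>i \<in> {1..<n}; i + 1 \<in> {1..<n}\<rbrakk> \<Longrightarrow>
   chev_rel n (\<ee> i * \<ff> (i + 1) - \<q> \<cdot> (\<ff> (i + 1) * \<ee> i)) 0"
| e_f_apart:
  "\<lbrakk>i \<in> {1..<n}; j \<in> {1..<n}; apart i j\<rbrakk> \<Longrightarrow>
   chev_rel n (\<ee> i * \<ff> j - \<ff> j * \<ee> i) 0"
| e_fb:
  "i \<in> {1..<n} \<Longrightarrow>
   chev_rel n
     (\<ee> i * \<ff>bar i - \<ff>bar i * \<ee> i)
     (qpow (- cow (i + 1)) * \<kk>bar i - \<kk>bar (i + 1) * qpow (- cow i))"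
| e_fb_up:
  "\<lbrakk>i \<in> {1..<n}; i + 1 \<in> {1..<n}\<rbrakk> \<Longrightarrow>
   chev_rel n (\<q> \<cdot> (\<ee> (i + 1) * \<ff>bar i) - \<ff>bar i * \<ee> (i + 1)) 0"
| e_fb_dn:
  "\<lbrakk>i \<in> {1..<n}; i + 1 \<in> {1..<n}\<rbrakk> \<Longrightarrow>
   chev_rel n (\<ee> i * \<ff>bar (i + 1) - \<q> \<cdot> (\<ff>bar (i + 1) * \<ee> i)) 0"
| e_fb_apart:
  "\<lbrakk>i \<in> {1..<n}; j \<in> {1..<n}; apart i j\<rbrakk> \<Longrightarrow>
   chev_rel n (\<ee> i * \<ff>bar j - \<ff>bar j * \<ee> i) 0"
| eb_f:
  "i \<in> {1..<n} \<Longrightarrow>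
   chev_rel n
     (\<ee>bar i * \<ff> i - \<ff> i * \<ee>bar i)
     (qpow (cow (i + 1)) * \<kk>bar i - \<kk>bar (i + 1) * qpow (cow i))"
| eb_f_up:
  "\<lbrakk>i \<in> {1..<n}; i + 1 \<in> {1..<n}\<rbrakk> \<Longrightarrow>
   chev_rel n (\<q> \<cdot> (\<ee>bar (i + 1) * \<ff> i) - \<ff> i * \<ee>bar (i + 1)) 0"
| eb_f_dn:
  "\<lbrakk>i \<in> {1..<n}; i + 1 \<in> {1..<n}\<rbrakk> \<Longrightarrow>
   chev_rel n (\<ee>bar i * \<ff> (i + 1) - \<q> \<cdot> (\<ff> (i + 1) * \<ee>bar i)) 0"
| eb_f_apart:
  "\<lbrakk>i \<in> {1..<n}; j \<in> {1..<n}; apart i j\<rbrakk> \<Longrightarrow>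
   chev_rel n (\<ee>bar i * \<ff> j - \<ff> j * \<ee>bar i) 0"
| kb_e:
  "i \<in> {1..<n} \<Longrightarrow>
   chev_rel n
     (\<kk>bar i * \<ee> i - \<q> \<cdot> (\<ee> i * \<kk>bar i))
     (\<ee>bar i * qpow (- cow i))"
| kb_e_dn:
  "\<lbrakk>i \<in> {1..n}; i - 1 \<in> {1..<n}\<rbrakk> \<Longrightarrow>
   chev_rel n
     (\<q> \<cdot> (\<kk>bar i * \<ee> (i - 1)) - \<ee> (i - 1) * \<kk>bar i)
     (- (qpow (- cow i) * \<ee>bar (i - 1)))"
| kb_e_apart:
  "\<lbrakk>i \<in> {1..n}; j \<in> {1..<n}; j \<noteq> i; j \<noteq> i - 1\<rbrakk> \<Longrightarrow>
   chev_rel n (\<kk>bar i * \<ee> j - \<ee> j * \<kk>bar i) 0"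
| kb_f:
  "i \<in> {1..<n} \<Longrightarrow>
   chev_rel n
     (\<kk>bar i * \<ff> i - \<q> \<cdot> (\<ff> i * \<kk>bar i))
     (- (\<ff>bar i * qpow (cow i)))"
| kb_f_dn:
  "\<lbrakk>i \<in> {1..n}; i - 1 \<in> {1..<n}\<rbrakk> \<Longrightarrow>
   chev_rel n
     (\<q> \<cdot> (\<kk>bar i * \<ff> (i - 1)) - \<ff> (i - 1) * \<kk>bar i)
     (qpow (cow i) * \<ff>bar (i - 1))"
| kb_f_apart:
  "\<lbrakk>i \<in> {1..n}; j \<in> {1..<n}; j \<noteq> i; j \<noteq> i - 1\<rbrakk> \<Longrightarrow>
   chev_rel n (\<kk>bar i * \<ff> j - \<ff> j * \<kk>bar i) 0"
| kb_sq:
  "i \<in> {1..n} \<Longrightarrow>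
   chev_rel n
     (\<kk>bar i ^ 2)
     ((1 / (\<q>^2 - inverse \<q>^2)) \<cdot> (qpow (cow i + cow i) - qpow (- (cow i + cow i))))"
| kb_kb:
  "\<lbrakk>i \<in> {1..n}; j \<in> {1..n}; i \<noteq> j\<rbrakk> \<Longrightarrow>
   chev_rel n (\<kk>bar i * \<kk>bar j) (- (\<kk>bar j * \<kk>bar i))"
| eb_fb:
  "i \<in> {1..<n} \<Longrightarrow>
   chev_rel n (\<ee>bar i * \<ff>bar i + \<ff>bar i * \<ee>bar i)
     ((1 / (\<q> - inverse \<q>)) \<cdot> (qpow (cow i + cow (i + 1)) - qpow (- cow i - cow (i + 1)))
      + (\<q> - inverse \<q>) \<cdot> (\<kk>bar i * \<kk>bar (i + 1)))"
| eb_fb_up: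
  "\<lbrakk>i \<in> {1..<n}; i + 1 \<in> {1..<n}\<rbrakk> \<Longrightarrow>
   chev_rel n (\<q> \<cdot> (\<ee>bar (i + 1) * \<ff>bar i) + \<ff>bar i * \<ee>bar (i + 1)) 0"
| eb_fb_dn:
  "\<lbrakk>i \<in> {1..<n}; i + 1 \<in> {1..<n}\<rbrakk> \<Longrightarrow>
   chev_rel n (\<ee>bar i * \<ff>bar (i + 1) + \<q> \<cdot> (\<ff>bar (i + 1) * \<ee>bar i)) 0"
| eb_fb_apart:
  "\<lbrakk>i \<in> {1..<n}; j \<in> {1..<n}; apart i j\<rbrakk> \<Longrightarrow>
   chev_rel n (\<ee>bar i * \<ff>bar j + \<ff>bar j * \<ee>bar i) 0"
| kb_eb:
  "i \<in> {1..<n} \<Longrightarrow>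
   chev_rel n
     (\<kk>bar i * \<ee>bar i + \<q> \<cdot> (\<ee>bar i * \<kk>bar i))
     (\<ee> i * qpow (- cow i))"
| kb_eb_dn:
  "\<lbrakk>i \<in> {1..n}; i - 1 \<in> {1..<n}\<rbrakk> \<Longrightarrow>
   chev_rel n
     (\<q> \<cdot> (\<kk>bar i * \<ee>bar (i - 1)) + \<ee>bar (i - 1) * \<kk>bar i)
     (qpow (- cow i) * \<ee> (i - 1))"
| kb_eb_apart:
  "\<lbrakk>i \<in> {1..n}; j \<in> {1..<n}; j \<noteq> i; j \<noteq> i - 1\<rbrakk> \<Longrightarrow>
   chev_rel n (\<kk>bar i * \<ee>bar j + \<ee>bar j * \<kk>bar i) 0"
| kb_fb:
  "i \<in> {1..<n} \<Longrightarrow>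
   chev_rel n
     (\<kk>bar i * \<ff>bar i + \<q> \<cdot> (\<ff>bar i * \<kk>bar i))
     (\<ff> i * qpow (cow i))"
| kb_fb_dn:
  "\<lbrakk>i \<in> {1..n}; i - 1 \<in> {1..<n}\<rbrakk> \<Longrightarrow>
   chev_rel n
     (\<q> \<cdot> (\<kk>bar i * \<ff>bar (i - 1)) + \<ff>bar (i - 1) * \<kk>bar i)
     (qpow (cow i) * \<ff> (i - 1))"
| kb_fb_apart:
  "\<lbrakk>i \<in> {1..n}; j \<in> {1..<n}; j \<noteq> i; j \<noteq> i - 1\<rbrakk> \<Longrightarrow>
   chev_rel n (\<kk>bar i * \<ff>bar j + \<ff>bar j * \<kk>bar i) 0"
| eb_sq:
  "i \<in> {1..<n} \<Longrightarrow>
   chev_rel n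
     (\<ee>bar i ^ 2)
     ((- ((\<q> - inverse \<q>) / (\<q> + inverse \<q>))) \<cdot> (\<ee> i ^ 2))"
| fb_sq:
  "i \<in> {1..<n} \<Longrightarrow>
   chev_rel n (\<ff>bar i ^ 2) (((\<q> - inverse \<q>) / (\<q> + inverse \<q>)) \<cdot> (\<ff> i ^ 2))"
| e_e_apart:
  "\<lbrakk>i \<in> {1..<n}; j \<in> {1..<n}; apart i j\<rbrakk> \<Longrightarrow>
   chev_rel n (\<ee> i * \<ee> j - \<ee> j * \<ee> i) 0"
| f_f_apart:
  "\<lbrakk>i \<in> {1..<n}; j \<in> {1..<n}; apart i j\<rbrakk> \<Longrightarrow>
   chev_rel n (\<ff> i * \<ff> j - \<ff> j * \<ff> i) 0"
| eb_eb_apart: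
  "\<lbrakk>i \<in> {1..<n}; j \<in> {1..<n}; apart i j\<rbrakk> \<Longrightarrow>
   chev_rel n (\<ee>bar i * \<ee>bar j + \<ee>bar j * \<ee>bar i) 0"
| fb_fb_apart:
  "\<lbrakk>i \<in> {1..<n}; j \<in> {1..<n}; apart i j\<rbrakk> \<Longrightarrow>
   chev_rel n (\<ff>bar i * \<ff>bar j + \<ff>bar j * \<ff>bar i) 0"
| e_eb:
  "\<lbrakk>i \<in> {1..<n}; j \<in> {1..<n}; \<bar>int i - int j\<bar> \<noteq> 1\<rbrakk> \<Longrightarrow>
   chev_rel n (\<ee> i * \<ee>bar j - \<ee>bar j * \<ee> i) 0"
| f_fb:
  "\<lbrakk>i \<in> {1..<n}; j \<in> {1..<n}; \<bar>int i - int j\<bar> \<noteq> 1\<rbrakk> \<Longrightarrow>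
   chev_rel n (\<ff> i * \<ff>bar j - \<ff>bar j * \<ff> i) 0"
| e_e_next:
  "\<lbrakk>i \<in> {1..<n}; i + 1 \<in> {1..<n}\<rbrakk> \<Longrightarrow>
   chev_rel n
     (\<ee> i * \<ee> (i + 1) - \<ee> (i + 1) * \<ee> i)
     (\<ee>bar i * \<ee>bar (i + 1) + \<ee>bar (i + 1) * \<ee>bar i)"
| f_f_next:
  "\<lbrakk>i \<in> {1..<n}; i + 1 \<in> {1..<n}\<rbrakk> \<Longrightarrow>
   chev_rel n
     (\<ff> (i + 1) * \<ff> i - \<ff> i * \<ff> (i + 1))
     (\<ff>bar i * \<ff>bar (i + 1) + \<ff>bar (i + 1) * \<ff>bar i)"
| e_eb_next:
  "\<lbrakk>i \<in> {1..<n}; i + 1 \<in> {1..<n}\<rbrakk> \<Longrightarrow>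
   chev_rel n
     (\<ee> i * \<ee>bar (i + 1) - \<ee>bar (i + 1) * \<ee> i)
     (\<ee>bar i * \<ee> (i + 1) - \<ee> (i + 1) * \<ee>bar i)"
| f_fb_next:
  "\<lbrakk>i \<in> {1..<n}; i + 1 \<in> {1..<n}\<rbrakk> \<Longrightarrow>
   chev_rel n
     (\<ff>bar (i + 1) * \<ff> i - \<ff> i * \<ff>bar (i + 1))
     (\<ff> (i + 1) * \<ff>bar i - \<ff>bar i * \<ff> (i + 1))"
| serre_e:
  "\<lbrakk>i \<in> {1..<n}; i + 1 \<in> {1..<n}\<rbrakk> \<Longrightarrow>
   chev_rel n
     (\<q> \<cdot> (\<ee> i ^ 2 * \<ee> (i + 1)) - (\<q> + inverse \<q>) \<cdot> (\<ee> i * \<ee> (i + 1) * \<ee> i)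
      + inverse \<q> \<cdot> (\<ee> (i + 1) * \<ee> i ^ 2))
     0"
| serre_f:
  "\<lbrakk>i \<in> {1..<n}; i + 1 \<in> {1..<n}\<rbrakk> \<Longrightarrow>
   chev_rel n
     (\<q> \<cdot> (\<ff> i ^ 2 * \<ff> (i + 1)) - (\<q> + inverse \<q>) \<cdot> (\<ff> i * \<ff> (i + 1) * \<ff> i)
      + inverse \<q> \<cdot> (\<ff> (i + 1) * \<ff> i ^ 2))
     0"
| serre_e':
  "\<lbrakk>i \<in> {1..<n}; i + 1 \<in> {1..<n}\<rbrakk> \<Longrightarrow>
   chev_rel n
     (\<q> \<cdot> (\<ee> i * \<ee> (i + 1) ^ 2) - (\<q> + inverse \<q>) \<cdot> (\<ee> (i + 1) * \<ee> i * \<ee> (i + 1))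
      + inverse \<q> \<cdot> (\<ee> (i + 1) ^ 2 * \<ee> i))
     0"
| serre_f':
  "\<lbrakk>i \<in> {1..<n}; i + 1 \<in> {1..<n}\<rbrakk> \<Longrightarrow>
   chev_rel n
     (\<q> \<cdot> (\<ff> i * \<ff> (i + 1) ^ 2) - (\<q> + inverse \<q>) \<cdot> (\<ff> (i + 1) * \<ff> i * \<ff> (i + 1))
      + inverse \<q> \<cdot> (\<ff> (i + 1) ^ 2 * \<ff> i))
     0"
| serre_eb:
  "\<lbrakk>i \<in> {1..<n}; i + 1 \<in> {1..<n}\<rbrakk> \<Longrightarrow>
   chev_rel n
     (\<q> \<cdot> (\<ee> i ^ 2 * \<ee>bar (i + 1)) - (\<q> + inverse \<q>) \<cdot> (\<ee> i * \<ee>bar (i + 1) * \<ee> i)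
      + inverse \<q> \<cdot> (\<ee>bar (i + 1) * \<ee> i ^ 2))
     0"
| serre_fb:
  "\<lbrakk>i \<in> {1..<n}; i + 1 \<in> {1..<n}\<rbrakk> \<Longrightarrow>
   chev_rel n
     (\<q> \<cdot> (\<ff> i ^ 2 * \<ff>bar (i + 1)) - (\<q> + inverse \<q>) \<cdot> (\<ff> i * \<ff>bar (i + 1) * \<ff> i)
      + inverse \<q> \<cdot> (\<ff>bar (i + 1) * \<ff> i ^ 2))
     0"
| serre_eb':
  "\<lbrakk>i \<in> {1..<n}; i + 1 \<in> {1..<n}\<rbrakk> \<Longrightarrow>
   chev_rel n
     (\<q> \<cdot> (\<ee>bar i * \<ee> (i + 1) ^ 2) - (\<q> + inverse \<q>) \<cdot> (\<ee> (i + 1) * \<ee>bar i * \<ee> (i + 1))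
      + inverse \<q> \<cdot> (\<ee> (i + 1) ^ 2 * \<ee>bar i))
     0"
| serre_fb':
  "\<lbrakk>i \<in> {1..<n}; i + 1 \<in> {1..<n}\<rbrakk> \<Longrightarrow>
   chev_rel n
     (\<q> \<cdot> (\<ff>bar i * \<ff> (i + 1) ^ 2) - (\<q> + inverse \<q>) \<cdot> (\<ff> (i + 1) * \<ff>bar i * \<ff> (i + 1))
      + inverse \<q> \<cdot> (\<ff> (i + 1) ^ 2 * \<ff>bar i))
     0"

definition Uq_chev :: "nat \<Rightarrow> (ratfun, chev_gen ncpoly set) module" where
  "Uq_chev n = presented_algebra (chev_gens n) (chev_rel n)"

definition chev_class :: "nat \<Rightarrow> chev_gen ncpoly \<Rightarrow> chev_gen ncpoly set" where
  "chev_class n = presented_class (chev_gens n) (chev_rel n)"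

end

theory Submission imports Defs
begin

text \<open>In Olshanski's algebra each Chevalley relation is read off from one or two exchange relations. In the
  opposite direction, the matrix $L$ is rebuilt from the Chevalley generators by
  $L_{i,j+1} = (f_j L_{ij} - L_{ij} f_j) K_j^{-1}$ (with $q f_j L_{ij}$ if $|i| = j$), and the problem is to
  prove all exchange relations for it. The relations with $L_{ij}$ for the diagonal and next-to-diagonal
  entries and for $L_{-1,1}$ are checked directly, by induction on the length of the $q$-commutator.

  For fixed $k \<le> l$ with $l > 0$, the exchange relations with $L_{kl}$ say $L N_{kl} = M_{kl} L$, where $N_{kl}$
  and $M_{kl}$ are matrices whose entries are linear in row $k$ and in column $l$ of $L$ respectively. For
  $k < l$ one has, with a constant $c$ and the matrix $N_{l,l+1} = z F$,
  $$N_{k,l+1} N_{ll} = c F N_{kl} - N_{kl} F + \delta_{k,-l-1} N_{l+1,l+1} N_{-l,l},$$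
  and the same identity holds for $M$. As $N_{ll}$ is invertible, the relations for $(k,l)$ imply those for
  $(k,l+1)$. The case $l < 0$ is reduced to $l > 0$ by the symmetry $L_{ij} \mapsto L_{-j,-i}$,
  $q \mapsto q^{-1}$ into the opposite algebra.

  A matrix with these relations is determined by its diagonal and next-to-diagonal entries and the $L_{-m,m}$, so the
  two resulting homomorphisms are inverse to each other.\<close>

text \<open>Writing a family of exchange relations as L N = M L makes it multiplicative: if L A = A'
  L and L B = B' L, then L (A B) = (A' B') L. An identity between the N and the same identity
  between the M therefore transports relations. Both identities are proved from the relations with
  diagonal entries and with L_{l,l+1} alone. The correction at k = -l-1 dictates the order in which
  the odd entries are treated. Row -1 never meets it, as l would be 0, and starts from L_{-1,1}. The
  symmetry carries row -1 to column 1, that is to all L_{-a,1}. Row -a-1 starts there and meets the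
  correction only at l = a, where it refers to the row -a already done. The recursion reaches only
  the entries with |i| \<le> j. The others come from the same recursion in the opposite algebra,
  where e and f change places, so the direct checks are made for |i| \<le> j and applied in both
  algebras.\<close>

class ratfun_algebra = ring + monoid_mult +
  fixes smul :: "ratfun \<Rightarrow> 'a \<Rightarrow> 'a"  (infixr \<open>\<bullet>\<close> 75)
  assumes smul_add_right: "c \<bullet> (x + y) = c \<bullet> x + c \<bullet> y"
    and smul_add_left: "(c + d) \<bullet> x = c \<bullet> x + d \<bullet> x"
    and smul_smul [simp]: "c \<bullet> d \<bullet> x = (c * d) \<bullet> x"
    and smul_one [simp]: "1 \<bullet> x = x"
    and mult_smul_left [simp]: "(c \<bullet> x) * y = c \<bullet> (x * y)"
    and mult_smul_right [simp]: "x * (c \<bullet> y) = c \<bullet> (x * y)"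
begin

lemma smul_zero_left [simp]: "0 \<bullet> x = 0"
  using smul_add_left[of 0 0 x] by simp

lemma smul_zero_right [simp]: "c \<bullet> 0 = 0"
  using smul_add_right[of c 0 0] by simp

lemma smul_minus_left [simp]: "(- c) \<bullet> x = - (c \<bullet> x)"
  using smul_add_left[of c "- c" x] by (simp add: eq_neg_iff_add_eq_0 add.commute)

lemma smul_minus_right [simp]: "c \<bullet> (- x) = - (c \<bullet> x)"
  using smul_add_right[of c x "- x"] by (simp add: eq_neg_iff_add_eq_0 add.commute)

lemma smul_diff_right: "c \<bullet> (x - y) = c \<bullet> x - c \<bullet> y"
  using smul_add_right[of c x "- y"] by simp

lemma smul_diff_left: "(c - d) \<bullet> x = c \<bullet> x - d \<bullet> x"
  using smul_add_left[of c "- d" x] by simp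

lemma smul_cancel: assumes "c \<noteq> 0" shows "c \<bullet> x = c \<bullet> y \<longleftrightarrow> x = y"
proof
  assume "c \<bullet> x = c \<bullet> y"
  then have "inverse c \<bullet> c \<bullet> x = inverse c \<bullet> c \<bullet> y" by (simp only:)
  then show "x = y" using assms by simp
qed simp

lemma smul_eq_zero: assumes "c \<noteq> 0" shows "c \<bullet> x = 0 \<longleftrightarrow> x = 0"
  using smul_cancel[OF assms, of x 0] by simp

lemma sum_smul: "(\<Sum>i\<in>A. c \<bullet> g i) = c \<bullet> sum g A"
  by (induction A rule: infinite_finite_induct) (simp_all add: smul_add_right)

lemmas smul_simps = smul_add_right smul_add_left smul_diff_right smul_diff_left

end

text \<open>A normal form for equations between noncommutative polynomials: products associate to
  the right, sums are expanded, and differences are moved across the equation, so that both sides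
  become sums that are compared up to order.\<close>

lemmas nc_simps =
  mult.assoc[where 'a = "'b::ratfun_algebra"]
  distrib_left[where 'a = "'b::ratfun_algebra"] distrib_right[where 'a = "'b::ratfun_algebra"]
  left_diff_distrib[where 'a = "'b::ratfun_algebra"] right_diff_distrib[where 'a = "'b::ratfun_algebra"]
  smul_add_right smul_diff_right
  add.assoc[where 'a = "'b::ratfun_algebra"] add.commute[where 'a = "'b::ratfun_algebra"]
  add.left_commute[where 'a = "'b::ratfun_algebra"] diff_diff_eq[where 'a = "'b::ratfun_algebra"]
  diff_add_eq[where 'a = "'b::ratfun_algebra"] add_diff_eq[where 'a = "'b::ratfun_algebra"]
  diff_eq_eq[where 'a = "'b::ratfun_algebra"] eq_diff_eq[where 'a = "'b::ratfun_algebra"]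
  diff_diff_eq2[where 'a = "'b::ratfun_algebra"]

text \<open>Lets a relation for \<open>a * b\<close> rewrite inside a product that associates to the
  right, where \<open>a * b\<close> is not a subterm.\<close>

lemma assoc_subst: "a * b = c \<Longrightarrow> a * (b * x) = c * (x::'a::semigroup_mult)"
  by (simp flip: mult.assoc)

text \<open>A copy of the type is needed for the opposite algebra, since a type carries only one
  multiplication as a class instance.\<close>

datatype 'a opp = Opp (unop: 'a)

instantiation opp :: (ratfun_algebra) ratfun_algebra
begin

definition zero_opp :: "'a opp" where "0 = Opp 0"
definition one_opp :: "'a opp" where "1 = Opp 1"
definition plus_opp :: "'a opp \<Rightarrow> 'a opp \<Rightarrow> 'a opp" where "x + y = Opp (unop x + unop y)"
definition minus_opp :: "'a opp \<Rightarrow> 'a opp \<Rightarrow> 'a opp" where "x - y = Opp (unop x - unop y)"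
definition uminus_opp :: "'a opp \<Rightarrow> 'a opp" where "- x = Opp (- unop x)"
definition times_opp :: "'a opp \<Rightarrow> 'a opp \<Rightarrow> 'a opp" where "x * y = Opp (unop y * unop x)"
definition smul_opp :: "ratfun \<Rightarrow> 'a opp \<Rightarrow> 'a opp" where "c \<bullet> x = Opp (c \<bullet> unop x)"

instance
  by standard (simp_all add: zero_opp_def one_opp_def plus_opp_def minus_opp_def uminus_opp_def
      times_opp_def smul_opp_def opp.expand mult.assoc distrib_left distrib_right smul_simps)

end

lemma unop_simps [simp]:
  "unop 0 = 0" "unop 1 = 1" "unop (x + y) = unop x + unop y" "unop (x - y) = unop x - unop y"
  "unop (- x) = - unop x" "unop (x * y) = unop y * unop x" "unop (c \<bullet> x) = c \<bullet> unop x"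
  by (simp_all add: zero_opp_def one_opp_def plus_opp_def minus_opp_def uminus_opp_def
      times_opp_def smul_opp_def)

lemma opp_eq_iff: "x = y \<longleftrightarrow> unop x = unop y"
  by (cases x; cases y) simp

section \<open>Strings of $q$-commutators\<close>

lemma commute_mult: "x * a = a * x \<Longrightarrow> x * b = b * x \<Longrightarrow> x * (a * b) = a * b * (x::'a::semigroup_mult)"
  by (metis mult.assoc)

text \<open>Both products in the bracket pick up the same scalar, whatever \<open>c\<close> is. This
  settles the induction step for strings of brackets whenever \<open>x\<close> q-commutes with every
  new factor.\<close>

lemma q_commute_bracket:
  fixes x p v k :: "'a::ratfun_algebra"
  assumes p: "x * p = \<alpha> \<bullet> (p * x)" and v: "x * v = \<beta> \<bullet> (v * x)" and k: "x * k = \<gamma> \<bullet> (k * x)"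
  shows "x * ((c \<bullet> (p * v) - v * p) * k) = (\<alpha> * \<beta> * \<gamma>) \<bullet> (((c \<bullet> (p * v) - v * p) * k) * x)"
  by (simp add: p v k assoc_subst[OF p] assoc_subst[OF v] assoc_subst[OF k]
      mult.assoc left_diff_distrib right_diff_distrib smul_diff_right mult_ac)

lemma commute_inverse:
  fixes x k ki :: "'a::ratfun_algebra"
  assumes kx: "k * x = c \<bullet> (x * k)" and k1: "k * ki = 1" and k2: "ki * k = 1" and c: "c \<noteq> 0"
  shows "ki * x = inverse c \<bullet> (x * ki)"
proof -
  have "ki * (k * x) * ki = c \<bullet> (ki * x * (k * ki))"
    by (simp add: kx mult.assoc)
  then have "x * ki = c \<bullet> (ki * x)" by (simp add: k1 k2 flip: mult.assoc)
  then show ?thesis using c by simp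
qed

text \<open>In a string of three neighbouring nodes the middle generator commutes with the double
  commutator.\<close>

lemma serre_middle:
  fixes x y w :: "'a::ratfun_algebra"
  assumes wy: "w * y = y * w"
    and xw: "x * x * w = (1 + r) \<bullet> (x * w * x) - r \<bullet> (w * x * x)"
    and xy: "y * x * x = (1 + r) \<bullet> (x * y * x) - r \<bullet> (x * x * y)"
    and r: "1 + r \<noteq> 0"
  shows "x * (y * (x * w - w * x) - (x * w - w * x) * y) = (y * (x * w - w * x) - (x * w - w * x) * y) * x"
proof -
  have wy': "w * (y * t) = y * (w * t)" for t by (simp add: wy flip: mult.assoc)
  note n = mult.assoc wy wy' left_diff_distrib right_diff_distrib
  let ?D = "x * (y * (x * w - w * x) - (x * w - w * x) * y) - (y * (x * w - w * x) - (x * w - w * x) * y) * x"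
  \<comment> \<open>Let S be the last difference. By the Serre relations, 1 + r times the first
    difference is r S and 1 + r times the second is S, so that the three cancel.\<close>
  have D: "?D = (x*y*x*w - y*x*w*x) + (x*w*x*y - w*x*y*x) - (x*x*w*y - w*y*x*x)"
    by (simp add: n)
  have "(1 + r) \<bullet> (x*y*x*w) - r \<bullet> (x*x*y*w) = (1 + r) \<bullet> (y*x*w*x) - r \<bullet> (y*w*x*x)"
    using arg_cong[OF xy, of "\<lambda>t. t * w"] arg_cong[OF xw, of "\<lambda>t. y * t"]
    by (simp add: mult.assoc left_diff_distrib right_diff_distrib)
  then have 1: "(1 + r) \<bullet> (x*y*x*w - y*x*w*x) = r \<bullet> (x*x*w*y - w*y*x*x)"
    by (simp add: smul_diff_right n algebra_simps)
  have 2: "(1 + r) \<bullet> (x*w*x*y - w*x*y*x) = x*x*w*y - w*y*x*x"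
  proof -
    have "x*x*w*y + r \<bullet> (w*x*x*y) = (1 + r) \<bullet> (x*w*x*y)" "w*y*x*x + r \<bullet> (w*x*x*y) = (1 + r) \<bullet> (w*x*y*x)"
      using arg_cong[OF xw, of "\<lambda>t. t * y"] arg_cong[OF xy, of "\<lambda>t. w * t"]
      by (simp_all add: mult.assoc left_diff_distrib right_diff_distrib)
    then have "(1 + r) \<bullet> (x*w*x*y) - (1 + r) \<bullet> (w*x*y*x) = x*x*w*y - w*y*x*x"
      by (metis add_diff_cancel_right)
    then show ?thesis by (simp only: smul_diff_right)
  qed
  have "(1 + r) \<bullet> ?D = 0"
    unfolding D smul_diff_right smul_add_right[of _ "_ - _"] 1[unfolded smul_diff_right] 2[unfolded smul_diff_right]
    by (simp add: smul_simps 1[unfolded smul_diff_right] 2[unfolded smul_diff_right])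
  then have "?D = 0" by (simp only: smul_eq_zero[OF r])
  then show ?thesis by (simp only: right_minus_eq)
qed

text \<open>One locale serves the even part, with \<open>G = K\<close>, \<open>X = z \<bullet> f\<close>, \<open>Y = 0\<close>, and the odd part, with \<open>G\<close>,
  \<open>X\<close>, \<open>Y\<close> equal to \<open>- z\<close> times $k_{\bar a}$, $f_{\bar a}$, $e_{\bar a}$. Below, \<open>V a b\<close> is going to be the
  matrix entry $L_{a,b}$ in the first and $L_{-a,b}$ in the second case.\<close>

locale strand =
  fixes q z :: ratfun and n :: int and K Ki f e G X Y :: "int \<Rightarrow> 'a::ratfun_algebra"
  assumes q0 [simp]: "q \<noteq> 0" and z: "z = q - inverse q" and z0 [simp]: "z \<noteq> 0" and q2: "1 + q * q \<noteq> 0"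
    and K_Ki: "\<lbrakk>1 \<le> m; m \<le> n\<rbrakk> \<Longrightarrow> K m * Ki m = 1"
    and Ki_K: "\<lbrakk>1 \<le> m; m \<le> n\<rbrakk> \<Longrightarrow> Ki m * K m = 1"
    and K_K: "\<lbrakk>1 \<le> m; m \<le> n; 1 \<le> i; i \<le> n\<rbrakk> \<Longrightarrow> K m * K i = K i * K m"
    and K_f: "\<lbrakk>1 \<le> m; m \<le> n; 1 \<le> i; i < n\<rbrakk> \<Longrightarrow>
      K m * f i = (if m = i then inverse q else if m = i + 1 then q else 1) \<bullet> (f i * K m)"
    and K_e: "\<lbrakk>1 \<le> m; m \<le> n; 1 \<le> i; i < n\<rbrakk> \<Longrightarrow>
      K m * e i = (if m = i then q else if m = i + 1 then inverse q else 1) \<bullet> (e i * K m)"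
    and K_G: "\<lbrakk>1 \<le> m; m \<le> n; 1 \<le> a; a \<le> n\<rbrakk> \<Longrightarrow> K m * G a = G a * K m"
    and G_f: "\<lbrakk>1 \<le> a; a < n\<rbrakk> \<Longrightarrow> X a * K a = q \<bullet> (f a * G a) - G a * f a"
    and G_f_dn: "\<lbrakk>1 \<le> a; a < n\<rbrakk> \<Longrightarrow> q \<bullet> (G (a + 1) * f a) = f a * G (a + 1) + K (a + 1) * X a"
    and G_f_far: "\<lbrakk>1 \<le> a; a \<le> n; 1 \<le> i; i < n; a \<noteq> i; a \<noteq> i + 1\<rbrakk> \<Longrightarrow> f i * G a = G a * f i"
    and X_f: "\<lbrakk>1 \<le> a; a < n\<rbrakk> \<Longrightarrow> X a * f a = f a * X a"
    and X_f_next: "\<lbrakk>1 \<le> a; a + 1 < n\<rbrakk> \<Longrightarrow>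
      f (a + 1) * X a - X a * f (a + 1) = X (a + 1) * f a - f a * X (a + 1)"
    and f_f_far: "\<lbrakk>1 \<le> a; a < n; 1 \<le> i; i < n; \<bar>a - i\<bar> > 1\<rbrakk> \<Longrightarrow> f i * f a = f a * f i"
    and serre_dn: "\<lbrakk>1 \<le> a; a + 1 < n\<rbrakk> \<Longrightarrow>
      X (a + 1) * f a * f a = (1 + q * q) \<bullet> (f a * X (a + 1) * f a) - (q * q) \<bullet> (f a * f a * X (a + 1))"
    and serre_dn_f: "\<lbrakk>1 \<le> a; a + 1 < n\<rbrakk> \<Longrightarrow>
      f (a + 1) * f a * f a = (1 + q * q) \<bullet> (f a * f (a + 1) * f a) - (q * q) \<bullet> (f a * f a * f (a + 1))"
    and serre_up: "\<lbrakk>1 \<le> a; a + 1 < n\<rbrakk> \<Longrightarrow>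
      f (a + 1) * f (a + 1) * X a = (1 + q * q) \<bullet> (f (a + 1) * X a * f (a + 1)) - (q * q) \<bullet> (X a * f (a + 1) * f (a + 1))"
    and serre_up_f: "\<lbrakk>1 \<le> a; a + 1 < n\<rbrakk> \<Longrightarrow>
      f (a + 1) * f (a + 1) * f a = (1 + q * q) \<bullet> (f (a + 1) * f a * f (a + 1)) - (q * q) \<bullet> (f a * f (a + 1) * f (a + 1))"
    and e_G: "\<lbrakk>1 \<le> a; a < n\<rbrakk> \<Longrightarrow> inverse q \<bullet> (G a * e a) = e a * G a + Ki a * Y a"
    and e_G_dn: "\<lbrakk>1 \<le> a; a < n\<rbrakk> \<Longrightarrow> G (a + 1) * e a + Y a * Ki (a + 1) = inverse q \<bullet> (e a * G (a + 1))"
    and e_G_far: "\<lbrakk>1 \<le> a; a \<le> n; 1 \<le> i; i < n; a \<noteq> i; a \<noteq> i + 1\<rbrakk> \<Longrightarrow> e i * G a = G a * e i"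
    and e_X: "\<lbrakk>1 \<le> a; a < n\<rbrakk> \<Longrightarrow> X a * e a + G a * Ki (a + 1) = e a * X a + Ki a * G (a + 1)"
    and e_X_up: "\<lbrakk>1 \<le> a; a + 1 < n\<rbrakk> \<Longrightarrow> e (a + 1) * X a = inverse q \<bullet> (X a * e (a + 1))"
    and e_X_dn: "\<lbrakk>1 \<le> a; a + 1 < n\<rbrakk> \<Longrightarrow> e a * X (a + 1) = q \<bullet> (X (a + 1) * e a)"
    and e_f: "\<lbrakk>1 \<le> a; a < n\<rbrakk> \<Longrightarrow> e a * f a = f a * e a + inverse z \<bullet> (K a * Ki (a + 1) - Ki a * K (a + 1))"
    and e_f_up: "\<lbrakk>1 \<le> a; a + 1 < n\<rbrakk> \<Longrightarrow> e (a + 1) * f a = inverse q \<bullet> (f a * e (a + 1))"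
    and e_f_dn: "\<lbrakk>1 \<le> a; a + 1 < n\<rbrakk> \<Longrightarrow> e a * f (a + 1) = q \<bullet> (f (a + 1) * e a)"
    and e_f_far: "\<lbrakk>1 \<le> a; a < n; 1 \<le> i; i < n; \<bar>a - i\<bar> > 1\<rbrakk> \<Longrightarrow> e i * f a = f a * e i"
begin

section \<open>Strings of brackets and their commutation with K, f and e\<close>

primrec U :: "int \<Rightarrow> nat \<Rightarrow> 'a" where
  "U a 0 = G a"
| "U a (Suc d) = ((if d = 0 then q else 1) \<bullet> (f (a + int d) * U a d) - U a d * f (a + int d)) * Ki (a + int d)"

text \<open>\<open>U\<close> counts the distance from the diagonal in order to be primitive
  recursive. For b < a truncation would make \<open>V a b\<close> equal to \<open>G a\<close>, so
  only a \<le> b is meaningful.\<close>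

definition V :: "int \<Rightarrow> int \<Rightarrow> 'a" where
  "V a b = U a (nat (b - a))"

lemma V_refl [simp]: "V a a = G a"
  by (simp add: V_def)

lemma V_Suc: "a \<le> b \<Longrightarrow> V a (b + 1) = ((if a = b then q else 1) \<bullet> (f b * V a b) - V a b * f b) * Ki b"
proof -
  assume "a \<le> b"
  then have "nat (b + 1 - a) = Suc (nat (b - a))" "a + int (nat (b - a)) = b" by simp_all
  with \<open>a \<le> b\<close> show ?thesis by (auto simp: V_def)
qed

lemma qq [simp]: "q * inverse q = 1" "inverse q * q = 1" "q * (inverse q * c) = c" "inverse q * (q * c) = c"
  by (simp_all add: mult.assoc[symmetric] del: mult.assoc)

lemma Ki_commute:
  assumes "1 \<le> m" "m \<le> n" "K m * x = c \<bullet> (x * K m)" "c \<noteq> 0"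
  shows "Ki m * x = inverse c \<bullet> (x * Ki m)"
  using commute_inverse[OF assms(3) K_Ki Ki_K] assms by blast

lemma K_Kii: "\<lbrakk>1 \<le> m; m \<le> n; 1 \<le> i; i \<le> n\<rbrakk> \<Longrightarrow> K m * Ki i = Ki i * K m"
  using Ki_commute[of i "K m" 1] K_K by simp

lemma Ki_Ki: "\<lbrakk>1 \<le> m; m \<le> n; 1 \<le> i; i \<le> n\<rbrakk> \<Longrightarrow> Ki m * Ki i = Ki i * Ki m"
  using Ki_commute[of m "Ki i" 1] K_Kii[of m i] by simp

lemma Ki_f: "\<lbrakk>1 \<le> m; m \<le> n; 1 \<le> i; i < n\<rbrakk> \<Longrightarrow>
    Ki m * f i = (if m = i then q else if m = i + 1 then inverse q else 1) \<bullet> (f i * Ki m)"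
  using Ki_commute[OF _ _ K_f[of m i]] by (simp split: if_splits)

lemma Ki_e: "\<lbrakk>1 \<le> m; m \<le> n; 1 \<le> i; i < n\<rbrakk> \<Longrightarrow>
    Ki m * e i = (if m = i then inverse q else if m = i + 1 then q else 1) \<bullet> (e i * Ki m)"
  using Ki_commute[OF _ _ K_e[of m i]] by (simp split: if_splits)

lemma f_Ki: "\<lbrakk>1 \<le> m; m \<le> n; 1 \<le> i; i < n\<rbrakk> \<Longrightarrow>
    f i * Ki m = (if m = i then inverse q else if m = i + 1 then q else 1) \<bullet> (Ki m * f i)"
  using Ki_f[of m i] by (simp split: if_splits)

lemma e_Ki: "\<lbrakk>1 \<le> m; m \<le> n; 1 \<le> i; i < n\<rbrakk> \<Longrightarrow>
    e i * Ki m = (if m = i then q else if m = i + 1 then inverse q else 1) \<bullet> (Ki m * e i)"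
  using Ki_e[of m i] by (simp split: if_splits)

lemma V_X: "\<lbrakk>1 \<le> a; a < n\<rbrakk> \<Longrightarrow> V a (a + 1) = X a"
proof -
  assume a: "1 \<le> a" "a < n"
  then have "V a (a + 1) = X a * K a * Ki a" by (simp add: V_Suc G_f)
  then show ?thesis using a by (simp add: mult.assoc K_Ki)
qed

lemma f_V_next: "\<lbrakk>1 \<le> a; a \<le> b; b < n\<rbrakk> \<Longrightarrow>
    V a (b + 1) * K b = (if a = b then q else 1) \<bullet> (f b * V a b) - V a b * f b"
  by (simp add: V_Suc mult.assoc Ki_K)

text \<open>This is q to the value of the weight eps_b - eps_a at k_m; for m = a = b the two factors
  cancel.\<close>

definition wt :: "int \<Rightarrow> int \<Rightarrow> int \<Rightarrow> ratfun" where
  "wt m a b = (if m = b then q else 1) * (if m = a then inverse q else 1)"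

lemma wt_nz [simp]: "wt m a b \<noteq> 0"
  by (simp add: wt_def)

lemma K_V:
  assumes "a \<le> b" "1 \<le> m" "m \<le> n" "1 \<le> a" "b \<le> n"
  shows "K m * V a b = wt m a b \<bullet> (V a b * K m)"
  using assms(1,5)
proof (induction b rule: int_ge_induct)
  case base
  then show ?case using assms by (simp add: wt_def K_G)
next
  case (step b)
  have "K m * Ki b = 1 \<bullet> (Ki b * K m)" "K m * V a b = wt m a b \<bullet> (V a b * K m)"
    using assms step by (simp_all add: K_Kii)
  from q_commute_bracket[OF K_f this(2,1)] show ?case
    unfolding V_Suc[OF step.hyps] using assms step by (auto simp: wt_def)
qed

lemma Ki_V:
  assumes "a \<le> b" "1 \<le> m" "m \<le> n" "1 \<le> a" "b \<le> n"
  shows "Ki m * V a b = inverse (wt m a b) \<bullet> (V a b * Ki m)"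
  by (rule Ki_commute) (use assms in \<open>auto simp: K_V\<close>)

text \<open>Node \<open>m\<close> neither belongs to the string nor is adjacent to one of its nodes,
  so every factor of the recursion commutes. The next three lemmas hold for the same reason.\<close>

lemma f_V_lt:
  assumes "a \<le> b" "1 \<le> m" "m < a - 1" "b \<le> n"
  shows "f m * V a b = V a b * f m"
  using assms(1,4)
proof (induction b rule: int_ge_induct)
  case base
  then show ?case using assms by (simp add: G_f_far)
next
  case (step b)
  have "f m * f b = 1 \<bullet> (f b * f m)" "f m * V a b = 1 \<bullet> (V a b * f m)" "f m * Ki b = 1 \<bullet> (Ki b * f m)"
    using step assms by (simp_all add: f_f_far f_Ki)
  from q_commute_bracket[OF this, of "if a = b then q else 1"] show ?case using step by (simp add: V_Suc)
qed

lemma f_V_gt: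
  assumes "a \<le> b" "b < m" "m < n" "1 \<le> a"
  shows "f m * V a b = V a b * f m"
  using assms(1,2)
proof (induction b rule: int_ge_induct)
  case base
  then show ?case using assms by (simp add: G_f_far)
next
  case (step b)
  have "f m * f b = 1 \<bullet> (f b * f m)" "f m * V a b = 1 \<bullet> (V a b * f m)" "f m * Ki b = 1 \<bullet> (Ki b * f m)"
    using step assms by (simp_all add: f_f_far f_Ki)
  from q_commute_bracket[OF this, of "if a = b then q else 1"] show ?case using step by (simp add: V_Suc)
qed

lemma e_V_lt:
  assumes "a \<le> b" "1 \<le> m" "m < a - 1" "b \<le> n"
  shows "e m * V a b = V a b * e m"
  using assms(1,4)
proof (induction b rule: int_ge_induct)
  case base
  then show ?case using assms by (simp add: e_G_far)
next
  case (step b)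
  have "e m * f b = 1 \<bullet> (f b * e m)" "e m * V a b = 1 \<bullet> (V a b * e m)" "e m * Ki b = 1 \<bullet> (Ki b * e m)"
    using step assms by (simp_all add: e_f_far e_Ki)
  from q_commute_bracket[OF this, of "if a = b then q else 1"] show ?case using step by (simp add: V_Suc)
qed

lemma e_V_gt:
  assumes "a \<le> b" "b < m" "m < n" "1 \<le> a"
  shows "e m * V a b = V a b * e m"
  using assms(1,2)
proof (induction b rule: int_ge_induct)
  case base
  then show ?case using assms by (simp add: e_G_far)
next
  case (step b)
  have "e m * f b = 1 \<bullet> (f b * e m)" "e m * V a b = 1 \<bullet> (V a b * e m)" "e m * Ki b = 1 \<bullet> (Ki b * e m)"
    using step assms by (simp_all add: e_f_far e_Ki)
  from q_commute_bracket[OF this, of "if a = b then q else 1"] show ?case using step by (simp add: V_Suc)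
qed

text \<open>The factor q^{-1} comes from the last node \<open>b - 1\<close> alone, since
  \<open>e b\<close> commutes with the shorter string. For a string with one node it is
  \<open>e_X_up\<close>.\<close>

lemma e_V_at:
  assumes "a < b" "b < n" "1 \<le> a"
  shows "e b * V a b = inverse q \<bullet> (V a b * e b)"
proof (cases "b = a + 1")
  case True
  then show ?thesis using assms by (simp add: V_X e_X_up)
next
  case False
  define c where "c = b - 1"
  have b: "b = c + 1" and c: "a < c" using False assms by (auto simp: c_def)
  have "e b * f c = inverse q \<bullet> (f c * e b)" "e b * V a c = 1 \<bullet> (V a c * e b)" "e b * Ki c = 1 \<bullet> (Ki c * e b)"
    using assms c by (simp_all add: b e_f_up e_V_gt e_Ki)
  from q_commute_bracket[OF this, of 1] show ?thesis using c by (simp add: V_Suc b)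
qed

text \<open>The factor q arises at the first node, by \<open>e_X_dn\<close>; the later nodes are not
  adjacent to \<open>a\<close>.\<close>

lemma e_V_prev:
  assumes "a + 1 < b" "b \<le> n" "1 \<le> a"
  shows "e a * V (a + 1) b = q \<bullet> (V (a + 1) b * e a)"
proof -
  have "a + 2 \<le> b" using assms by simp
  then show ?thesis using assms(2)
  proof (induction b rule: int_ge_induct)
    case base
    then show ?case using assms V_X[of "a + 1"] by (simp add: e_X_dn add.assoc)
  next
    case (step b)
    have "e a * f b = 1 \<bullet> (f b * e a)" "e a * V (a + 1) b = q \<bullet> (V (a + 1) b * e a)"
      "e a * Ki b = 1 \<bullet> (Ki b * e a)"
      using step assms by (simp_all add: e_f_far e_Ki)
    from q_commute_bracket[OF this, of 1] show ?case using step by (simp add: V_Suc)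
  qed
qed

text \<open>Against the last node \<open>f b\<close>, the generator \<open>e b\<close> leaves a
  Cartan term, and this strips the node from the string.\<close>

lemma e_V_last:
  assumes "1 \<le> a" "a < b" "b < n"
  shows "V a (b + 1) * e b + V a b * Ki (b + 1) = e b * V a (b + 1)"
proof -
  define v where "v = V a b"
  let ?H = "K b * Ki (b + 1) - Ki b * K (b + 1)"
  have Kv: "K b * v = q \<bullet> (v * K b)" "Ki b * v = inverse q \<bullet> (v * Ki b)"
    "K (b + 1) * v = v * K (b + 1)" "Ki (b + 1) * v = v * Ki (b + 1)"
    using assms by (simp_all add: v_def K_V Ki_V wt_def)
  \<comment> \<open>The second summand of \<open>?H\<close> passes \<open>v\<close> with the factor
    q^{-1} and drops out. The first passes with the factor q and leaves q - q^{-1} = z, which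
    cancels the denominator in \<open>e_f\<close>.\<close>
  have "?H * v - inverse q \<bullet> (v * ?H) = z \<bullet> (v * (K b * Ki (b + 1)))"
    by (simp add: z left_diff_distrib right_diff_distrib mult.assoc Kv
        assoc_subst[OF Kv(1)] assoc_subst[OF Kv(2)] smul_diff_right smul_diff_left)
  then have H: "inverse z \<bullet> (?H * v) = inverse q \<bullet> inverse z \<bullet> (v * ?H) + v * (K b * Ki (b + 1))"
    by (simp add: diff_eq_eq smul_add_right smul_diff_right mult.commute)
  have Kb: "K b * (Ki b * Ki (b + 1)) = Ki (b + 1)"
    using assms by (simp add: K_Ki flip: mult.assoc)
  have Kb': "K b * (Ki (b + 1) * Ki b) = Ki (b + 1)"
    using assms Kb Ki_Ki[of "b + 1" b] by simp
  have ev: "e b * v = inverse q \<bullet> (v * e b)" using assms by (simp add: v_def e_V_at)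
  have ef: "e b * f b = f b * e b + inverse z \<bullet> ?H" using assms by (simp add: e_f)
  have "e b * ((f b * v - v * f b) * Ki b) =
    (f b * (e b * v) + inverse z \<bullet> (?H * v) - inverse q \<bullet> (v * (e b * f b))) * Ki b"
    by (simp add: right_diff_distrib left_diff_distrib distrib_right mult.assoc ef assoc_subst[OF ef]
        assoc_subst[OF ev] smul_diff_right)
  also have "\<dots> = inverse q \<bullet> ((f b * v - v * f b) * (e b * Ki b)) + v * Ki (b + 1)"
    unfolding H ev ef by (simp add: nc_simps Kb')
  also have "e b * Ki b = q \<bullet> (Ki b * e b)" using assms by (simp add: e_Ki)
  finally show ?thesis using assms by (simp add: V_Suc v_def mult.assoc)
qed

text \<open>Here the first node is stripped. For b = a + 2 the relation \<open>e_X\<close> produces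
  \<open>G (a + 1)\<close> and \<open>G a\<close>; the part with \<open>G a\<close> cancels in the
  bracket because \<open>f (a + 1)\<close> commutes with \<open>G a\<close>.\<close>

lemma e_V_first:
  assumes "1 \<le> a" "a + 1 < b" "b \<le> n"
  shows "V a b * e a = e a * V a b + Ki a * V (a + 1) b"
proof -
  have "a + 2 \<le> b" using assms by simp
  then show ?thesis using assms(3)
  proof (induction b rule: int_ge_induct)
    case base
    have r: "f (a + 1) * e a = inverse q \<bullet> (e a * f (a + 1))"
      "X a * e a = e a * X a + Ki a * G (a + 1) - G a * Ki (a + 1)"
      "Ki (a + 1) * e a = q \<bullet> (e a * Ki (a + 1))" "f (a + 1) * G a = G a * f (a + 1)"
      "f (a + 1) * Ki a = Ki a * f (a + 1)" "Ki (a + 1) * f (a + 1) = q \<bullet> (f (a + 1) * Ki (a + 1))"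
      using assms base by (simp_all add: e_f_dn Ki_e Ki_f G_f_far eq_diff_eq e_X)
    have V: "V a (a + 2) = (f (a + 1) * X a - X a * f (a + 1)) * Ki (a + 1)"
      "V (a + 1) (a + 2) = (q \<bullet> (f (a + 1) * G (a + 1)) - G (a + 1) * f (a + 1)) * Ki (a + 1)"
      using V_Suc[of a "a + 1"] V_Suc[of "a + 1" "a + 1"] V_X[of a] assms base by (simp_all add: add.assoc)
    show ?case
      unfolding V by (simp add: r r[THEN assoc_subst] nc_simps)
  next
    case (step b)
    have r: "f b * e a = e a * f b" "V a b * e a = e a * V a b + Ki a * V (a + 1) b"
      "Ki b * e a = e a * Ki b" "f b * Ki a = Ki a * f b"
      using assms step by (simp_all add: e_f_far Ki_e Ki_f)
    show ?case using step by (simp add: V_Suc r r[THEN assoc_subst] nc_simps)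
  qed
qed

text \<open>Before node \<open>m + 1\<close> is added, \<open>e m\<close> produces
  \<open>V a m\<close> by \<open>e_V_last\<close>. This term cancels in the next bracket because
  \<open>f (m + 1)\<close> commutes with \<open>V a m\<close>.\<close>

lemma e_V_mid:
  assumes "1 \<le> a" "a < m" "m + 1 < b" "b \<le> n"
  shows "e m * V a b = V a b * e m"
proof -
  have "m + 2 \<le> b" using assms by simp
  then show ?thesis using assms(4)
  proof (induction b rule: int_ge_induct)
    case base
    have r: "e m * f (m + 1) = q \<bullet> (f (m + 1) * e m)"
      "e m * V a (m + 1) = V a (m + 1) * e m + V a m * Ki (m + 1)"
      "e m * Ki (m + 1) = inverse q \<bullet> (Ki (m + 1) * e m)" "f (m + 1) * V a m = V a m * f (m + 1)"
      "Ki (m + 1) * f (m + 1) = q \<bullet> (f (m + 1) * Ki (m + 1))"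
      using assms base by (simp_all add: e_f_dn e_Ki Ki_f f_V_gt e_V_last)
    have V: "V a (m + 2) = (f (m + 1) * V a (m + 1) - V a (m + 1) * f (m + 1)) * Ki (m + 1)"
      using V_Suc[of a "m + 1"] assms base by (simp add: add.assoc)
    show ?case
      unfolding V by (simp add: r r[THEN assoc_subst] nc_simps)
  next
    case (step b)
    have "e m * f b = 1 \<bullet> (f b * e m)" "e m * V a b = 1 \<bullet> (V a b * e m)" "e m * Ki b = 1 \<bullet> (Ki b * e m)"
      using step assms by (simp_all add: e_f_far e_Ki)
    from q_commute_bracket[OF this, of 1] show ?case using step assms by (simp add: V_Suc)
  qed
qed

text \<open>The recursion lengthens strings on the right; here one is lengthened on the left. For b
  = a + 2 the two ways of bracketing agree by \<open>X_f_next\<close>, and afterwards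
  \<open>f b\<close> commutes with \<open>f a\<close> and \<open>K (a + 1)\<close>.\<close>

lemma f_V_prev:
  assumes "1 \<le> a" "a + 1 < b" "b \<le> n"
  shows "V (a + 1) b * f a = f a * V (a + 1) b + K (a + 1) * V a b"
proof -
  have "a + 2 \<le> b" using assms by simp
  then show ?thesis using assms(3)
  proof (induction b rule: int_ge_induct)
    case base
    have V: "V a (a + 2) * K (a + 1) = X (a + 1) * f a - f a * X (a + 1)"
      using f_V_next[of a "a + 1"] V_X[of a] X_f_next[of a] assms base by (simp add: add.assoc)
    have "K (a + 1) * V a (a + 2) = X (a + 1) * f a - f a * X (a + 1)"
      using assms base by (subst K_V) (simp_all add: V wt_def)
    then show ?case using V_X[of "a + 1"] assms base by (simp add: add.assoc)
  next
    case (step b)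
    have r: "f b * f a = f a * f b" "V (a + 1) b * f a = f a * V (a + 1) b + K (a + 1) * V a b"
      "Ki b * f a = f a * Ki b" "f b * K (a + 1) = K (a + 1) * f b"
      using assms step by (simp_all add: f_f_far K_f Ki_f)
    show ?case using step by (simp add: V_Suc r r[THEN assoc_subst] nc_simps)
  qed
qed

text \<open>In a string with more than one node, \<open>f b\<close> commutes with every factor
  except the last node \<open>f (b - 1)\<close>, and for these two the relation is
  \<open>serre_up_f\<close>.\<close>

lemma serre_V:
  assumes "1 \<le> a" "a < b" "b < n"
  shows "f b * f b * V a b = (1 + q * q) \<bullet> (f b * V a b * f b) - (q * q) \<bullet> (V a b * f b * f b)"
proof (cases "b = a + 1")
  case True
  then show ?thesis using assms by (simp add: V_X serre_up)
next
  case False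
  define c where "c = b - 1"
  have b: "b = c + 1" and c: "a < c" using False assms by (auto simp: c_def)
  have r: "Ki c * f b = f b * Ki c" "f b * V a c = V a c * f b"
    using assms c b by (simp_all add: Ki_f f_V_gt)
  have s: "f b * (f b * f c) = (1 + q * q) \<bullet> (f b * (f c * f b)) - (q * q) \<bullet> (f c * (f b * f b))"
    using serre_up_f[of c] assms c b by (simp add: mult.assoc)
  have s': "f b * (f b * (f c * t)) = (1 + q * q) \<bullet> (f b * (f c * (f b * t))) - (q * q) \<bullet> (f c * (f b * (f b * t)))" for t
    using arg_cong[OF s, of "\<lambda>u. u * t"] by (simp add: mult.assoc left_diff_distrib)
  have Vb: "V a b = (f c * V a c - V a c * f c) * Ki c"
    using c by (simp add: b V_Suc)
  show ?thesis
    unfolding Vb by (simp add: r r[THEN assoc_subst] s s' mult.assoc left_diff_distrib right_diff_distrib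
        smul_diff_right)
qed

text \<open>With \<open>V a (b + 1)\<close> written as a bracket and \<open>Ki b\<close> moved past
  \<open>f b\<close>, this is \<open>serre_V\<close> rearranged.\<close>

lemma f_V_last:
  assumes "1 \<le> a" "a < b" "b < n"
  shows "q \<bullet> (V a (b + 1) * f b) = f b * V a (b + 1)"
proof -
  have r: "Ki b * f b = q \<bullet> (f b * Ki b)" using assms by (simp add: Ki_f)
  note s = serre_V[OF assms, unfolded mult.assoc]
  have s': "f b * (f b * (V a b * t)) = (1 + q * q) \<bullet> (f b * (V a b * (f b * t))) - (q * q) \<bullet> (V a b * (f b * (f b * t)))" for t
    using arg_cong[OF s, of "\<lambda>u. u * t"] by (simp add: mult.assoc left_diff_distrib)
  show ?thesis using assms
    by (simp add: V_Suc r s s' mult.assoc left_diff_distrib right_diff_distrib smul_diff_right smul_add_left)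
qed

text \<open>By \<open>X_f_next\<close> the string with the nodes a and a + 1 is also a bracket with
  \<open>f a\<close> as the outer factor, and \<open>serre_dn\<close> applies to it.\<close>

lemma f_V_first:
  assumes "1 \<le> a" "a + 1 < b" "b \<le> n"
  shows "f a * V a b = inverse q \<bullet> (V a b * f a)"
proof -
  have "a + 2 \<le> b" using assms by simp
  then show ?thesis using assms(3)
  proof (induction b rule: int_ge_induct)
    case base
    have V: "V a (a + 2) = (X (a + 1) * f a - f a * X (a + 1)) * Ki (a + 1)"
      using V_Suc[of a "a + 1"] V_X[of a] X_f_next[of a] assms base by (simp add: add.assoc)
    have r: "Ki (a + 1) * f a = inverse q \<bullet> (f a * Ki (a + 1))"
      using assms base by (simp add: Ki_f)
    have s: "X (a + 1) * (f a * f a) = (1 + q * q) \<bullet> (f a * (X (a + 1) * f a)) - (q * q) \<bullet> (f a * (f a * X (a + 1)))"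
      using serre_dn[of a] assms base by (simp add: mult.assoc)
    have s': "X (a + 1) * (f a * (f a * t)) = (1 + q * q) \<bullet> (f a * (X (a + 1) * (f a * t))) - (q * q) \<bullet> (f a * (f a * (X (a + 1) * t)))" for t
      using arg_cong[OF s, of "\<lambda>u. u * t"] by (simp add: mult.assoc left_diff_distrib)
    have "V a (a + 2) * f a = q \<bullet> (f a * V a (a + 2))"
      unfolding V by (simp add: r s' mult.assoc left_diff_distrib right_diff_distrib
        smul_diff_right smul_add_left distrib_left mult_ac smul_add_right)
    then show ?case by simp
  next
    case (step b)
    have "f a * f b = 1 \<bullet> (f b * f a)" "f a * V a b = inverse q \<bullet> (V a b * f a)" "f a * Ki b = 1 \<bullet> (Ki b * f a)"
      using step assms by (simp_all add: f_f_far f_Ki)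
    from q_commute_bracket[OF this, of 1] show ?case using step assms by (simp add: V_Suc)
  qed
qed

text \<open>An instance of \<open>serre_middle\<close> in which the string \<open>V a m\<close>
  takes the place of the left neighbour of node \<open>m\<close>; \<open>serre_V\<close> supplies
  its Serre relation.\<close>

lemma f_V_mid:
  assumes "1 \<le> a" "a < m" "m + 1 < b" "b \<le> n"
  shows "f m * V a b = V a b * f m"
proof -
  have "m + 2 \<le> b" using assms by simp
  then show ?thesis using assms(4)
  proof (induction b rule: int_ge_induct)
    case base
    let ?x = "f m" and ?y = "f (m + 1)" and ?w = "V a m"
    let ?P = "?y * (?x * ?w - ?w * ?x) - (?x * ?w - ?w * ?x) * ?y"
    \<comment> \<open>\<open>Ki m\<close> commutes with \<open>f (m + 1)\<close> and is moved to the
      right. The product \<open>Ki m * Ki (m + 1)\<close> then commutes with \<open>f m\<close>, as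
      its factors q and q^{-1} cancel.\<close>
    have V: "V a (m + 2) = ?P * (Ki m * Ki (m + 1))"
      using V_Suc[of a "m + 1"] V_Suc[of a m] Ki_f[of m "m + 1"] assms base
      by (simp add: add.assoc mult.assoc left_diff_distrib right_diff_distrib)
    have "?x * ?P = ?P * ?x"
      by (rule serre_middle[OF _ serre_V serre_dn_f q2]) (use assms base in \<open>auto simp: f_V_gt\<close>)
    moreover have "?x * (Ki m * Ki (m + 1)) = (Ki m * Ki (m + 1)) * ?x"
      using assms base by (simp add: mult.assoc Ki_f assoc_subst[OF Ki_f[of m m]])
    ultimately show ?case unfolding V by (rule commute_mult)
  next
    case (step b)
    have "f m * f b = 1 \<bullet> (f b * f m)" "f m * V a b = 1 \<bullet> (V a b * f m)" "f m * Ki b = 1 \<bullet> (Ki b * f m)"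
      using step assms by (simp_all add: f_f_far f_Ki)
    from q_commute_bracket[OF this, of 1] show ?case using step assms by (simp add: V_Suc)
  qed
qed

end

section \<open>The commutation rules in the shape of exchange relations\<close>

context strand
begin

text \<open>Up to the factor z in L_{m,m+1} = z f_m this is an exchange relation with that entry.
  The cases are the positions of node \<open>m\<close> relative to the string.\<close>

lemma exchange_f_V:
  assumes "1 \<le> a" "a \<le> b" "b \<le> n" "1 \<le> m" "m < n"
  shows "(if b = m + 1 then q else 1) \<bullet> (V a b * f m) + (if b = m then V a (m + 1) * K m else 0)
    = (if a = m then q else 1) \<bullet> (f m * V a b) + (if a = m + 1 then K (m + 1) * V m b else 0)"
proof -
  consider (lt) "m < a - 1" | (gt) "b < m" | (nxt) "b = m" | (prev) "m + 1 = a" "a = b" | (prev') "m + 1 = a" "a < b"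
    | (two) "m = a" "b = a + 1" | (first) "m = a" "a + 1 < b" | (last) "a < m" "m + 1 = b" | (mid) "a < m" "m + 1 < b"
    using assms by (smt (verit))
  then show ?thesis
  proof cases
    case lt
    then show ?thesis using assms f_V_lt[of a b m] by simp
  next
    case gt
    then show ?thesis using assms f_V_gt[of a b m] by simp
  next
    case nxt
    then show ?thesis using assms f_V_next[of a b] by simp
  next
    case prev
    then show ?thesis using assms G_f_dn[of m] V_X[of m] by simp
  next
    case prev'
    then show ?thesis using assms f_V_prev[of m b] by auto
  next
    case two
    then show ?thesis using assms X_f[of a] V_X[of a] by simp
  next
    case first
    then show ?thesis using assms f_V_first[of a b] by simp
  next
    case last
    then show ?thesis using assms f_V_last[of a m] by auto
  next
    case mid
    then show ?thesis using assms f_V_mid[of a m b] by simp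
  qed
qed

text \<open>\<open>Y m\<close> takes the place of \<open>V (m + 1) m\<close>, which would be
  meaningless: the entry to the left of the start of the string is zero in the even part and
  L_{-m-1,m} in the odd part.\<close>

lemma exchange_e_V:
  assumes "1 \<le> a" "a \<le> b" "b \<le> n" "1 \<le> m" "m < n"
  shows "(if b = m then inverse q else 1) \<bullet> (V a b * e m)
      + (if b = m + 1 then (if a = m + 1 then Y m else V a m) * Ki (m + 1) else 0)
    = (if a = m + 1 then inverse q else 1) \<bullet> (e m * V a b)
      + (if a = m then Ki m * (if b = m then Y m else V (m + 1) b) else 0)"
proof -
  consider (lt) "m < a - 1" | (gt) "b < m" | (diag) "a = m" "b = m" | (at) "a < b" "b = m" | (prev) "m + 1 = a" "a = b"
    | (prev') "m + 1 = a" "a < b" | (two) "m = a" "b = a + 1" | (first) "m = a" "a + 1 < b"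
    | (last) "a < m" "m + 1 = b" | (mid) "a < m" "m + 1 < b"
    using assms by (smt (verit))
  then show ?thesis
  proof cases
    case lt
    then show ?thesis using assms e_V_lt[of a b m] by simp
  next
    case gt
    then show ?thesis using assms e_V_gt[of a b m] by simp
  next
    case diag
    then show ?thesis using assms e_G[of m] by simp
  next
    case at
    then show ?thesis using assms e_V_at[of a b] by simp
  next
    case prev
    then show ?thesis using assms e_G_dn[of m] by auto
  next
    case prev'
    then show ?thesis using assms e_V_prev[of m b] by auto
  next
    case two
    then show ?thesis using assms e_X[of a] V_X[of a] by simp
  next
    case first
    then show ?thesis using assms e_V_first[of a b] by simp
  next
    case last
    then show ?thesis using assms e_V_last[of a m] by auto
  next
    case mid
    then show ?thesis using assms e_V_mid[of a m b] by simp
  qed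
qed

lemma exchange_K_V:
  assumes "1 \<le> a" "a \<le> b" "b \<le> n" "1 \<le> m" "m \<le> n"
  shows "(if b = m then q else 1) \<bullet> (V a b * K m) = (if a = m then q else 1) \<bullet> (K m * V a b)"
    "(if b = m then inverse q else 1) \<bullet> (V a b * Ki m) = (if a = m then inverse q else 1) \<bullet> (Ki m * V a b)"
  using assms by (auto simp: K_V Ki_V wt_def)

text \<open>The first step of the recursion, the only one with a factor q, is replaced by its known
  result \<open>X a\<close>, so that the inductive case is a plain commutator.\<close>

lemma V_induct [consumes 3, case_names G X Suc]:
  assumes "1 \<le> a" "a \<le> b" "b \<le> n"
    and "P a (G a)" "a < n \<Longrightarrow> P (a + 1) (X a)"
    and "\<And>b. \<lbrakk>a < b; b < n; P b (V a b)\<rbrakk> \<Longrightarrow> P (b + 1) ((f b * V a b - V a b * f b) * Ki b)"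
  shows "P b (V a b)"
  using assms(2,3)
proof (induction b rule: int_ge_induct)
  case base
  then show ?case using assms by simp
next
  case (step b)
  then show ?case using assms V_X[of a] V_Suc[of a b] by (cases "a = b") auto
qed

end

section \<open>The exchange relations as matrix identities\<close>

text \<open>\<open>q\<close> and the entries are parameters because the relation is also used with
  the inverse of \<open>q\<close> in the opposite algebra, and for images under
  homomorphisms.\<close>

definition exchange :: "ratfun \<Rightarrow> (int \<Rightarrow> int \<Rightarrow> 'a::ratfun_algebra) \<Rightarrow> int \<Rightarrow> int \<Rightarrow> int \<Rightarrow> int \<Rightarrow> bool" where
  "exchange q L i j k l \<longleftrightarrow>
    ((-1) ^ (olsh_parity i j * olsh_parity k l) * q powi olsh_phi j l) \<bullet> (L i j * L k l)
      + (of_bool (k \<le> j \<and> j < l) * of_int (olsh_theta i j k) * (q - inverse q)) \<bullet> (L i l * L k j)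
      + (of_bool (i \<le> -l \<and> -l < j \<and> j \<le> -k) * of_int (olsh_theta (-i) (-j) k) * (q - inverse q))
          \<bullet> (L i (-l) * L k (-j))
    = (q powi olsh_phi i k) \<bullet> (L k l * L i j)
      + (of_bool (k < i \<and> i \<le> l) * of_int (olsh_theta i j k) * (q - inverse q)) \<bullet> (L i l * L k j)
      + (of_bool (-l \<le> i \<and> i < -k \<and> -k \<le> j) * of_int (olsh_theta (-i) (-j) k) * (q - inverse q))
          \<bullet> (L (-i) l * L (-k) j)"

definition indices :: "int \<Rightarrow> int set" where
  "indices n = {i. i \<noteq> 0 \<and> \<bar>i\<bar> \<le> n}"

lemma finite_indices [simp]: "finite (indices n)"
  by (rule finite_subset[of _ "{-n..n}"]) (auto simp: indices_def)

text \<open>Entries whose indices are out of order or out of range are zero. Conditions on the order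
  of indices can then be absorbed into vanishing entries.\<close>

locale triangular =
  fixes q z :: ratfun and n :: int and L :: "int \<Rightarrow> int \<Rightarrow> 'a::ratfun_algebra"
  assumes q0 [simp]: "q \<noteq> 0" and z: "z = q - inverse q" and z0 [simp]: "z \<noteq> 0"
    and L_zero: "\<not> (i \<in> indices n \<and> j \<in> indices n \<and> i \<le> j) \<Longrightarrow> L i j = 0"
    and L_inverse: "i \<in> indices n \<Longrightarrow> L i i * L (-i) (-i) = 1"
begin

lemma qq [simp]: "q * inverse q = 1" "inverse q * q = 1" "q * (inverse q * c) = c" "inverse q * (q * c) = c"
  by (simp_all add: mult.assoc[symmetric] del: mult.assoc)

lemma L_gt [simp]: "j < i \<Longrightarrow> L i j = 0"
  by (rule L_zero) simp

text \<open>For l > 0, \<open>sg\<close> and \<open>tg\<close> are what remains of the theta factors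
  and the parity sign after division by the sign that is -1 exactly when i < 0 and k < 0.\<close>

definition sg :: "int \<Rightarrow> int \<Rightarrow> ratfun" where
  "sg k b = (if k < 0 \<and> b < 0 then - 1 else 1)"

definition tg :: "int \<Rightarrow> int \<Rightarrow> ratfun" where
  "tg k b = (if k < 0 \<and> 0 < b then - 1 else 1)"

text \<open>For $l > 0$ the factors $\theta$ and the parities combine to a common sign, which is cancelled
  here. In contrast to \<open>exchange\<close>, the relation then also holds for \<open>j < i\<close>, and this allows matrix
  products over all indices.\<close>

definition exch :: "int \<Rightarrow> int \<Rightarrow> int \<Rightarrow> int \<Rightarrow> bool" where
  "exch i j k l \<longleftrightarrow>
    (sg k j * q powi olsh_phi j l) \<bullet> (L i j * L k l) + (if j < l then z \<bullet> (L i l * L k j) else 0)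
      + (if - j < l then (z * sg k j) \<bullet> (L i (- l) * L k (- j)) else 0)
    = (sg k i * q powi olsh_phi i k) \<bullet> (L k l * L i j) + (if k < i then z \<bullet> (L i l * L k j) else 0)
      + (if i < - k then (z * tg k i) \<bullet> (L (- i) l * L (- k) j) else 0)"

text \<open>Conditions such as \<open>k \<le> j\<close> and \<open>i \<le> l\<close> may be dropped
  because the entries in question vanish otherwise, and all six terms share the sign
  \<open>s\<close>.\<close>

lemma exchange_iff_exch:
  assumes I: "i \<in> indices n" "j \<in> indices n" "k \<in> indices n" "l \<in> indices n"
    and le: "i \<le> j" "k \<le> l" "0 < l"
  shows "exchange q L i j k l \<longleftrightarrow> exch i j k l"
proof -
  have nz: "i \<noteq> 0" "j \<noteq> 0" "k \<noteq> 0" "l \<noteq> 0" using I by (auto simp: indices_def)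
  define s :: ratfun where "s = (if i < 0 \<and> k < 0 then - 1 else 1)"
  have s: "s \<noteq> 0" by (simp add: s_def)
  have 1: "((-1) ^ (olsh_parity i j * olsh_parity k l) * q powi olsh_phi j l) \<bullet> (L i j * L k l)
      = s \<bullet> (sg k j * q powi olsh_phi j l) \<bullet> (L i j * L k l)"
    using nz le by (simp add: s_def olsh_parity_def sg_def zero_less_mult_iff)
  have 2: "(of_bool (k \<le> j \<and> j < l) * of_int (olsh_theta i j k) * z) \<bullet> (L i l * L k j)
      = s \<bullet> (if j < l then z \<bullet> (L i l * L k j) else 0)"
    using nz le by (cases "k \<le> j"; cases "i < 0"; cases "j < 0"; cases "k < 0") (simp_all add: s_def olsh_theta_def)
  have 3: "(of_bool (i \<le> -l \<and> -l < j \<and> j \<le> -k) * of_int (olsh_theta (-i) (-j) k) * z) \<bullet> (L i (-l) * L k (-j))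
      = s \<bullet> (if - j < l then (z * sg k j) \<bullet> (L i (- l) * L k (- j)) else 0)"
    using nz le by (cases "i \<le> -l"; cases "j \<le> -k"; cases "i < 0"; cases "j < 0"; cases "k < 0")
      (simp_all add: s_def olsh_theta_def sg_def)
  have 4: "(q powi olsh_phi i k) \<bullet> (L k l * L i j) = s \<bullet> (sg k i * q powi olsh_phi i k) \<bullet> (L k l * L i j)"
    by (simp add: s_def sg_def)
  have 5: "(of_bool (k < i \<and> i \<le> l) * of_int (olsh_theta i j k) * z) \<bullet> (L i l * L k j)
      = s \<bullet> (if k < i then z \<bullet> (L i l * L k j) else 0)"
    using nz le by (cases "k \<le> j"; cases "i \<le> l"; cases "i < 0"; cases "j < 0"; cases "k < 0") (simp_all add: s_def olsh_theta_def)
  have 6: "(of_bool (-l \<le> i \<and> i < -k \<and> -k \<le> j) * of_int (olsh_theta (-i) (-j) k) * z) \<bullet> (L (-i) l * L (-k) j)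
      = s \<bullet> (if i < - k then (z * tg k i) \<bullet> (L (- i) l * L (- k) j) else 0)"
    using nz le by (cases "-l \<le> i"; cases "-k \<le> j"; cases "i < 0"; cases "j < 0"; cases "k < 0")
      (simp_all add: s_def olsh_theta_def tg_def)
  show ?thesis
    unfolding exchange_def exch_def z[symmetric] 1 2 3 4 5 6 smul_add_right[symmetric] smul_cancel[OF s] ..
qed

text \<open>If \<open>L i l * L k j\<close> is nonzero, then k \<le> j < i \<le> l, and the term is
  present on both sides. All other terms vanish.\<close>

lemma exch_gt:
  assumes "0 < l" "j < i"
  shows "exch i j k l"
proof -
  have "(if j < l then z \<bullet> (L i l * L k j) else 0) = (if k < i then z \<bullet> (L i l * L k j) else 0)"
    using assms by (cases "i \<le> l"; cases "k \<le> j") auto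
  moreover have "(if - j < l then (z * sg k j) \<bullet> (L i (- l) * L k (- j)) else 0) = 0"
    using assms by (cases "i \<le> - l") auto
  moreover have "(if i < - k then (z * tg k i) \<bullet> (L (- i) l * L (- k) j) else 0) = 0"
    using assms by (cases "- k \<le> j") auto
  ultimately show ?thesis using assms by (simp add: exch_def)
qed

definition exch_all :: "int \<Rightarrow> int \<Rightarrow> bool" where
  "exch_all k l \<longleftrightarrow> (\<forall>i \<in> indices n. \<forall>j \<in> indices n. exch i j k l)"

lemma exch_all_iff:
  assumes "k \<in> indices n" "l \<in> indices n" "k \<le> l" "0 < l"
  shows "exch_all k l \<longleftrightarrow> (\<forall>i \<in> indices n. \<forall>j \<in> indices n. i \<le> j \<longrightarrow> exchange q L i j k l)"
  unfolding exch_all_def using assms exchange_iff_exch exch_gt by (meson not_le)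

definition mm :: "(int \<Rightarrow> int \<Rightarrow> 'a) \<Rightarrow> (int \<Rightarrow> int \<Rightarrow> 'a) \<Rightarrow> int \<Rightarrow> int \<Rightarrow> 'a" where
  "mm A B i j = (\<Sum>r\<in>indices n. A i r * B r j)"

lemma mm_assoc: "mm (mm A B) C = mm A (mm B C)"
  unfolding mm_def fun_eq_iff sum_distrib_left sum_distrib_right mult.assoc
  by (intro allI sum.swap)

definition eqI :: "(int \<Rightarrow> int \<Rightarrow> 'a) \<Rightarrow> (int \<Rightarrow> int \<Rightarrow> 'a) \<Rightarrow> bool"  (infix \<open>\<doteq>\<close> 50) where
  "A \<doteq> B \<longleftrightarrow> (\<forall>i \<in> indices n. \<forall>j \<in> indices n. A i j = B i j)"

lemma eqI_refl [simp]: "A \<doteq> A" and eqI_sym: "A \<doteq> B \<Longrightarrow> B \<doteq> A"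
  and eqI_trans [trans]: "A \<doteq> B \<Longrightarrow> B \<doteq> C \<Longrightarrow> A \<doteq> C"
  by (simp_all add: eqI_def)

lemma mm_cong: "A \<doteq> A' \<Longrightarrow> B \<doteq> B' \<Longrightarrow> mm A B \<doteq> mm A' B'"
  by (simp add: eqI_def mm_def cong: sum.cong)

text \<open>The index \<open>a\<close> selects the entry of row i that is multiplied: in
  \<open>mm L (N k l) i j\<close> the three summands meet \<open>L i j\<close>, \<open>L i l\<close>
  and \<open>L i (- l)\<close>. In \<open>M\<close> the index \<open>c\<close> selects in the same
  way the row of the right-hand factor.\<close>

definition N :: "int \<Rightarrow> int \<Rightarrow> int \<Rightarrow> int \<Rightarrow> 'a" where
  "N k l a b = (if a = b then (sg k b * q powi olsh_phi b l) \<bullet> L k l else 0)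
    + (if a = l then (if b < l then z \<bullet> L k b else 0) else 0)
    + (if a = - l then (if - b < l then (z * sg k b) \<bullet> L k (- b) else 0) else 0)"

definition M :: "int \<Rightarrow> int \<Rightarrow> int \<Rightarrow> int \<Rightarrow> 'a" where
  "M k l i c = (if i = c then (sg k i * q powi olsh_phi i k) \<bullet> L k l else 0)
    + (if c = k then (if k < i then z \<bullet> L i l else 0) else 0)
    + (if c = - k then (if i < - k then (z * tg k i) \<bullet> L (- i) l else 0) else 0)"

lemma minus_mem_indices [simp]: "- i \<in> indices n \<longleftrightarrow> i \<in> indices n"
  by (auto simp: indices_def)

lemma mult_if_zero: "x * (if P then y else 0) = (if P then x * y else 0)"
  "(if P then y else 0) * x = (if P then y * x else (0::'a))"
  by simp_all

lemmas mm_simps = mm_def distrib_left distrib_right sum.distrib mult_if_zero sum.delta' sum.delta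

lemma mm_L_N:
  assumes "i \<in> indices n" "j \<in> indices n" "l \<in> indices n"
  shows "mm L (N k l) i j = (sg k j * q powi olsh_phi j l) \<bullet> (L i j * L k l) + (if j < l then z \<bullet> (L i l * L k j) else 0)
      + (if - j < l then (z * sg k j) \<bullet> (L i (- l) * L k (- j)) else 0)"
  using assms by (auto simp: mm_simps N_def)

lemma mm_M_L:
  assumes "i \<in> indices n" "j \<in> indices n" "k \<in> indices n"
  shows "mm (M k l) L i j = (sg k i * q powi olsh_phi i k) \<bullet> (L k l * L i j) + (if k < i then z \<bullet> (L i l * L k j) else 0)
      + (if i < - k then (z * tg k i) \<bullet> (L (- i) l * L (- k) j) else 0)"
  using assms by (auto simp: mm_simps M_def)

lemma exch_all_iff_mm:
  assumes "k \<in> indices n" "l \<in> indices n"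
  shows "exch_all k l \<longleftrightarrow> mm L (N k l) \<doteq> mm (M k l) L"
  using assms by (simp add: exch_all_def exch_def eqI_def mm_L_N mm_M_L)

end

section \<open>The step from column l to column l + 1\<close>

context triangular
begin

lemma powi_phi: "k \<noteq> 0 \<Longrightarrow> q powi olsh_phi i k = (if \<bar>i\<bar> = \<bar>k\<bar> then if 0 < k then q else inverse q else 1)"
  by (auto simp: olsh_phi_def sgn_if power_int_minus)

context
  fixes k l :: int
  assumes l: "1 \<le> l" "l < n" and k: "k \<in> indices n" "k < l"
    and exch_K: "exch_all l l" and exch_K': "exch_all (l + 1) (l + 1)"
    and exch_f: "exch_all l (l + 1)"
begin

text \<open>This is the single element f_l. The matrix called F in the overview is
  \<open>Nf\<close>, and \<open>Mf\<close> is its counterpart on the other side.\<close>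

definition "F = inverse z \<bullet> L l (l + 1)"

lemma mem [simp]: "l \<in> indices n" "l + 1 \<in> indices n" "- l - 1 \<in> indices n"
  using l by (auto simp: indices_def)

definition Nf :: "int \<Rightarrow> int \<Rightarrow> 'a" where
  "Nf a b = (if a = b then (q powi olsh_phi b (l + 1)) \<bullet> F else 0)
    + (if a = l + 1 then if b = l then L l l else 0 else 0) + (if a = - l - 1 then if b = - l then L l l else 0 else 0)"

definition Mf :: "int \<Rightarrow> int \<Rightarrow> 'a" where
  "Mf i c = (if i = c then (q powi olsh_phi i l) \<bullet> F else 0)
    + (if i = l + 1 then if c = l then L (l + 1) (l + 1) else 0 else 0)
    + (if i = - l - 1 then if c = - l then L (l + 1) (l + 1) else 0 else 0)"

lemma zF: "L l (l + 1) = z \<bullet> F"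
  by (simp add: F_def)

lemma N_f: "N l (l + 1) a b = z \<bullet> Nf a b"
proof -
  have 1: "(if b < l + 1 then z \<bullet> L l b else 0) = z \<bullet> (if b = l then L l l else 0)" for b
    by (cases "b < l") auto
  have 2: "(if - b < l + 1 then (z * sg l b) \<bullet> L l (- b) else 0) = z \<bullet> (if b = - l then L l l else 0)" for b
    using l by (cases "- b < l") (auto simp: sg_def)
  have 3: "- (l + 1) = - l - 1" by simp
  show ?thesis
    unfolding N_def Nf_def 1 2 3 zF using l by (simp add: sg_def smul_add_right mult.commute)
qed

lemma M_f: "M l (l + 1) a b = z \<bullet> Mf a b"
proof -
  have 1: "(if l < a then z \<bullet> L a (l + 1) else 0) = z \<bullet> (if a = l + 1 then L (l + 1) (l + 1) else 0)" for a
    by (cases "l + 1 < a"; cases "a = l + 1") auto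
  have 2: "(if a < - l then (z * tg l a) \<bullet> L (- a) (l + 1) else 0) = z \<bullet> (if a = - l - 1 then L (l + 1) (l + 1) else 0)" for a
    using l by (cases "a < - l - 1"; cases "a = - l - 1") (auto simp: tg_def add.commute)
  show ?thesis
    unfolding M_def Mf_def 1 2 zF using l by (auto simp add: sg_def smul_add_right mult.commute)
qed

lemma N_K: "m \<in> indices n \<Longrightarrow> 1 \<le> m \<Longrightarrow> N m m a b = (if a = b then (q powi olsh_phi b m) \<bullet> L m m else 0)"
proof -
  assume m: "1 \<le> m"
  have 1: "(if b < m then z \<bullet> L m b else 0) = 0" by simp
  have 2: "(if - b < m then (z * sg m b) \<bullet> L m (- b) else 0) = 0" by simp
  show ?thesis unfolding N_def 1 2 using m by (simp add: sg_def)
qed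

lemma M_K: "m \<in> indices n \<Longrightarrow> 1 \<le> m \<Longrightarrow> M m m a b = (if a = b then (q powi olsh_phi b m) \<bullet> L m m else 0)"
proof -
  assume m: "1 \<le> m"
  have 1: "(if m < a then z \<bullet> L a m else 0) = 0" by simp
  have 2: "(if a < - m then (z * tg m a) \<bullet> L (- a) m else 0) = 0" by simp
  show ?thesis unfolding M_def 1 2 using m by (simp add: sg_def)
qed

lemma mm_eval:
  assumes "a \<in> indices n" "b \<in> indices n"
  shows "mm Nf A a b = (q powi olsh_phi a (l + 1)) \<bullet> (F * A a b)
      + (if a = l + 1 then L l l * A l b else 0) + (if a = - l - 1 then L l l * A (- l) b else 0)"
    "mm A Nf a b = (q powi olsh_phi b (l + 1)) \<bullet> (A a b * F)
      + (if b = l then A a (l + 1) * L l l else 0) + (if b = - l then A a (- l - 1) * L l l else 0)"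
    "mm Mf A a b = (q powi olsh_phi a l) \<bullet> (F * A a b)
      + (if a = l + 1 then L (l + 1) (l + 1) * A l b else 0) + (if a = - l - 1 then L (l + 1) (l + 1) * A (- l) b else 0)"
    "mm A Mf a b = (q powi olsh_phi b l) \<bullet> (A a b * F)
      + (if b = l then A a (l + 1) * L (l + 1) (l + 1) else 0) + (if b = - l then A a (- l - 1) * L (l + 1) (l + 1) else 0)"
  using assms by (simp_all add: mm_simps Nf_def Mf_def cong: if_cong)

lemma mm_K:
  assumes "a \<in> indices n" "b \<in> indices n" "m \<in> indices n" "1 \<le> m"
  shows "mm (N m m) A a b = (q powi olsh_phi a m) \<bullet> (L m m * A a b)"
    "mm A (N m m) a b = (q powi olsh_phi b m) \<bullet> (A a b * L m m)"
    "mm (M m m) A a b = (q powi olsh_phi a m) \<bullet> (L m m * A a b)"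
    "mm A (M m m) a b = (q powi olsh_phi b m) \<bullet> (A a b * L m m)"
  using assms by (simp_all add: mm_simps N_K M_K cong: if_cong)

lemma L_Nf: "mm L Nf \<doteq> mm Mf L"
proof -
  have "mm L (N l (l + 1)) \<doteq> mm (M l (l + 1)) L"
    using exch_f l by (simp add: exch_all_iff_mm)
  then show ?thesis
    by (simp add: eqI_def mm_def N_f M_f smul_cancel sum_smul)
qed

lemma exch_F:
  assumes "i \<in> indices n" "j \<in> indices n"
  shows "(q powi olsh_phi j (l + 1)) \<bullet> (L i j * F)
      + (if j = l then L i (l + 1) * L l l else 0) + (if j = - l then L i (- l - 1) * L l l else 0)
    = (q powi olsh_phi i l) \<bullet> (F * L i j)
      + (if i = l + 1 then L (l + 1) (l + 1) * L l j else 0) + (if i = - l - 1 then L (l + 1) (l + 1) * L (- l) j else 0)"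
  using L_Nf assms by (simp add: eqI_def mm_eval)

lemma exch_L_K:
  assumes "i \<in> indices n" "j \<in> indices n" "m \<in> indices n" "1 \<le> m" "exch_all m m"
  shows "(q powi olsh_phi j m) \<bullet> (L i j * L m m) = (q powi olsh_phi i m) \<bullet> (L m m * L i j)"
  using assms by (simp add: exch_all_iff_mm eqI_def mm_K)

text \<open>The constant c of the overview, namely the power of q in front of
  \<open>F * L k b\<close> in \<open>exch_F\<close>; see \<open>phi_k\<close>.\<close>

definition "\<alpha> = (if k = - l then q else 1)"

lemma alpha [simp]: "\<alpha> \<noteq> 0" "\<alpha> * inverse \<alpha> = 1" "inverse \<alpha> * \<alpha> = 1"
    "\<alpha> * (inverse \<alpha> * c) = c" "\<alpha> * (c * inverse \<alpha>) = c" "\<alpha> * (c * (inverse \<alpha> * d)) = c * d"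
    "\<alpha> * (c * (d * inverse \<alpha>)) = c * d" "inverse \<alpha> * (\<alpha> * c) = c"
  by (simp_all add: \<alpha>_def)

lemma k_simps [simp]: "k \<noteq> 0" "k \<noteq> l" "k \<noteq> l + 1" "\<not> l < k" "\<not> l + 1 < k" "l \<noteq> 0" "0 < l" "0 < l + 1" "l + 1 \<noteq> 0"
    "- l < l" "- l - 1 < l" "- l - 1 < 0" "l \<noteq> - l" "- l \<noteq> l" "l + 1 \<noteq> - l" "- l \<noteq> l + 1"
    "- l - 1 \<noteq> l" "l \<noteq> - l - 1" "- l - 1 \<noteq> l + 1" "l + 1 \<noteq> - l - 1" "- l - 1 \<noteq> - l" "- l \<noteq> - l - 1"
  using k l by (auto simp: indices_def)

lemma phi: "q powi olsh_phi b l = (if b = l \<or> b = - l then q else 1)"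
    "q powi olsh_phi b (l + 1) = (if b = l + 1 \<or> b = - l - 1 then q else 1)"
  using l by (auto simp: powi_phi)

lemma phi_k: "q powi olsh_phi k l = \<alpha>"
  by (auto simp: phi \<alpha>_def)

definition "T b = (if k = - l - 1 then L (l + 1) (l + 1) * L (- l) b else 0)"

text \<open>Row k of \<open>exch_F\<close>, solved for the product with \<open>F\<close> on the
  left. Together with \<open>K_L\<close> it moves \<open>F\<close> and \<open>L l l\<close> to the
  right of the entries of row k, so that \<open>N_move\<close> becomes a comparison of normal forms.
  \<open>T\<close> is the extra term for k = -l-1.\<close>

lemma F_L: "b \<in> indices n \<Longrightarrow> F * L k b = inverse \<alpha> \<bullet> ((if b = l + 1 \<or> b = - l - 1 then q else 1) \<bullet> (L k b * F)
      + (if b = l then L k (l + 1) * L l l else 0) + (if b = - l then L k (- l - 1) * L l l else 0) - T b)"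
proof -
  assume b: "b \<in> indices n"
  have "\<alpha> \<bullet> (F * L k b) + T b = (if b = l + 1 \<or> b = - l - 1 then q else 1) \<bullet> (L k b * F)
      + (if b = l then L k (l + 1) * L l l else 0) + (if b = - l then L k (- l - 1) * L l l else 0)"
    using exch_F[OF k(1) b, unfolded phi_k, unfolded phi] by (simp only: T_def k_simps if_False add_0_right)
  then have "\<alpha> \<bullet> (F * L k b) = (if b = l + 1 \<or> b = - l - 1 then q else 1) \<bullet> (L k b * F)
      + (if b = l then L k (l + 1) * L l l else 0) + (if b = - l then L k (- l - 1) * L l l else 0) - T b"
    by (simp only: eq_diff_eq)
  from this[symmetric] show ?thesis by (simp del: diff_eq_eq)
qed

lemma K_L: "b \<in> indices n \<Longrightarrow> L l l * L k b = (inverse \<alpha> * (if b = l \<or> b = - l then q else 1)) \<bullet> (L k b * L l l)"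
proof -
  assume b: "b \<in> indices n"
  have "inverse \<alpha> \<bullet> \<alpha> \<bullet> (L l l * L k b) = inverse \<alpha> \<bullet> (if b = l \<or> b = - l then q else 1) \<bullet> (L k b * L l l)"
    by (simp only: exch_L_K[OF k(1) b mem(1) l(1) exch_K, unfolded phi_k, unfolded phi])
  then show ?thesis by simp
qed

definition rhsN :: "int \<Rightarrow> int \<Rightarrow> 'a" where
  "rhsN a b = \<alpha> \<bullet> mm Nf (N k l) a b - mm (N k l) Nf a b
    + (if k = - l - 1 then mm (N (l + 1) (l + 1)) (N (- l) l) a b else 0)"

text \<open>Expresses the correction through \<open>T\<close>, so that it cancels against the terms
  that \<open>F_L\<close> subtracts.\<close>

lemma rhsN_3: "a \<in> indices n \<Longrightarrow> b \<in> indices n \<Longrightarrow> (if k = - l - 1 then mm (N (l + 1) (l + 1)) (N (- l) l) a b else 0)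
  = (if a = l + 1 \<or> a = - l - 1 then q else 1) \<bullet> ((if a = b then (sg k b * (if b = l \<or> b = - l then q else 1)) \<bullet> T l else 0)
    + (if a = l then (if b < l then z \<bullet> T b else 0) else 0)
    + (if a = - l then (if - b < l then (z * sg k b) \<bullet> T (- b) else 0) else 0))"
  using l unfolding T_def by (cases "k = - l - 1") (simp_all add: mm_K N_def phi sg_def smul_add_right olsh_phi_def)

lemma sg_simps: "sg k l = 1" "sg k (l + 1) = 1" "sg k (- l) = sg k (-1)" "sg k (- l - 1) = sg k (-1)"
    "sg k (-1) * sg k (-1) = 1"
  using l by (simp_all add: sg_def)

lemma q_z: "q * z = q * q - 1" "z * q = q * q - 1" "q * (z * c) = q * q * c - c"
  by (simp_all add: z algebra_simps)

text \<open>Only the indices l, -l, l + 1 and -l-1 have exceptional powers of q or off-diagonal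
  entries of \<open>Nf\<close>; hence the five cases for each of \<open>a\<close> and
  \<open>b\<close>.\<close>

lemma N_move: "mm (N k (l + 1)) (N l l) \<doteq> rhsN"
  unfolding eqI_def
proof (intro ballI)
  fix a b assume ab: "a \<in> indices n" "b \<in> indices n"
  have mb: "- b \<in> indices n" using ab by simp
  have e: "- (l + 1) = - l - 1" "- (- l - 1) = l + 1" by simp_all
  note n = N_def phi mm_eval(1,2) mm_K e sg_simps F_L K_L nc_simps rhsN_3
  consider "a = l + 1" | "a = - l - 1" | "a = l" | "a = - l" | "a \<noteq> l + 1" "a \<noteq> - l - 1" "a \<noteq> l" "a \<noteq> - l" by blast
  note A = this
  consider "b = l + 1" | "b = - l - 1" | "b = l" | "b = - l" | "b \<noteq> l + 1" "b \<noteq> - l - 1" "b \<noteq> l" "b \<noteq> - l" by blast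
  note B = this
  show "mm (N k (l + 1)) (N l l) a b = rhsN a b"
  proof (cases rule: A)
    case 1
    show ?thesis unfolding rhsN_def rhsN_3[OF ab]
      by (cases rule: B) (use ab mb l 1 in \<open>simp_all add: n q_z smul_diff_left\<close>)
  next
    case 2
    show ?thesis unfolding rhsN_def rhsN_3[OF ab]
      by (cases rule: B) (use ab mb l 2 in \<open>simp_all add: n q_z smul_diff_left mult_ac\<close>)
  next
    case 3
    show ?thesis unfolding rhsN_def rhsN_3[OF ab]
      by (cases rule: B) (use ab mb l 3 in \<open>simp_all add: n mult_ac\<close>)
  next
    case 4
    show ?thesis unfolding rhsN_def rhsN_3[OF ab]
      by (cases rule: B) (use ab mb l 4 in \<open>simp_all add: n mult_ac\<close>)
  next
    case 5
    show ?thesis unfolding rhsN_def rhsN_3[OF ab]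
      by (cases rule: B) (use ab mb l 5 in \<open>simp_all add: n\<close>)
  qed
qed

definition rhsM :: "int \<Rightarrow> int \<Rightarrow> 'a" where
  "rhsM a b = \<alpha> \<bullet> mm Mf (M k l) a b - mm (M k l) Mf a b
    + (if k = - l - 1 then mm (M (l + 1) (l + 1)) (M (- l) l) a b else 0)"

text \<open>The entries of \<open>M k l\<close> lie in column l. Now \<open>F\<close> and, by
  \<open>L_K'\<close>, also \<open>L (l + 1) (l + 1)\<close> are moved to the left of that
  column.\<close>

lemma L_F: "i \<in> indices n \<Longrightarrow> L i l * F = (if i = l \<or> i = - l then q else 1) \<bullet> (F * L i l)
    + (if i = l + 1 then L (l + 1) (l + 1) * L l l else 0) + (if i = - l - 1 then L (l + 1) (l + 1) * L (- l) l else 0)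
    - L i (l + 1) * L l l"
  using exch_F[of i l, unfolded phi] by (simp add: eq_diff_eq)

lemma L_K': "i \<in> indices n \<Longrightarrow> L i l * L (l + 1) (l + 1)
    = (if i = l + 1 \<or> i = - l - 1 then q else 1) \<bullet> (L (l + 1) (l + 1) * L i l)"
  using exch_L_K[of i l "l + 1", unfolded phi] l exch_K' by simp

lemma rhsM_3: "a \<in> indices n \<Longrightarrow> b \<in> indices n \<Longrightarrow> (if k = - l - 1 then mm (M (l + 1) (l + 1)) (M (- l) l) a b else 0)
  = (if k = - l - 1 then (if a = l + 1 \<or> a = - l - 1 then q else 1) \<bullet> (L (l + 1) (l + 1) * M (- l) l a b) else 0)"
  using l by (simp add: mm_K phi)

lemma M_move: "mm (M k (l + 1)) (M l l) \<doteq> rhsM"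
  unfolding eqI_def
proof (intro ballI)
  fix a b assume ab: "a \<in> indices n" "b \<in> indices n"
  have ma: "- a \<in> indices n" using ab by simp
  have e: "- (l + 1) = - l - 1" "- (- l - 1) = l + 1" "1 + l = l + 1" by simp_all
  have tg: "tg k l = sg k (-1)" "tg k (l + 1) = sg k (-1)" "tg k (- l) = 1" "tg k (- l - 1) = 1"
      "sg (- l) i = sg (- 1) i" "sg (- l - 1) i = sg (- 1) i" "tg (- l) i = tg (- 1) i" "tg (- l - 1) i = tg (- 1) i" for i
    using l by (simp_all add: tg_def sg_def)
  have tg': "tg (-1) l = - 1" "tg (-1) (l + 1) = - 1" "tg (-1) (- l) = 1" "tg (-1) (- l - 1) = 1"
      "sg (-1) l = 1" "sg (-1) (l + 1) = 1" "sg (-1) (- l) = - 1" "sg (-1) (- l - 1) = - 1" 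
    using l by (simp_all add: tg_def sg_def)
  have phi': "q powi olsh_phi i (- l) = (if i = l \<or> i = - l then inverse q else 1)"
    "q powi olsh_phi i (- l - 1) = (if i = l + 1 \<or> i = - l - 1 then inverse q else 1)" for i
    using l by (auto simp: powi_phi)
  note n = M_def phi phi' mm_eval(3,4) mm_K e sg_simps tg tg' nc_simps L_F L_K' mult_ac
  consider "a = l + 1" | "a = - l - 1" | "a = l" | "a = - l" | "a \<noteq> l + 1" "a \<noteq> - l - 1" "a \<noteq> l" "a \<noteq> - l" by blast
  note A = this
  \<comment> \<open>The columns k and -k of \<open>M\<close> are special. They collide with the
    special indices of \<open>Mf\<close> when -k is l or l + 1; the first case also changes
    \<open>\<alpha>\<close>, the second brings in the correction.\<close>
  consider "k = - l" | "k = - l - 1" | "k \<noteq> - l" "k \<noteq> - l - 1" by blast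
  then show "mm (M k (l + 1)) (M l l) a b = rhsM a b"
  proof cases
    case 1
    have \<alpha>: "\<alpha> = q" unfolding \<alpha>_def using 1 by simp
    consider "b = l" | "b = - l" | "b \<noteq> l" "b \<noteq> - l" by blast
    note B = this
    show ?thesis unfolding rhsM_def rhsM_3[OF ab] \<alpha>
      by (cases rule: B; cases rule: A) (use ab ma l 1 in \<open>simp_all add: n\<close>)
  next
    case 2
    have \<alpha>: "\<alpha> = 1" unfolding \<alpha>_def using 2 by simp
    \<comment> \<open>The coefficients q, z and q^{-1} occur together here, the last one because of
      \<open>phi'\<close>. Eliminating q makes them comparable.\<close>
    have q: "q \<bullet> x = z \<bullet> x + inverse q \<bullet> x" for x :: 'a by (simp add: z smul_diff_left)
    consider "b = l" | "b = - l" | "b = l + 1" | "b = - l - 1" | "b \<noteq> l" "b \<noteq> - l" "b \<noteq> l + 1" "b \<noteq> - l - 1" by blast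
    note B = this
    show ?thesis unfolding rhsM_def rhsM_3[OF ab] \<alpha>
      by ((cases rule: B; cases rule: A), (use ab ma l 2 in \<open>simp_all add: n\<close>), (simp_all add: q))
  next
    case 3
    have \<alpha>: "\<alpha> = 1" using 3 by (simp add: \<alpha>_def)
    have k3: "- k \<noteq> l" "l \<noteq> - k" "- k \<noteq> - l" "- l \<noteq> - k" "- k \<noteq> l + 1" "l + 1 \<noteq> - k" "- k \<noteq> - l - 1" "- l - 1 \<noteq> - k"
       "- l - 1 \<noteq> k" "- l \<noteq> k" "l \<noteq> k" "l + 1 \<noteq> k" using 3 k_simps(1-3) by presburger+
    \<comment> \<open>The diagonal coefficient of \<open>M k m\<close>, its column k and its column
      -k. As -k is neither l nor l + 1, the conditions \<open>k < i\<close> and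
      \<open>i < - k\<close> separate neither l from l + 1 nor -l from -l-1, so that both columns
      obey the rule \<open>L_F\<close>.\<close>
    define d where "d i = sg k i * q powi olsh_phi i k" for i
    define P where "P m i = (if k < i then z \<bullet> L i m else 0)" for m i
    define Q where "Q m i = (if i < - k then (z * tg k i) \<bullet> L (- i) m else 0)" for m i
    have M: "M k m i c = (if i = c then d i \<bullet> L k m else 0) + (if c = k then P m i else 0)
        + (if c = - k then Q m i else 0)" for m i c
      by (simp add: M_def d_def P_def Q_def)
    have d: "d l = 1" "d (l + 1) = 1" "d (- l) = sg k (-1)" "d (- l - 1) = sg k (-1)"
      using k3 3 k(2) l unfolding d_def by (auto simp: powi_phi sg_def)
    have kF: "L k l * F = F * L k l - L k (l + 1) * L l l"
      using L_F[OF k(1)] 3 by simp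
    have kK: "L k l * L (l + 1) (l + 1) = L (l + 1) (l + 1) * L k l"
      using L_K'[OF k(1)] 3 by simp
    have P: "P l i * F = (if i = l \<or> i = - l then q else 1) \<bullet> (F * P l i)
        + (if i = l + 1 then L (l + 1) (l + 1) * P l l else 0)
        + (if i = - l - 1 then L (l + 1) (l + 1) * P l (- l) else 0) - P (l + 1) i * L l l" if "i \<in> indices n" for i
    proof (cases "k < i")
      case True
      then have "i = - l - 1 \<longrightarrow> k < - l" by auto
      then show ?thesis using True by (auto simp: P_def L_F[OF that] smul_add_right smul_diff_right mult.commute)
    next
      case False
      then have "i = - l - 1 \<longrightarrow> \<not> k < - l" "i \<noteq> l + 1" using 3 k(2) by auto
      then show ?thesis using False by (simp add: P_def)
    qed
    have Q: "Q l i * F = (if i = l \<or> i = - l then q else 1) \<bullet> (F * Q l i)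
        + (if i = l + 1 then L (l + 1) (l + 1) * Q l l else 0)
        + (if i = - l - 1 then L (l + 1) (l + 1) * Q l (- l) else 0) - Q (l + 1) i * L l l" if i: "i \<in> indices n" for i
    proof (cases "i < - k")
      case True
      have c: "- i = l \<or> - i = - l \<longleftrightarrow> i = l \<or> i = - l" "- i = l + 1 \<longleftrightarrow> i = - l - 1" "- i = - l - 1 \<longleftrightarrow> i = l + 1" by auto
      have "i = l + 1 \<longrightarrow> l < - k" "i = - l - 1 \<longrightarrow> - l < - k" using True 3 k(2) by auto
      then show ?thesis using True L_F[of "- i", unfolded c] i
        by (auto simp: Q_def smul_add_right smul_diff_right mult_ac tg)
    next
      case False
      then have "i = l + 1 \<longrightarrow> \<not> l < - k" "i \<noteq> - l - 1" using 3 k(2) l by auto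
      then show ?thesis using False by (simp add: Q_def)
    qed
    note n = M d mm_eval(3,4) mm_K e nc_simps kF kK P Q phi mult_ac k3 3 l(1)
    consider "b = l" | "b = - l" | "b = k" | "b = - k" | "b \<noteq> l" "b \<noteq> - l" "b \<noteq> k" "b \<noteq> - k" by blast
    then show ?thesis
    proof cases
      case 1
      show ?thesis unfolding rhsM_def rhsM_3[OF ab] \<alpha>
        by (cases rule: A) (use ab in \<open>simp_all add: n 1\<close>)
    next
      case 2
      show ?thesis unfolding rhsM_def rhsM_3[OF ab] \<alpha>
        by (cases rule: A) (use ab in \<open>simp_all add: n 2\<close>)
    next
      case b: 3
      show ?thesis unfolding rhsM_def rhsM_3[OF ab] \<alpha>
        by (cases rule: A) (use ab in \<open>simp_all add: n b\<close>)
    next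
      case 4
      show ?thesis unfolding rhsM_def rhsM_3[OF ab] \<alpha>
        by (cases rule: A) (use ab in \<open>simp_all add: n 4\<close>)
    next
      case 5
      show ?thesis unfolding rhsM_def rhsM_3[OF ab] \<alpha>
        by (cases rule: A) (use ab in \<open>simp_all add: n 5 5[symmetric]\<close>)
    qed
  qed
qed

lemma mm_swap:
  assumes "mm L A \<doteq> mm A' L" "mm L B \<doteq> mm B' L"
  shows "mm L (mm A B) \<doteq> mm (mm A' B') L"
proof -
  have "mm L (mm A B) \<doteq> mm (mm A' L) B"
    unfolding mm_assoc[symmetric] by (rule mm_cong[OF assms(1) eqI_refl])
  also have "\<dots> \<doteq> mm A' (mm B' L)"
    unfolding mm_assoc by (rule mm_cong[OF eqI_refl assms(2)])
  finally show ?thesis by (simp add: mm_assoc)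
qed

lemma mm_linear:
  "mm L (\<lambda>a b. c \<bullet> A a b - B a b + (if P then C a b else 0)) i j
    = c \<bullet> mm L A i j - mm L B i j + (if P then mm L C i j else 0)"
  "mm (\<lambda>a b. c \<bullet> A a b - B a b + (if P then C a b else 0)) L i j
    = c \<bullet> mm A L i j - mm B L i j + (if P then mm C L i j else 0)"
  by (simp_all add: mm_def distrib_left distrib_right left_diff_distrib right_diff_distrib
      sum.distrib sum_subtractf flip: sum_smul)

lemma exch_move:
  assumes kl: "exch_all k l" and ll: "k = - l - 1 \<Longrightarrow> exch_all (- l) l"
  shows "exch_all k (l + 1)"
proof -
  have kl': "mm L (N k l) \<doteq> mm (M k l) L" using kl k by (simp add: exch_all_iff_mm)
  have K: "mm L (N l l) \<doteq> mm (M l l) L" using exch_K by (simp add: exch_all_iff_mm)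
  have K': "mm L (N (l + 1) (l + 1)) \<doteq> mm (M (l + 1) (l + 1)) L"
    using exch_K' by (simp add: exch_all_iff_mm)
  have ll': "k = - l - 1 \<Longrightarrow> mm L (N (- l) l) \<doteq> mm (M (- l) l) L"
    using ll by (simp add: exch_all_iff_mm)
  \<comment> \<open>The product of \<open>N k (l + 1)\<close> and \<open>N l l\<close> is expanded
    by \<open>N_move\<close>, carried through \<open>L\<close> term by term with
    \<open>mm_swap\<close>, and reassembled on the other side by \<open>M_move\<close>.\<close>
  have "mm L (mm (N k (l + 1)) (N l l)) \<doteq> mm L rhsN"
    by (rule mm_cong[OF eqI_refl N_move])
  also have "\<dots> \<doteq> mm rhsM L"
    unfolding eqI_def rhsN_def rhsM_def mm_linear
    using mm_swap[OF L_Nf kl'] mm_swap[OF kl' L_Nf] mm_swap[OF K' ll'] by (auto simp: eqI_def)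
  also have "\<dots> \<doteq> mm (mm (M k (l + 1)) (M l l)) L"
    by (rule mm_cong[OF eqI_sym[OF M_move] eqI_refl])
  also have "\<dots> \<doteq> mm (mm (M k (l + 1)) L) (N l l)"
    unfolding mm_assoc by (rule mm_cong[OF eqI_refl eqI_sym[OF K]])
  finally have *: "mm (mm L (N k (l + 1))) (N l l) \<doteq> mm (mm (M k (l + 1)) L) (N l l)"
    by (simp add: mm_assoc)
  \<comment> \<open>\<open>N l l\<close> is diagonal, each entry being a power of q times the
    invertible \<open>L l l\<close>, so it is cancelled entry by entry.\<close>
  have inv: "L l l * L (- l) (- l) = 1" by (rule L_inverse) simp
  have "mm L (N k (l + 1)) i j = mm (M k (l + 1)) L i j" if ij: "i \<in> indices n" "j \<in> indices n" for i j
  proof -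
    have "q powi olsh_phi j l \<noteq> 0" by (simp add: phi)
    then have "mm L (N k (l + 1)) i j * L l l = mm (M k (l + 1)) L i j * L l l"
      using * ij l by (simp add: eqI_def mm_K smul_cancel)
    from arg_cong[OF this, of "\<lambda>x. x * L (- l) (- l)"] show ?thesis
      by (simp add: mult.assoc inv)
  qed
  then show ?thesis using k by (simp add: exch_all_iff_mm eqI_def)
qed

end

declare mem [simp del] alpha [simp del] k_simps [simp del]

end

section \<open>The symmetry with the opposite algebra\<close>

definition opp_matrix :: "(int \<Rightarrow> int \<Rightarrow> 'a) \<Rightarrow> int \<Rightarrow> int \<Rightarrow> 'a opp" where
  "opp_matrix L i j = Opp (L (- j) (- i))"

lemma theta_minus: "olsh_theta (- i) (- j) (- k) = - olsh_theta i j k"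
proof -
  have "sgn (- i) + sgn (- j) + sgn (- k) = - (sgn i + sgn j + sgn k)" by (simp add: idom_abs_sgn_class.sgn_minus)
  then show ?thesis unfolding olsh_theta_def by (simp only: idom_abs_sgn_class.sgn_minus)
qed

lemma phi_minus: "olsh_phi (- i) (- j) = - olsh_phi i j"
  by (simp add: olsh_phi_def idom_abs_sgn_class.sgn_minus)

context triangular
begin

lemma triangular_opp: "triangular (inverse q) (- z) n (opp_matrix L)"
proof
  show "opp_matrix L i j = 0" if "\<not> (i \<in> indices n \<and> j \<in> indices n \<and> i \<le> j)" for i j
  proof -
    have "L (- j) (- i) = 0" by (rule L_zero) (use that in auto)
    then show ?thesis by (simp add: opp_matrix_def zero_opp_def)
  qed
  show "opp_matrix L i i * opp_matrix L (- i) (- i) = 1" if "i \<in> indices n" for i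
    using that L_inverse[of i] by (simp add: opp_matrix_def times_opp_def one_opp_def)
qed (use z in auto)

text \<open>Reversing the products and inverting q interchanges the two sides of the relation up to
  the sign \<open>s\<close>; this is why the proof ends with \<open>eq_commute\<close>.\<close>

lemma exchange_opp:
  assumes I: "i \<in> indices n" "j \<in> indices n" "k \<in> indices n" "l \<in> indices n"
    and le: "i \<le> j" "k \<le> l"
  shows "exchange (inverse q) (opp_matrix L) i j k l \<longleftrightarrow> exchange q L (- j) (- i) (- l) (- k)"
proof -
  have nz: "i \<noteq> 0" "j \<noteq> 0" "k \<noteq> 0" "l \<noteq> 0" using I by (auto simp: indices_def)
  define s :: ratfun where "s = (-1) ^ (olsh_parity i j * olsh_parity k l)"
  have ss [simp]: "s * s = 1" "s * (s * c) = c" for c by (simp_all add: s_def flip: power_add mult.assoc)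
  have s0: "s \<noteq> 0" by (simp add: s_def)
  have par: "olsh_parity (- j) (- i) = olsh_parity i j" "olsh_parity (- l) (- k) = olsh_parity k l"
    by (simp_all add: olsh_parity_def mult.commute)
  have neg: "- (x::int) < 0 \<longleftrightarrow> \<not> x < 0" if "x \<noteq> 0" for x using that by linarith
  have sgn: "sgn (x::int) = (if x < 0 then - 1 else 1)" if "x \<noteq> 0" for x using that by (simp add: sgn_if)
  have pos: "0 < x \<longleftrightarrow> \<not> x < 0" if "x \<noteq> 0" for x :: int using that by linarith
  have s: "s = (if (i < 0 \<longleftrightarrow> j < 0) \<or> (k < 0 \<longleftrightarrow> l < 0) then 1 else - 1)"
    unfolding s_def olsh_parity_def zero_less_mult_iff nz[THEN pos]
    by (cases "i < 0"; cases "j < 0"; cases "k < 0"; cases "l < 0") simp_all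
  have imp: "j < 0 \<longrightarrow> i < 0" "l < 0 \<longrightarrow> k < 0" using le by auto
  \<comment> \<open>If i and j have the same sign, both thetas equal it and \<open>s\<close> is 1.
    Otherwise the thetas are the signs of k and l, which differ exactly when \<open>s\<close> is
    -1.\<close>
  have theta1: "of_int (olsh_theta i j k) = s * of_int (olsh_theta j i l)"
    using imp unfolding s olsh_theta_def idom_abs_sgn_class.sgn_minus nz[THEN sgn]
    by (cases "i < 0"; cases "j < 0"; cases "k < 0"; cases "l < 0"; simp)
  have theta2: "of_int (olsh_theta i j (- k)) = s * of_int (olsh_theta j i (- l))"
    using imp unfolding s olsh_theta_def idom_abs_sgn_class.sgn_minus nz[THEN sgn]
    by (cases "i < 0"; cases "j < 0"; cases "k < 0"; cases "l < 0"; simp)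
  note theta = theta1 theta2
  have theta_minus': "olsh_theta (- a) (- b) c = - olsh_theta a b (- c)" for a b c
    using theta_minus[of a b "- c"] by simp
  have z': "inverse q - inverse (inverse q) = - z" using z by simp
  have 1: "(s * inverse q powi olsh_phi j l) \<bullet> (L (- l) (- k) * L (- j) (- i))
      = s \<bullet> (q powi olsh_phi (- j) (- l)) \<bullet> (L (- l) (- k) * L (- j) (- i))"
    by (simp add: phi_minus power_int_minus power_int_inverse)
  have 4: "(inverse q powi olsh_phi i k) \<bullet> (L (- j) (- i) * L (- l) (- k))
      = s \<bullet> (s * q powi olsh_phi (- i) (- k)) \<bullet> (L (- j) (- i) * L (- l) (- k))"
    by (simp add: phi_minus power_int_minus power_int_inverse flip: mult.assoc)
  have 2: "(of_bool (k \<le> j \<and> j < l) * of_int (olsh_theta i j k) * - z) \<bullet> x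
      = s \<bullet> (of_bool (- l < - j \<and> - j \<le> - k) * of_int (olsh_theta (- j) (- i) (- l)) * z) \<bullet> x" for x :: 'a
    by (simp add: theta_minus theta conj_commute mult.assoc)
  have 3: "(of_bool (i \<le> - l \<and> - l < j \<and> j \<le> - k) * of_int (olsh_theta (- i) (- j) k) * - z) \<bullet> x
      = s \<bullet> (of_bool (k \<le> - j \<and> - j < l \<and> l \<le> - i) * of_int (olsh_theta j i (- l)) * z) \<bullet> x" for x :: 'a
  proof -
    have "i \<le> - l \<and> - l < j \<and> j \<le> - k \<longleftrightarrow> k \<le> - j \<and> - j < l \<and> l \<le> - i" by auto
    then show ?thesis by (simp add: theta_minus' theta mult.assoc)
  qed
  have 5: "(of_bool (k < i \<and> i \<le> l) * of_int (olsh_theta i j k) * - z) \<bullet> x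
      = s \<bullet> (of_bool (- l \<le> - i \<and> - i < - k) * of_int (olsh_theta (- j) (- i) (- l)) * z) \<bullet> x" for x :: 'a
    by (simp add: theta_minus theta conj_commute mult.assoc)
  have 6: "(of_bool (- l \<le> i \<and> i < - k \<and> - k \<le> j) * of_int (olsh_theta (- i) (- j) k) * - z) \<bullet> x
      = s \<bullet> (of_bool (- j \<le> k \<and> k < - i \<and> - i \<le> l) * of_int (olsh_theta j i (- l)) * z) \<bullet> x" for x :: 'a
  proof -
    have "- l \<le> i \<and> i < - k \<and> - k \<le> j \<longleftrightarrow> - j \<le> k \<and> k < - i \<and> - i \<le> l" by auto
    then show ?thesis by (simp add: theta_minus' theta mult.assoc)
  qed
  show ?thesis
    unfolding exchange_def opp_eq_iff[of "_ + _"] unop_simps opp_matrix_def opp.sel minus_minus z' par z[symmetric]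
      s_def[symmetric] 1 2 3 4 5 6 smul_add_right[symmetric] smul_cancel[OF s0]
    by (rule eq_commute)
qed

end

text \<open>The assumption \<open>exchange_E\<close> makes the locale stable under the symmetry,
  which interchanges it with \<open>exchange_F\<close>.\<close>

locale simple_exchange = triangular +
  assumes n1: "1 \<le> n"
    and exchange_diag: "\<lbrakk>m \<in> indices n; i \<in> indices n; j \<in> indices n; i \<le> j\<rbrakk> \<Longrightarrow> exchange q L i j m m"
    and exchange_F: "\<lbrakk>1 \<le> m; m < n; i \<in> indices n; j \<in> indices n; i \<le> j\<rbrakk> \<Longrightarrow> exchange q L i j m (m + 1)"
    and exchange_E: "\<lbrakk>1 \<le> m; m < n; i \<in> indices n; j \<in> indices n; i \<le> j\<rbrakk> \<Longrightarrow> exchange q L i j (- m - 1) (- m)"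
    and exchange_odd: "\<lbrakk>i \<in> indices n; j \<in> indices n; i \<le> j\<rbrakk> \<Longrightarrow> exchange q L i j (- 1) 1"
begin

lemma exch_all_simple:
  "\<lbrakk>1 \<le> m; m \<le> n\<rbrakk> \<Longrightarrow> exch_all m m" "\<lbrakk>1 \<le> m; m < n\<rbrakk> \<Longrightarrow> exch_all m (m + 1)" "exch_all (- 1) 1"
proof -
  show "exch_all m m" if "1 \<le> m" "m \<le> n"
  proof -
    have m: "m \<in> indices n" "0 < m" using that by (auto simp: indices_def)
    show ?thesis unfolding exch_all_iff[OF m(1) m(1) order_refl m(2)] using exchange_diag[OF m(1)] by blast
  qed
  show "exch_all m (m + 1)" if "1 \<le> m" "m < n"
  proof -
    have m: "m \<in> indices n" "m + 1 \<in> indices n" "m \<le> m + 1" "0 < m + 1" using that by (auto simp: indices_def)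
    show ?thesis unfolding exch_all_iff[OF m] using exchange_F[OF that] by blast
  qed
  have m: "- 1 \<in> indices n" "1 \<in> indices n" "- 1 \<le> (1::int)" "0 < (1::int)" using n1 by (auto simp: indices_def)
  show "exch_all (- 1) 1" unfolding exch_all_iff[OF m] using exchange_odd by blast
qed

lemma exch_all_step:
  assumes "1 \<le> l" "l < n" "k \<in> indices n" "k < l" "exch_all k l" "k = - l - 1 \<Longrightarrow> exch_all (- l) l"
  shows "exch_all k (l + 1)"
  by (rule exch_move) (use assms in \<open>auto intro: exch_all_simple\<close>)

text \<open>The last hypothesis supplies the correction term. For fixed \<open>k\<close> it concerns
  only the column l = -k-1.\<close>

lemma exch_all_row:
  assumes "a \<le> l" "1 \<le> a" "l \<le> n" "k \<in> indices n" "k < a" "exch_all k a"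
    "\<And>l. 1 \<le> l \<Longrightarrow> k = - l - 1 \<Longrightarrow> exch_all (- l) l"
  shows "exch_all k l"
  using assms(1,3)
proof (induction l rule: int_ge_induct)
  case base
  then show ?case using assms by simp
next
  case (step l)
  show ?case by (rule exch_all_step) (use step assms in auto)
qed

lemma exch_all_even: "\<lbrakk>1 \<le> k; k \<le> l; l \<le> n\<rbrakk> \<Longrightarrow> exch_all k l"
proof (cases "k = l")
  assume a: "1 \<le> k" "k \<le> l" "l \<le> n" "k \<noteq> l"
  show "exch_all k l"
    by (rule exch_all_row[of "k + 1"]) (use a exch_all_simple in \<open>auto simp: indices_def\<close>)
qed (auto intro: exch_all_simple)

lemma exch_all_minus_one: "\<lbrakk>1 \<le> l; l \<le> n\<rbrakk> \<Longrightarrow> exch_all (- 1) l"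
  by (rule exch_all_row[of 1]) (use exch_all_simple in \<open>auto simp: indices_def\<close>)

lemma exchange_upper:
  assumes "exch_all k l" "k \<in> indices n" "l \<in> indices n" "k \<le> l" "0 < l" "i \<in> indices n" "j \<in> indices n" "i \<le> j"
  shows "exchange q L i j k l"
  using assms by (simp add: exch_all_iff)

lemma simple_exchange_opp: "simple_exchange (inverse q) (- z) n (opp_matrix L)"
proof -
  interpret opp: triangular "inverse q" "- z" n "opp_matrix L" by (rule triangular_opp)
  have I: "m \<in> indices n" "m + 1 \<in> indices n" "- m - 1 \<in> indices n" "1 \<in> indices n" if "1 \<le> m" "m < n" for m
    using that by (auto simp: indices_def)
  have I1: "1 \<in> indices n" using n1 by (auto simp: indices_def)
  have e: "- (m + 1) = - m - 1" "- (- m - 1) = m + 1" for m :: int by simp_all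
  show ?thesis
  proof
    show "exchange (inverse q) (opp_matrix L) i j m m" if "m \<in> indices n" "i \<in> indices n" "j \<in> indices n" "i \<le> j" for i j m
      using that by (simp add: exchange_opp exchange_diag)
    show "exchange (inverse q) (opp_matrix L) i j m (m + 1)"
      if "1 \<le> m" "m < n" "i \<in> indices n" "j \<in> indices n" "i \<le> j" for i j m
      using that I[OF that(1,2)] exchange_E[OF that(1,2), of "- j" "- i"] by (simp add: exchange_opp e del: minus_add_distrib)
    show "exchange (inverse q) (opp_matrix L) i j (- m - 1) (- m)"
      if "1 \<le> m" "m < n" "i \<in> indices n" "j \<in> indices n" "i \<le> j" for i j m
      using that I[OF that(1,2)] exchange_F[OF that(1,2), of "- j" "- i"] by (simp add: exchange_opp e del: minus_diff_eq)
    show "exchange (inverse q) (opp_matrix L) i j (- 1) 1" if "i \<in> indices n" "j \<in> indices n" "i \<le> j" for i j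
      using that I1 exchange_odd[of "- j" "- i"] by (simp add: exchange_opp)
  qed (rule n1)
qed

theorem exchange_all:
  assumes I: "i \<in> indices n" "j \<in> indices n" "k \<in> indices n" "l \<in> indices n" and le: "i \<le> j" "k \<le> l"
  shows "exchange q L i j k l"
proof -
  interpret opp: simple_exchange "inverse q" "- z" n "opp_matrix L" by (rule simple_exchange_opp)
  have lower: "exchange q L i j (- l) (- k)" if "opp.exch_all k l" "k \<in> indices n" "l \<in> indices n" "k \<le> l" "0 < l"
      "i \<in> indices n" "j \<in> indices n" "i \<le> j" for i j k l
    using opp.exchange_upper[OF that(1-5), of "- j" "- i"] that exchange_opp[of "- j" "- i" k l] by simp
  \<comment> \<open>Row -1 of the opposite matrix is column 1 of \<open>L\<close>: the position (-1,
    a) corresponds to (-a, 1).\<close>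
  have col: "exch_all (- a) 1" if "1 \<le> a" "a \<le> n" for a
    using lower[OF opp.exch_all_minus_one[OF that]] that by (auto simp: exch_all_iff indices_def)
  have odd: "exch_all (- a) b" if "1 \<le> a" "1 \<le> b" "b \<le> n" "a \<le> n" for a b
    using that
  proof (induction a arbitrary: b rule: int_ge_induct)
    case base
    then show ?case by (simp add: exch_all_minus_one)
  next
    case (step a)
    \<comment> \<open>In row -(a + 1) the correction occurs at l = a, where it is the induction
      hypothesis for (-a, a).\<close>
    have *: "exch_all (- l) l" if "1 \<le> l" "- (a + 1) = - l - 1" for l
      using that step.IH[of a] step.prems by auto
    show ?case
      by (rule exch_all_row[of 1]) (use step.prems step.hyps col[of "a + 1"] * in \<open>auto simp: indices_def\<close>)
  qed
  consider "0 < k" | "k < 0" "0 < l" | "l < 0" using I le by (force simp: indices_def)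
  then show ?thesis
  proof cases
    case 1
    then show ?thesis using I le by (intro exchange_upper[OF exch_all_even]) (auto simp: indices_def)
  next
    case 2
    then show ?thesis using I le odd[of "- k" l] by (intro exchange_upper) (auto simp: indices_def)
  next
    case 3
    then show ?thesis using I le opp.exch_all_even[of "- l" "- k"] lower[of "- l" "- k" i j]
      by (auto simp: indices_def)
  qed
qed

end

section \<open>From the Chevalley generators to the matrix\<close>

text \<open>Here \<open>K m\<close> and \<open>K (- m)\<close> stand for $q^{k_m}$ and $q^{-k_m}$. Of the relations
  between two odd generators only those with $k_{\bar 1}$ are needed.\<close>

locale chev_system =
  fixes q z :: ratfun and n :: int and K f e fb eb kb :: "int \<Rightarrow> 'a::ratfun_algebra"
  assumes q0 [simp]: "q \<noteq> 0" and z: "z = q - inverse q" and z0 [simp]: "z \<noteq> 0"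
    and q2: "1 + q * q \<noteq> 0" and n1: "1 \<le> n"
    and K_inv: "\<lbrakk>1 \<le> m; m \<le> n\<rbrakk> \<Longrightarrow> K m * K (- m) = 1" "\<lbrakk>1 \<le> m; m \<le> n\<rbrakk> \<Longrightarrow> K (- m) * K m = 1"
    and K_K: "\<lbrakk>1 \<le> m; m \<le> n; 1 \<le> i; i \<le> n\<rbrakk> \<Longrightarrow> K m * K i = K i * K m"
    and K_f: "\<lbrakk>1 \<le> m; m \<le> n; 1 \<le> i; i < n\<rbrakk> \<Longrightarrow>
      K m * f i = (if m = i then inverse q else if m = i + 1 then q else 1) \<bullet> (f i * K m)"
    and K_e: "\<lbrakk>1 \<le> m; m \<le> n; 1 \<le> i; i < n\<rbrakk> \<Longrightarrow>
      K m * e i = (if m = i then q else if m = i + 1 then inverse q else 1) \<bullet> (e i * K m)"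
    and K_fb: "\<lbrakk>1 \<le> m; m \<le> n; 1 \<le> i; i < n\<rbrakk> \<Longrightarrow>
      K m * fb i = (if m = i then inverse q else if m = i + 1 then q else 1) \<bullet> (fb i * K m)"
    and K_eb: "\<lbrakk>1 \<le> m; m \<le> n; 1 \<le> i; i < n\<rbrakk> \<Longrightarrow>
      K m * eb i = (if m = i then q else if m = i + 1 then inverse q else 1) \<bullet> (eb i * K m)"
    and K_kb: "\<lbrakk>1 \<le> m; m \<le> n; 1 \<le> i; i \<le> n\<rbrakk> \<Longrightarrow> K m * kb i = kb i * K m"
    and e_f: "\<lbrakk>1 \<le> i; i < n\<rbrakk> \<Longrightarrow> e i * f i - f i * e i = inverse z \<bullet> (K i * K (- (i + 1)) - K (- i) * K (i + 1))"
    and e_f_up: "\<lbrakk>1 \<le> i; i + 1 < n\<rbrakk> \<Longrightarrow> q \<bullet> (e (i + 1) * f i) = f i * e (i + 1)"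
    and e_f_dn: "\<lbrakk>1 \<le> i; i + 1 < n\<rbrakk> \<Longrightarrow> e i * f (i + 1) = q \<bullet> (f (i + 1) * e i)"
    and e_f_far: "\<lbrakk>1 \<le> i; i < n; 1 \<le> j; j < n; \<bar>i - j\<bar> > 1\<rbrakk> \<Longrightarrow> e i * f j = f j * e i"
    and e_fb: "\<lbrakk>1 \<le> i; i < n\<rbrakk> \<Longrightarrow> e i * fb i - fb i * e i = K (- (i + 1)) * kb i - kb (i + 1) * K (- i)"
    and e_fb_up: "\<lbrakk>1 \<le> i; i + 1 < n\<rbrakk> \<Longrightarrow> q \<bullet> (e (i + 1) * fb i) = fb i * e (i + 1)"
    and e_fb_dn: "\<lbrakk>1 \<le> i; i + 1 < n\<rbrakk> \<Longrightarrow> e i * fb (i + 1) = q \<bullet> (fb (i + 1) * e i)"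
    and e_fb_far: "\<lbrakk>1 \<le> i; i < n; 1 \<le> j; j < n; \<bar>i - j\<bar> > 1\<rbrakk> \<Longrightarrow> e i * fb j = fb j * e i"
    and eb_f: "\<lbrakk>1 \<le> i; i < n\<rbrakk> \<Longrightarrow> eb i * f i - f i * eb i = K (i + 1) * kb i - kb (i + 1) * K i"
    and eb_f_up: "\<lbrakk>1 \<le> i; i + 1 < n\<rbrakk> \<Longrightarrow> q \<bullet> (eb (i + 1) * f i) = f i * eb (i + 1)"
    and eb_f_dn: "\<lbrakk>1 \<le> i; i + 1 < n\<rbrakk> \<Longrightarrow> eb i * f (i + 1) = q \<bullet> (f (i + 1) * eb i)"
    and eb_f_far: "\<lbrakk>1 \<le> i; i < n; 1 \<le> j; j < n; \<bar>i - j\<bar> > 1\<rbrakk> \<Longrightarrow> eb i * f j = f j * eb i"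
    and kb_e: "\<lbrakk>1 \<le> i; i < n\<rbrakk> \<Longrightarrow> kb i * e i - q \<bullet> (e i * kb i) = eb i * K (- i)"
    and kb_e_dn: "\<lbrakk>1 \<le> i; i < n\<rbrakk> \<Longrightarrow> q \<bullet> (kb (i + 1) * e i) - e i * kb (i + 1) = - (K (- (i + 1)) * eb i)"
    and kb_e_far: "\<lbrakk>1 \<le> i; i \<le> n; 1 \<le> j; j < n; i \<noteq> j; i \<noteq> j + 1\<rbrakk> \<Longrightarrow> kb i * e j = e j * kb i"
    and kb_f: "\<lbrakk>1 \<le> i; i < n\<rbrakk> \<Longrightarrow> kb i * f i - q \<bullet> (f i * kb i) = - (fb i * K i)"
    and kb_f_dn: "\<lbrakk>1 \<le> i; i < n\<rbrakk> \<Longrightarrow> q \<bullet> (kb (i + 1) * f i) - f i * kb (i + 1) = K (i + 1) * fb i"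
    and kb_f_far: "\<lbrakk>1 \<le> i; i \<le> n; 1 \<le> j; j < n; i \<noteq> j; i \<noteq> j + 1\<rbrakk> \<Longrightarrow> kb i * f j = f j * kb i"
    and kb_sq: "(q * q - inverse q * inverse q) \<bullet> (kb 1 * kb 1) = K 1 * K 1 - K (- 1) * K (- 1)"
    and kb_kb: "\<lbrakk>2 \<le> i; i \<le> n\<rbrakk> \<Longrightarrow> kb 1 * kb i = - (kb i * kb 1)"
    and kb_fb: "1 < n \<Longrightarrow> kb 1 * fb 1 + q \<bullet> (fb 1 * kb 1) = f 1 * K 1"
    and kb_fb_far: "\<lbrakk>2 \<le> i; i < n\<rbrakk> \<Longrightarrow> kb 1 * fb i = - (fb i * kb 1)"
    and kb_eb: "1 < n \<Longrightarrow> kb 1 * eb 1 + q \<bullet> (eb 1 * kb 1) = e 1 * K (- 1)"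
    and kb_eb_far: "\<lbrakk>2 \<le> i; i < n\<rbrakk> \<Longrightarrow> kb 1 * eb i = - (eb i * kb 1)"
    and e_e_far: "\<lbrakk>1 \<le> i; i < n; 1 \<le> j; j < n; \<bar>i - j\<bar> > 1\<rbrakk> \<Longrightarrow> e i * e j = e j * e i"
    and f_f_far: "\<lbrakk>1 \<le> i; i < n; 1 \<le> j; j < n; \<bar>i - j\<bar> > 1\<rbrakk> \<Longrightarrow> f i * f j = f j * f i"
    and e_eb: "\<lbrakk>1 \<le> i; i < n; 1 \<le> j; j < n; \<bar>i - j\<bar> \<noteq> 1\<rbrakk> \<Longrightarrow> e i * eb j = eb j * e i"
    and f_fb: "\<lbrakk>1 \<le> i; i < n; 1 \<le> j; j < n; \<bar>i - j\<bar> \<noteq> 1\<rbrakk> \<Longrightarrow> f i * fb j = fb j * f i"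
    and e_eb_next: "\<lbrakk>1 \<le> i; i + 1 < n\<rbrakk> \<Longrightarrow> e i * eb (i + 1) - eb (i + 1) * e i = eb i * e (i + 1) - e (i + 1) * eb i"
    and f_fb_next: "\<lbrakk>1 \<le> i; i + 1 < n\<rbrakk> \<Longrightarrow> fb (i + 1) * f i - f i * fb (i + 1) = f (i + 1) * fb i - fb i * f (i + 1)"
    and serre_e: "\<lbrakk>1 \<le> i; i + 1 < n\<rbrakk> \<Longrightarrow>
      q \<bullet> (e i * e i * e (i + 1)) - (q + inverse q) \<bullet> (e i * e (i + 1) * e i) + inverse q \<bullet> (e (i + 1) * e i * e i) = 0"
    and serre_f: "\<lbrakk>1 \<le> i; i + 1 < n\<rbrakk> \<Longrightarrow>
      q \<bullet> (f i * f i * f (i + 1)) - (q + inverse q) \<bullet> (f i * f (i + 1) * f i) + inverse q \<bullet> (f (i + 1) * f i * f i) = 0"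
    and serre_e': "\<lbrakk>1 \<le> i; i + 1 < n\<rbrakk> \<Longrightarrow>
      q \<bullet> (e i * e (i + 1) * e (i + 1)) - (q + inverse q) \<bullet> (e (i + 1) * e i * e (i + 1)) + inverse q \<bullet> (e (i + 1) * e (i + 1) * e i) = 0"
    and serre_f': "\<lbrakk>1 \<le> i; i + 1 < n\<rbrakk> \<Longrightarrow>
      q \<bullet> (f i * f (i + 1) * f (i + 1)) - (q + inverse q) \<bullet> (f (i + 1) * f i * f (i + 1)) + inverse q \<bullet> (f (i + 1) * f (i + 1) * f i) = 0"
    and serre_eb: "\<lbrakk>1 \<le> i; i + 1 < n\<rbrakk> \<Longrightarrow>
      q \<bullet> (e i * e i * eb (i + 1)) - (q + inverse q) \<bullet> (e i * eb (i + 1) * e i) + inverse q \<bullet> (eb (i + 1) * e i * e i) = 0"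
    and serre_fb: "\<lbrakk>1 \<le> i; i + 1 < n\<rbrakk> \<Longrightarrow>
      q \<bullet> (f i * f i * fb (i + 1)) - (q + inverse q) \<bullet> (f i * fb (i + 1) * f i) + inverse q \<bullet> (fb (i + 1) * f i * f i) = 0"
    and serre_eb': "\<lbrakk>1 \<le> i; i + 1 < n\<rbrakk> \<Longrightarrow>
      q \<bullet> (eb i * e (i + 1) * e (i + 1)) - (q + inverse q) \<bullet> (e (i + 1) * eb i * e (i + 1)) + inverse q \<bullet> (e (i + 1) * e (i + 1) * eb i) = 0"
    and serre_fb': "\<lbrakk>1 \<le> i; i + 1 < n\<rbrakk> \<Longrightarrow>
      q \<bullet> (fb i * f (i + 1) * f (i + 1)) - (q + inverse q) \<bullet> (f (i + 1) * fb i * f (i + 1)) + inverse q \<bullet> (f (i + 1) * f (i + 1) * fb i) = 0"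
begin

lemma K_Ki_commute:
  assumes "1 \<le> m" "m \<le> n" "K m * x = c \<bullet> (x * K m)" "c \<noteq> 0"
  shows "K (- m) * x = inverse c \<bullet> (x * K (- m))"
  using commute_inverse[OF assms(3) K_inv] assms by blast

lemma Ki_f: "\<lbrakk>1 \<le> m; m \<le> n; 1 \<le> i; i < n\<rbrakk> \<Longrightarrow>
    K (- m) * f i = (if m = i then q else if m = i + 1 then inverse q else 1) \<bullet> (f i * K (- m))"
  using K_Ki_commute[OF _ _ K_f[of m i]] by (simp split: if_splits)

lemma Ki_e: "\<lbrakk>1 \<le> m; m \<le> n; 1 \<le> i; i < n\<rbrakk> \<Longrightarrow>
    K (- m) * e i = (if m = i then inverse q else if m = i + 1 then q else 1) \<bullet> (e i * K (- m))"
  using K_Ki_commute[OF _ _ K_e[of m i]] by (simp split: if_splits)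

lemma Ki_fb: "\<lbrakk>1 \<le> m; m \<le> n; 1 \<le> i; i < n\<rbrakk> \<Longrightarrow>
    K (- m) * fb i = (if m = i then q else if m = i + 1 then inverse q else 1) \<bullet> (fb i * K (- m))"
  using K_Ki_commute[OF _ _ K_fb[of m i]] by (simp split: if_splits)

lemma Ki_eb: "\<lbrakk>1 \<le> m; m \<le> n; 1 \<le> i; i < n\<rbrakk> \<Longrightarrow>
    K (- m) * eb i = (if m = i then inverse q else if m = i + 1 then q else 1) \<bullet> (eb i * K (- m))"
  using K_Ki_commute[OF _ _ K_eb[of m i]] by (simp split: if_splits)

lemma Ki_kb: "\<lbrakk>1 \<le> m; m \<le> n; 1 \<le> i; i \<le> n\<rbrakk> \<Longrightarrow> K (- m) * kb i = kb i * K (- m)"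
  using K_Ki_commute[of m "kb i" 1] K_kb by simp

lemma Ki_K: "\<lbrakk>1 \<le> m; m \<le> n; 1 \<le> i; i \<le> n\<rbrakk> \<Longrightarrow> K (- m) * K i = K i * K (- m)"
  using K_Ki_commute[of m "K i" 1] K_K by simp

lemma Ki_Ki: "\<lbrakk>1 \<le> m; m \<le> n; 1 \<le> i; i \<le> n\<rbrakk> \<Longrightarrow> K (- m) * K (- i) = K (- i) * K (- m)"
  using K_Ki_commute[of i "K (- m)" 1] Ki_K[of m i] by simp

lemma qq [simp]: "q * inverse q = 1" "inverse q * q = 1" "q * (inverse q * c) = c" "inverse q * (q * c) = c"
  by (simp_all add: mult.assoc[symmetric] del: mult.assoc)

lemma serre_eq:
  assumes "q \<bullet> (a::'a) - (q + inverse q) \<bullet> b + inverse q \<bullet> c = 0"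
  shows "c = (1 + q * q) \<bullet> b - (q * q) \<bullet> a"
proof -
  have "inverse q \<bullet> c = (q + inverse q) \<bullet> b - q \<bullet> a"
    using assms by (simp add: algebra_simps)
  then have "q \<bullet> inverse q \<bullet> c = q \<bullet> ((q + inverse q) \<bullet> b - q \<bullet> a)" by (simp only:)
  then show ?thesis by (simp add: smul_diff_right distrib_left add.commute)
qed

lemma smul_eqI: "x = inverse q \<bullet> y" if "q \<bullet> x = y" for x y :: 'a
  using that by auto

text \<open>Reading the products backwards interchanges the coefficients q and q^{-1}, so that Serre
  relations become Serre relations of the opposite algebra.\<close>

lemma serre_flip:
  assumes "q \<bullet> (a * b * c) - (q + inverse q) \<bullet> (u * v * w) + inverse q \<bullet> (x * y * t) = (0::'a)"
  shows "inverse q \<bullet> (x * (y * t)) - (inverse q + q) \<bullet> (u * (v * w)) + q \<bullet> (a * (b * c)) = 0"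
    "(inverse q + q) \<bullet> (u * (v * w)) - inverse q \<bullet> (x * (y * t)) = q \<bullet> (a * (b * c))"
  using assms by (simp_all add: mult.assoc algebra_simps)

text \<open>The symmetry sends L_{i,i+1} to L_{-i-1,-i}, and z becoming -z accounts for the opposite
  signs in the definitions of \<open>f\<close> and \<open>e\<close>. All odd generators have the
  same sign in their definitions, so there the minus sign remains.\<close>

lemma chev_system_opp:
  "chev_system (inverse q) (- z) n (\<lambda>m. Opp (K (- m))) (\<lambda>i. Opp (e i)) (\<lambda>i. Opp (f i))
    (\<lambda>i. - Opp (eb i)) (\<lambda>i. - Opp (fb i)) (\<lambda>i. - Opp (kb i))"
proof -
  have K_kb_next: "kb i * K (i + 1) = K (i + 1) * kb i" "kb (i + 1) * K i = K i * kb (i + 1)"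
      "kb i * K (- i - 1) = K (- i - 1) * kb i" "kb (i + 1) * K (- i) = K (- i) * kb (i + 1)"
    if "1 \<le> i" "i < n" for i
    using K_kb[of "i + 1" i] K_kb[of i "i + 1"] Ki_kb[of "i + 1" i] Ki_kb[of i "i + 1"] that by simp_all
  have Ki_eb': "K (- i - 1) * eb i = q \<bullet> (eb i * K (- i - 1))" if "1 \<le> i" "i < n" for i
    using Ki_eb[of "i + 1" i] that by simp
  have kb_f': "kb i * f i = q \<bullet> (f i * kb i) - fb i * K i" if "1 \<le> i" "i < n" for i
    using kb_f[OF that] by (simp add: algebra_simps)
  have kb_f_dn': "kb (i + 1) * f i = inverse q \<bullet> (f i * kb (i + 1) + K (i + 1) * fb i)" if "1 \<le> i" "i < n" for i
    by (rule smul_eqI) (use kb_f_dn[OF that] in \<open>simp add: diff_eq_eq add.commute\<close>)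
  have kb_e': "kb i * e i = q \<bullet> (e i * kb i) + eb i * K (- i)" if "1 \<le> i" "i < n" for i
    using kb_e[OF that] by (simp add: diff_eq_eq add.commute)
  have kb_e_dn': "kb (i + 1) * e i = inverse q \<bullet> (e i * kb (i + 1) - K (- i - 1) * eb i)" if "1 \<le> i" "i < n" for i
    by (rule smul_eqI) (use kb_e_dn[OF that] in \<open>simp add: nc_simps\<close>)
  have zz: "inverse (inverse q - q) = - inverse z" unfolding z inverse_minus_eq[symmetric] by simp
  have qz: "inverse q \<noteq> q" using z z0 by auto
  have q2': "1 + inverse q * inverse q \<noteq> 0"
  proof
    assume "1 + inverse q * inverse q = 0"
    then have "q * q * (1 + inverse q * inverse q) = 0" by simp
    then show False using q2 by (simp add: distrib_left mult.assoc add.commute)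
  qed
  show ?thesis
    apply unfold_locales
    apply (simp_all only: opp_eq_iff unop_simps opp.sel minus_minus mult_minus_left mult_minus_right neg_equal_iff_equal smul_minus_right)
    apply (simp_all add: K_inv Ki_Ki Ki_f Ki_e Ki_fb Ki_eb Ki_kb n1 z e_f_far e_fb_far eb_f_far kb_e_far kb_f_far kb_kb kb_fb_far kb_eb_far
      e_e_far f_f_far e_eb f_fb e_f_up e_f_dn qz q2')
    subgoal for i using e_f[of i] Ki_K[of i "i + 1"] Ki_K[of "i + 1" i] by (simp add: zz flip: smul_minus_right)
    subgoal for i by (rule smul_eqI[OF e_f_up])
    subgoal for i using eb_f[of i] by (simp add: K_kb_next) (metis minus_diff_eq)
    subgoal for i by (simp add: eb_f_dn)
    subgoal for i by (rule smul_eqI[OF eb_f_up])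
    subgoal for i using e_fb[of i] by (simp add: K_kb_next) (metis minus_diff_eq)
    subgoal for i by (simp add: e_fb_dn)
    subgoal for i by (rule smul_eqI[OF e_fb_up])
    subgoal for i by (simp add: kb_f' K_fb smul_diff_right)
    subgoal for i by (simp add: kb_f_dn' K_fb smul_add_right)
    subgoal for i by (simp add: kb_e' smul_add_right)
    subgoal for i by (simp add: kb_e_dn' Ki_eb' smul_diff_right)
    subgoal using kb_sq by (metis minus_diff_eq smul_minus_left)
    subgoal using kb_eb by (simp add: eq_diff_eq[symmetric] smul_diff_right)
    subgoal using kb_fb by (simp add: eq_diff_eq[symmetric] smul_diff_right K_f)
    subgoal for i using f_fb_next[of i] by (metis minus_diff_eq)
    subgoal for i using e_eb_next[of i] by (metis minus_diff_eq)
    subgoal for i using serre_flip(1)[OF serre_f[of i]] by simp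
    subgoal for i using serre_flip(1)[OF serre_e[of i]] by simp
    subgoal for i using serre_flip(1)[OF serre_f'[of i]] by simp
    subgoal for i using serre_flip(1)[OF serre_e'[of i]] by simp
    subgoal for i using serre_flip(2)[OF serre_fb[of i]] by simp
    subgoal for i using serre_flip(2)[OF serre_eb[of i]] by simp
    subgoal for i using serre_flip(2)[OF serre_fb'[of i]] by simp
    subgoal for i using serre_flip(2)[OF serre_eb'[of i]] by simp
    done
qed

lemma e_f_exch: "\<lbrakk>1 \<le> i; i < n\<rbrakk> \<Longrightarrow> e i * f i = f i * e i + inverse z \<bullet> (K i * K (- (i + 1)) - K (- i) * K (i + 1))"
  using e_f[of i] by (simp add: algebra_simps)

text \<open>With \<open>K\<close> for \<open>G\<close>, the axioms \<open>G_f\<close> and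
  \<open>G_f_dn\<close> express the weight of \<open>f\<close> through z = q - q^{-1}, and those on
  \<open>X\<close> are z times relations between the \<open>f\<close> and the
  \<open>e\<close>.\<close>

lemma strand_even: "strand q z n K (\<lambda>m. K (- m)) f e K (\<lambda>a. z \<bullet> f a) (\<lambda>_. 0)"
proof -
  have z': "q - inverse q = z" by (rule z[symmetric])
  have qq1: "q \<bullet> x - inverse q \<bullet> x = z \<bullet> x" for x :: 'a by (simp add: z smul_diff_left)
  have K': "K i * K (- (i + 1)) = K (- (i + 1)) * K i" if "1 \<le> i" "i < n" for i
    using Ki_K[of "i + 1" i] that by simp
  have zq: "z * q = q * q - 1" by (simp add: z algebra_simps)
  show ?thesis
    apply unfold_locales
    apply (simp_all add: z' q2 K_inv K_K K_f K_e f_f_far e_f_far e_f_dn e_f_exch Ki_f Ki_e Ki_K smul_diff_right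
      smul_add_right qq1 serre_eq[OF serre_f] serre_eq[OF serre_f'] smul_eqI[OF e_f_up])
    apply (simp add: zq smul_diff_left)
    apply (simp_all add: mult_ac)
    done
qed

text \<open>The axioms that contain \<open>G\<close>, \<open>X\<close> or \<open>Y\<close> are
  linear in them, so each is a multiple of a relation between an odd and an even generator.\<close>

lemma strand_odd: "strand q z n K (\<lambda>m. K (- m)) f e (\<lambda>a. - (z \<bullet> kb a)) (\<lambda>a. - (z \<bullet> fb a)) (\<lambda>a. - (z \<bullet> eb a))"
proof -
  have z': "q - inverse q = z" by (rule z[symmetric])
  have c: "x = y \<Longrightarrow> z \<bullet> x = z \<bullet> y" for x y :: 'a by simp
  show ?thesis
    apply unfold_locales
    apply (simp_all add: z' q2 K_inv K_K K_f K_e f_f_far e_f_far e_f_dn Ki_f Ki_e Ki_K smul_diff_right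
      smul_add_right serre_eq[OF serre_f] serre_eq[OF serre_f'] smul_eqI[OF e_f_up] K_kb K_fb)
    subgoal for a using c[OF kb_f[of a]] by (simp add: smul_diff_right mult_ac)
    subgoal for a using c[OF kb_f_dn[of a]] by (simp add: smul_diff_right K_fb mult_ac algebra_simps)
    subgoal for a i by (simp add: kb_f_far)
    subgoal for a by (simp add: f_fb)
    subgoal for a using c[OF f_fb_next[of a]] by (simp add: smul_diff_right mult_ac algebra_simps)
    subgoal for a using c[OF serre_eq[OF serre_fb[of a]]] by (simp add: smul_diff_right mult_ac algebra_simps)
    subgoal for a using c[OF serre_eq[OF serre_fb'[of a]]] by (simp add: smul_diff_right mult_ac algebra_simps)
    subgoal for a using arg_cong[OF c[OF kb_e[of a]], of "\<lambda>x. inverse q \<bullet> x"]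
      by (simp add: smul_diff_right Ki_eb mult_ac algebra_simps mult.left_commute[of q z "inverse q"])
    subgoal for a using arg_cong[OF c[OF kb_e_dn[of a]], of "\<lambda>x. inverse q \<bullet> x"] Ki_eb[of "a + 1" a]
      by (simp add: smul_diff_right mult_ac nc_simps mult.left_commute[of q z "inverse q"])
    subgoal for a i by (simp add: kb_e_far)
    subgoal for a using c[OF e_fb[of a]] Ki_kb[of "a + 1" a] Ki_kb[of a "a + 1"] by (simp add: smul_diff_right mult_ac nc_simps)
    subgoal for a using c[OF smul_eqI[OF e_fb_up[of a]]] by (simp add: mult_ac)
    subgoal for a using c[OF e_fb_dn[of a]] by (simp add: mult_ac)
    subgoal for a using e_f_exch[of a] Ki_K[of a "a + 1"] Ki_K[of "a + 1" a] by (simp add: smul_diff_right)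
    done
qed

end

sublocale chev_system \<subseteq> even: strand q z n K "\<lambda>m. K (- m)" f e K "\<lambda>a. z \<bullet> f a" "\<lambda>_. 0"
  by (rule strand_even)

sublocale chev_system \<subseteq> odd: strand q z n K "\<lambda>m. K (- m)" f e
  "\<lambda>a. - (z \<bullet> kb a)" "\<lambda>a. - (z \<bullet> fb a)" "\<lambda>a. - (z \<bullet> eb a)"
  by (rule strand_odd)

section \<open>The entries with |i| \<le> j and their relations with k_1-bar\<close>

context chev_system
begin

definition upper :: "int \<Rightarrow> int \<Rightarrow> 'a" where
  "upper i j = (if 0 < i then even.V i j else odd.V (- i) j)"

text \<open>All generators in these strings have index at least 2. \<open>kb 1\<close> commutes with
  the even ones and anticommutes with the odd ones.\<close>

lemma upper_odd_gt:
  assumes "2 \<le> a" "a \<le> b" "b \<le> n"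
  shows "kb 1 * even.V a b = even.V a b * kb 1" "kb 1 * odd.V a b = - (odd.V a b * kb 1)"
proof -
  have f: "kb 1 * f i = 1 \<bullet> (f i * kb 1)" "kb 1 * K (- i) = 1 \<bullet> (K (- i) * kb 1)" if "2 \<le> i" "i < n" for i
    using that by (simp_all add: kb_f_far Ki_kb)
  have "1 \<le> a" using assms by simp
  then show "kb 1 * even.V a b = even.V a b * kb 1" using assms(2,3)
  proof (induction b rule: even.V_induct)
    case (Suc b)
    then have v: "kb 1 * even.V a b = 1 \<bullet> (even.V a b * kb 1)" by simp
    show ?case using q_commute_bracket[OF f(1) v f(2), of b b 1] Suc assms by simp
  qed (use assms in \<open>simp_all add: K_kb kb_f_far\<close>)
  from \<open>1 \<le> a\<close> show "kb 1 * odd.V a b = - (odd.V a b * kb 1)" using assms(2,3)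
  proof (induction b rule: odd.V_induct)
    case (Suc b)
    then have v: "kb 1 * odd.V a b = (- 1) \<bullet> (odd.V a b * kb 1)" by simp
    show ?case using q_commute_bracket[OF f(1) v f(2), of b b 1] Suc assms by simp
  qed (use assms in \<open>simp_all add: kb_kb kb_fb_far\<close>)
qed

text \<open>For b = 2 these are \<open>kb_f\<close> and \<open>kb_fb\<close> at node 1. Each further
  \<open>f b\<close> commutes with \<open>kb 1\<close> and \<open>K 1\<close>, so the equations
  survive the brackets.\<close>

lemma upper_odd_one:
  assumes "2 \<le> b" "b \<le> n"
  shows "even.V 1 b * kb 1 = inverse q \<bullet> (kb 1 * even.V 1 b) - K 1 * odd.V 1 b"
    "odd.V 1 b * kb 1 = - (inverse q \<bullet> (kb 1 * odd.V 1 b)) - K 1 * even.V 1 b"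
proof -
  have "even.V 1 b * kb 1 = inverse q \<bullet> (kb 1 * even.V 1 b) - K 1 * odd.V 1 b \<and>
    odd.V 1 b * kb 1 = - (inverse q \<bullet> (kb 1 * odd.V 1 b)) - K 1 * even.V 1 b"
    using assms
  proof (induction b rule: int_ge_induct)
    case base
    then have n: "1 < n" by simp
    have "f 1 * kb 1 = inverse q \<bullet> (kb 1 * f 1 + fb 1 * K 1)"
      using kb_f[of 1] n by (intro smul_eqI) (simp add: diff_eq_eq nc_simps)
    moreover have "fb 1 * kb 1 = inverse q \<bullet> (f 1 * K 1 - kb 1 * fb 1)"
      using kb_fb[OF n] by (intro smul_eqI) (simp add: eq_diff_eq add.commute)
    ultimately show ?case
      using even.V_X[of 1] odd.V_X[of 1] n K_f[of 1 1] K_fb[of 1 1]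
      by (simp add: smul_add_right smul_diff_right mult_ac)
  next
    case (step b)
    have r: "f b * kb 1 = kb 1 * f b" "f b * K 1 = K 1 * f b" "K (- b) * kb 1 = kb 1 * K (- b)"
      using step K_f[of 1 b] Ki_kb[of b 1] by (simp_all add: kb_f_far)
    note IH = step.IH[THEN conjunct1] step.IH[THEN conjunct2]
    show ?case using step IH by (simp add: even.V_Suc odd.V_Suc IH IH[THEN assoc_subst] r r[THEN assoc_subst] nc_simps)
  qed
  then show "even.V 1 b * kb 1 = inverse q \<bullet> (kb 1 * even.V 1 b) - K 1 * odd.V 1 b"
    "odd.V 1 b * kb 1 = - (inverse q \<bullet> (kb 1 * odd.V 1 b)) - K 1 * even.V 1 b" by blast+
qed

text \<open>The factorization q^2 - q^{-2} = (q + q^{-1}) z brings \<open>kb_sq\<close> into the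
  form of the exchange relation of L_{-1,1} with itself.\<close>

lemma kb_square: "q \<bullet> (z \<bullet> (kb 1 * kb 1)) + K (- 1) * K (- 1) = - (inverse q \<bullet> (z \<bullet> (kb 1 * kb 1))) + K 1 * K 1"
proof -
  have "q * q - inverse q * inverse q = q * z + inverse q * z" by (simp add: z algebra_simps)
  then show ?thesis using kb_sq by (simp add: smul_add_left algebra_simps)
qed

lemma upper_f:
  assumes "i \<noteq> 0" "\<bar>i\<bar> \<le> j" "j \<le> n" "1 \<le> m" "m < n"
  shows "(if j = m + 1 then q else 1) \<bullet> (upper i j * f m) + (if j = m then upper i (m + 1) * K m else 0)
    = (if \<bar>i\<bar> = m then q else 1) \<bullet> (f m * upper i j) + (if i = m + 1 then K (m + 1) * upper m j else 0)
      + (if i = - m - 1 then K (m + 1) * upper (- m) j else 0)"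
  using assms even.exchange_f_V[of i j m] odd.exchange_f_V[of "- i" j m]
  by (cases "0 < i") (auto simp: upper_def)

lemma upper_e:
  assumes "i \<noteq> 0" "\<bar>i\<bar> \<le> j" "j \<le> n" "1 \<le> m" "m < n"
  shows "(if j = m then inverse q else 1) \<bullet> (upper i j * e m)
      + (if j = m + 1 then (if \<bar>i\<bar> = m + 1 then if 0 < i then 0 else - (z \<bullet> eb m) else upper i m) * K (- (m + 1)) else 0)
    = (if \<bar>i\<bar> = m + 1 then inverse q else 1) \<bullet> (e m * upper i j)
      + (if i = m then K (- m) * (if j = m then 0 else upper (m + 1) j) else 0)
      + (if i = - m then K (- m) * (if j = m then - (z \<bullet> eb m) else upper (- m - 1) j) else 0)"
  using assms even.exchange_e_V[of i j m] odd.exchange_e_V[of "- i" j m]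
  by (cases "0 < i") (auto simp: upper_def add.commute[of 1 m])

lemma upper_K:
  assumes "i \<noteq> 0" "\<bar>i\<bar> \<le> j" "j \<le> n" "1 \<le> m" "m \<le> n"
  shows "(if j = m then q else 1) \<bullet> (upper i j * K m) = (if \<bar>i\<bar> = m then q else 1) \<bullet> (K m * upper i j)"
    "(if j = m then inverse q else 1) \<bullet> (upper i j * K (- m)) = (if \<bar>i\<bar> = m then inverse q else 1) \<bullet> (K (- m) * upper i j)"
  using assms even.exchange_K_V[of i j m] odd.exchange_K_V[of "- i" j m]
  by (cases "0 < i"; auto simp: upper_def)+

lemma upper_simps: "1 \<le> m \<Longrightarrow> upper m m = K m" "1 \<le> m \<Longrightarrow> upper (- m) m = - (z \<bullet> kb m)"
  "1 \<le> m \<Longrightarrow> m < n \<Longrightarrow> upper m (m + 1) = z \<bullet> f m" "1 \<le> m \<Longrightarrow> m < n \<Longrightarrow> upper (- m) (m + 1) = - (z \<bullet> fb m)"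
  by (simp_all add: upper_def even.V_X odd.V_X)

end

text \<open>To be used for \<open>L_matrix\<close> and for its opposite. The entries of the latter
  with |i| \<le> j are the lower entries of the former, so it suffices to treat this region
  here.\<close>

locale upper_system = chev_system q z n K f e fb eb kb + tri: triangular q z n L
  for q z :: ratfun and n :: int and K f e fb eb kb :: "int \<Rightarrow> 'a::ratfun_algebra" and L :: "int \<Rightarrow> int \<Rightarrow> 'a" +
  assumes L_upper: "\<lbrakk>i \<noteq> 0; \<bar>i\<bar> \<le> j; j \<le> n\<rbrakk> \<Longrightarrow> L i j = upper i j"
    and L_neg_diag: "\<lbrakk>1 \<le> m; m \<le> n\<rbrakk> \<Longrightarrow> L (- m) (- m) = K (- m)"
    and L_E: "\<lbrakk>1 \<le> m; m < n\<rbrakk> \<Longrightarrow> L (- m - 1) (- m) = - (z \<bullet> e m)"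
    and L_Eb: "\<lbrakk>1 \<le> m; m < n\<rbrakk> \<Longrightarrow> L (- m - 1) m = - (z \<bullet> eb m)"
begin

context
  fixes i j :: int
  assumes ij: "i \<noteq> 0" "\<bar>i\<bar> \<le> j" "j \<le> n"
begin

lemma mem_ij: "i \<in> indices n" "j \<in> indices n" "i \<le> j" "0 < j"
  using ij by (auto simp: indices_def)

lemma upper_exchange_diag:
  assumes "1 \<le> m" "m \<le> n"
  shows "exchange q L i j m m" "exchange q L i j (- m) (- m)"
proof -
  have phi: "q powi olsh_phi a m = (if \<bar>a\<bar> = m then q else 1)"
    "q powi olsh_phi a (- m) = (if \<bar>a\<bar> = m then inverse q else 1)" for a
    using assms by (auto simp: tri.powi_phi)
  have par: "olsh_parity m m = 0" "olsh_parity (- m) (- m) = 0" using assms by (auto simp: olsh_parity_def)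
  have L: "L m m = K m" using assms L_upper[of m m] upper_simps by simp
  have c: "(m \<le> j \<and> j < m) = False" "(i \<le> - m \<and> - m < j \<and> j \<le> - m) = False"
     "(m < i \<and> i \<le> m) = False" "(- m \<le> i \<and> i < - m \<and> - m \<le> j) = False"
     "(- m \<le> j \<and> j < - m) = False" "(i \<le> m \<and> m < j \<and> j \<le> m) = False"
     "(- m < i \<and> i \<le> - m) = False" "(m \<le> i \<and> i < m \<and> m \<le> j) = False" by auto
  show "exchange q L i j m m"
    unfolding exchange_def par c using upper_K(1)[OF ij assms] ij
    by (simp add: phi L L_upper)
  show "exchange q L i j (- m) (- m)"
    unfolding exchange_def par minus_minus c using upper_K(2)[OF ij assms] ij assms
    by (simp add: phi L_neg_diag L_upper)
qed

lemma upper_exchange_f: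
  assumes m: "1 \<le> m" "m < n"
  shows "exchange q L i j m (m + 1)"
proof -
  have mm: "m \<in> indices n" "m + 1 \<in> indices n" "m \<le> m + 1" "0 < m + 1" using m by (auto simp: indices_def)
  have phi: "q powi olsh_phi j (m + 1) = (if j = m + 1 then q else 1)" "q powi olsh_phi i m = (if \<bar>i\<bar> = m then q else 1)"
    using m mem_ij by (auto simp: tri.powi_phi)
  have sg: "tri.sg m a = 1" "tri.tg m a = 1" for a using m by (simp_all add: tri.sg_def tri.tg_def)
  have 1: "(if j < m + 1 then z \<bullet> (L i (m + 1) * L m j) else 0) = z \<bullet> (if j = m then upper i (m + 1) * K m else 0)"
  proof (cases "j = m")
    case True
    then show ?thesis using ij m by (simp add: L_upper upper_simps)
  qed simp
  have 2: "(if - j < m + 1 then (z * tri.sg m j) \<bullet> (L i (- (m + 1)) * L m (- j)) else 0) = 0"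
    using mem_ij m by simp
  have 3: "(if m < i then z \<bullet> (L i (m + 1) * L m j) else 0) = z \<bullet> (if i = m + 1 then K (m + 1) * upper m j else 0)"
  proof (cases "i = m + 1")
    case True
    then show ?thesis using ij m by (simp add: L_upper upper_simps)
  qed simp
  have 4: "(if i < - m then (z * tri.tg m i) \<bullet> (L (- i) (m + 1) * L (- m) j) else 0)
      = z \<bullet> (if i = - m - 1 then K (m + 1) * upper (- m) j else 0)"
  proof (cases "i = - m - 1")
    case True
    then show ?thesis using ij m by (simp add: L_upper upper_simps sg add.commute[of 1 m])
  next
    case False
    then show ?thesis using ij m by (simp add: sg)
  qed
  have "L m (m + 1) = z \<bullet> f m" "L i j = upper i j" using ij m by (simp_all add: L_upper upper_simps)
  then have "tri.exch i j m (m + 1)"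
    unfolding tri.exch_def 1 2 3 4 unfolding phi sg using arg_cong[OF upper_f[OF ij m], of "\<lambda>x. z \<bullet> x"]
    by (simp add: smul_add_right mult_ac)
  then show ?thesis using tri.exchange_iff_exch[OF mem_ij(1,2) mm(1,2) mem_ij(3) mm(3,4)] by simp
qed

lemma upper_exchange_kb: "exchange q L i j (- 1) 1"
proof -
  have mm: "- 1 \<in> indices n" "1 \<in> indices n" "- 1 \<le> (1::int)" "0 < (1::int)" using n1 by (auto simp: indices_def)
  have phi: "q powi olsh_phi j 1 = (if j = 1 then q else 1)" "q powi olsh_phi i (- 1) = (if \<bar>i\<bar> = 1 then inverse q else 1)"
    using mem_ij by (auto simp: tri.powi_phi)
  have s: "tri.sg (- 1) j = 1" "tri.sg (- 1) i = (if i < 0 then - 1 else 1)" using mem_ij ij by (auto simp: tri.sg_def)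
  have 1: "(if j < 1 then z \<bullet> (L i 1 * L (- 1) j) else 0) = 0" using mem_ij by simp
  have 2: "(if - j < 1 then (z * tri.sg (- 1) j) \<bullet> (L i (- 1) * L (- 1) (- j)) else 0)
      = z \<bullet> (if j = 1 \<and> i = - 1 then K (- 1) * K (- 1) else 0)"
    using mem_ij ij n1 L_neg_diag[of 1] s by (cases "j = 1"; cases "i = - 1") auto
  have 3: "(if - 1 < i then z \<bullet> (L i 1 * L (- 1) j) else 0) = z \<bullet> (if i = 1 then K 1 * upper (- 1) j else 0)"
    using mem_ij ij n1 by (cases "i = 1") (auto simp: L_upper upper_simps)
  have 4: "(if i < - (- 1) then (z * tri.tg (- 1) i) \<bullet> (L (- i) 1 * L (- (- 1)) j) else 0)
      = z \<bullet> (if i = - 1 then K 1 * upper 1 j else 0)"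
    using mem_ij ij n1 by (cases "i = - 1"; cases "i < - 1") (auto simp: L_upper upper_simps tri.tg_def)
  have L: "L (- 1) 1 = - (z \<bullet> kb 1)" "L i j = upper i j" using ij n1 by (simp_all add: L_upper upper_simps)
  have zz: "z \<bullet> z \<bullet> x = z \<bullet> y \<longleftrightarrow> z \<bullet> x = y" for x y :: 'a by (simp only: smul_cancel[OF z0])
  \<comment> \<open>This is the exchange relation with L_{-1,1} = -z k_1-bar after division by the
    common factor -z.\<close>
  have key: "(if j = 1 then q else 1) \<bullet> (upper i j * kb 1) - (if j = 1 \<and> i = - 1 then K (- 1) * K (- 1) else 0)
    = (if i < 0 then - 1 else 1) \<bullet> ((if \<bar>i\<bar> = 1 then inverse q else 1) \<bullet> (kb 1 * upper i j))
      - (if i = 1 then K 1 * upper (- 1) j else 0) - (if i = - 1 then K 1 * upper 1 j else 0)"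
  proof -
    consider "i = 1" "j = 1" | "i = - 1" "j = 1" | "i = 1" "2 \<le> j" | "i = - 1" "2 \<le> j" | "2 \<le> i" | "i \<le> - 2"
      using ij by linarith
    then show ?thesis
    proof cases
      case 1
      have "q \<bullet> (K 1 * kb 1) = inverse q \<bullet> (K 1 * kb 1) + z \<bullet> (K 1 * kb 1)" by (simp add: z smul_diff_left)
      then show ?thesis using 1 n1 K_kb[of 1 1] by (simp add: upper_def)
    next
      case 2
      then show ?thesis using kb_square n1 by (simp add: upper_def algebra_simps)
    next
      case 3
      then show ?thesis using ij upper_odd_one[of j] by (simp add: upper_def)
    next
      case 4
      then show ?thesis using ij upper_odd_one[of j] by (simp add: upper_def)
    next
      case 5
      then show ?thesis using ij upper_odd_gt[of i j] by (simp add: upper_def)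
    next
      case 6
      then show ?thesis using ij upper_odd_gt[of "- i" j] by (simp add: upper_def)
    qed
  qed
  have "tri.exch i j (- 1) 1"
    unfolding tri.exch_def 1 2 3 4 unfolding phi s L
    using arg_cong[OF key, of "\<lambda>x. - (z \<bullet> x)"] ij(1)
    by (simp add: smul_add_right smul_diff_right mult_ac algebra_simps tri.sg_def)
  then show ?thesis using tri.exchange_iff_exch[OF mem_ij(1,2) mm(1,2) mem_ij(3) mm(3,4)] by simp
qed

lemma upper_exchange_e:
  assumes m: "1 \<le> m" "m < n"
  shows "exchange q L i j (- m - 1) (- m)"
proof -
  have phi: "q powi olsh_phi j (- m) = (if j = m then inverse q else 1)"
     "q powi olsh_phi i (- m - 1) = (if \<bar>i\<bar> = m + 1 then inverse q else 1)"
    using m mem_ij by (auto simp: tri.powi_phi)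
  have par: "olsh_parity (- m - 1) (- m) = 0" using m mult_neg_neg[of "- m - 1" "- m"] by (simp only: olsh_parity_def) simp
  have ij': "L i j = upper i j" "L (- m - 1) (- m) = - (z \<bullet> e m)" using ij m by (simp_all add: L_upper L_E)
  have z': "q - inverse q = z" by (rule z[symmetric])
  have 1: "(of_bool (- m - 1 \<le> j \<and> j < - m) * of_int (olsh_theta i j (- m - 1)) * z) \<bullet> (L i (- m) * L (- m - 1) j) = 0"
    using mem_ij m by simp
  have 2: "(of_bool (i \<le> - (- m) \<and> - (- m) < j \<and> j \<le> - (- m - 1)) * of_int (olsh_theta (- i) (- j) (- m - 1)) * z)
      \<bullet> (L i (- (- m)) * L (- m - 1) (- j))
    = - (z \<bullet> (if j = m + 1 then (if \<bar>i\<bar> = m + 1 then if 0 < i then 0 else - (z \<bullet> eb m) else upper i m) * K (- (m + 1)) else 0))"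
  proof (cases "j = m + 1")
    case True
    have th: "olsh_theta (- i) (- j) (- m - 1) = - 1" using ij mem_ij m by (auto simp: olsh_theta_def sgn_if)
    have e: "- (m + 1) = - m - 1" by simp
    have K: "L (- m - 1) (- m - 1) = K (- m - 1)" using L_neg_diag[of "m + 1"] m by simp
    \<comment> \<open>For |i| = m + 1 the entry lies outside the region |i| \<le> j: it is
      L_{-m-1,m} or, below the diagonal, zero.\<close>
    have "L i m = (if \<bar>i\<bar> = m + 1 then if 0 < i then 0 else - (z \<bullet> eb m) else upper i m)"
    proof (cases "\<bar>i\<bar> = m + 1")
      case True
      then have "i = m + 1 \<or> i = - m - 1" by linarith
      then show ?thesis using m True by (auto simp: L_Eb)
    next
      case False
      then show ?thesis using ij True m by (simp add: L_upper)
    qed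
    moreover have "olsh_theta (- i) (- m - 1) (- m - 1) = - 1" using th True by simp
    moreover have "L i m = 0" if "m < i" using that by simp
    ultimately show ?thesis using True m ij th by (cases "i \<le> m") (auto simp: K)
  qed (use mem_ij in auto)
  have 3: "(of_bool (- m - 1 < i \<and> i \<le> - m) * of_int (olsh_theta i j (- m - 1)) * z) \<bullet> (L i (- m) * L (- m - 1) j)
    = - (z \<bullet> (if i = - m then K (- m) * (if j = m then - (z \<bullet> eb m) else upper (- m - 1) j) else 0))"
  proof (cases "i = - m")
    case True
    have th: "olsh_theta i j (- m - 1) = - 1" using True mem_ij m by (simp add: olsh_theta_def sgn_if)
    have "L (- m - 1) j = (if j = m then - (z \<bullet> eb m) else upper (- m - 1) j)"
      using True ij m L_Eb[of m] L_upper[of "- m - 1" j] by auto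
    then show ?thesis using True m th by (simp add: L_neg_diag)
  next
    case False
    then have "(- m - 1 < i \<and> i \<le> - m) = False" by auto
    then show ?thesis using False by simp
  qed
  have 4: "(of_bool (- (- m) \<le> i \<and> i < - (- m - 1) \<and> - (- m - 1) \<le> j) * of_int (olsh_theta (- i) (- j) (- m - 1)) * z)
      \<bullet> (L (- i) (- m) * L (- (- m - 1)) j)
    = - (z \<bullet> (if i = m then K (- m) * (if j = m then 0 else upper (m + 1) j) else 0))"
  proof (cases "i = m")
    case True
    have th: "olsh_theta (- i) (- j) (- m - 1) = - 1" using True mem_ij m by (simp add: olsh_theta_def sgn_if)
    show ?thesis using True ij m th L_upper[of "m + 1" j] by (auto simp add: L_neg_diag add.commute[of 1 m])
  next
    case False
    then have "(- (- m) \<le> i \<and> i < - (- m - 1) \<and> - (- m - 1) \<le> j) = False" by auto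
    then show ?thesis using False by simp
  qed
  show ?thesis
    unfolding exchange_def z' 1 2 3 4 phi ij' par
    using arg_cong[OF upper_e[OF ij m], of "\<lambda>x. - (z \<bullet> x)"]
    by (simp add: smul_add_right mult_ac algebra_simps)
qed

end

lemma upper_exchange:
  assumes "i \<noteq> 0" "\<bar>i\<bar> \<le> j" "j \<le> n"
  shows "m \<in> indices n \<Longrightarrow> exchange q L i j m m"
    and "\<lbrakk>1 \<le> m; m < n\<rbrakk> \<Longrightarrow> exchange q L i j m (m + 1)"
    and "\<lbrakk>1 \<le> m; m < n\<rbrakk> \<Longrightarrow> exchange q L i j (- m - 1) (- m)"
    and "exchange q L i j (- 1) 1"
proof -
  show "exchange q L i j m m" if "m \<in> indices n"
    using that upper_exchange_diag[OF assms, of m] upper_exchange_diag[OF assms, of "- m"]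
    by (cases "0 < m") (auto simp: indices_def)
qed (use assms in \<open>auto intro: upper_exchange_f upper_exchange_e upper_exchange_kb\<close>)

end

section \<open>The full matrix and its relations with the Chevalley generators\<close>

context chev_system
begin

text \<open>The entries with |i| > j come from the recursion in the opposite algebra. The arguments
  of \<open>chev_system.upper\<close> are the data of \<open>chev_system_opp\<close>: inverse
  parameter, inverted \<open>K\<close>, \<open>e\<close> instead of \<open>f\<close>, and
  -\<open>kb\<close>.\<close>

definition L_matrix :: "int \<Rightarrow> int \<Rightarrow> 'a" where
  "L_matrix i j = (if i \<in> indices n \<and> j \<in> indices n \<and> i \<le> j then if \<bar>i\<bar> \<le> j then upper i j
    else unop (chev_system.upper (inverse q) (- z) (\<lambda>m. Opp (K (- m))) (\<lambda>i. Opp (e i)) (\<lambda>i. - Opp (kb i)) (- j) (- i))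
    else 0)"

lemma L_matrix_upper: "\<lbrakk>i \<noteq> 0; \<bar>i\<bar> \<le> j; j \<le> n\<rbrakk> \<Longrightarrow> L_matrix i j = upper i j"
  by (auto simp: L_matrix_def indices_def)

context
begin

interpretation opp: chev_system "inverse q" "- z" n "\<lambda>m. Opp (K (- m))" "\<lambda>i. Opp (e i)" "\<lambda>i. Opp (f i)"
    "\<lambda>i. - Opp (eb i)" "\<lambda>i. - Opp (fb i)" "\<lambda>i. - Opp (kb i)" by (rule chev_system_opp)

text \<open>On the antidiagonal i = -j both recipes apply, and both give -z times
  \<open>kb j\<close>.\<close>

lemma L_matrix_lower: "\<lbrakk>i < 0; - n \<le> i; \<bar>j\<bar> \<le> - i; j \<noteq> 0\<rbrakk> \<Longrightarrow> L_matrix i j = unop (opp.upper (- j) (- i))"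
proof (cases "\<bar>i\<bar> \<le> j")
  case True
  assume *: "i < 0" "- n \<le> i" "\<bar>j\<bar> \<le> - i" "j \<noteq> 0"
  then have "i = - j" "1 \<le> j" using True by auto
  then show ?thesis using * by (simp add: L_matrix_upper upper_simps opp.upper_simps)
qed (auto simp: L_matrix_def indices_def)

lemma L_matrix_diag: "i \<in> indices n \<Longrightarrow> L_matrix i i = K i"
  using L_matrix_lower[of i i] opp.upper_simps(1)[of "- i"]
  by (cases "0 < i") (auto simp: L_matrix_upper upper_simps indices_def)

lemma L_matrix_E: "\<lbrakk>1 \<le> m; m < n\<rbrakk> \<Longrightarrow> L_matrix (- m - 1) (- m) = - (z \<bullet> e m)"
    "\<lbrakk>1 \<le> m; m < n\<rbrakk> \<Longrightarrow> L_matrix (- m - 1) m = - (z \<bullet> eb m)"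
  using L_matrix_lower[of "- m - 1" "- m"] L_matrix_lower[of "- m - 1" m] opp.upper_simps(3,4)[of m]
  by (simp_all add: add.commute[of 1 m])

lemma L_matrix_F: "\<lbrakk>1 \<le> m; m < n\<rbrakk> \<Longrightarrow> L_matrix m (m + 1) = z \<bullet> f m"
    "\<lbrakk>1 \<le> m; m < n\<rbrakk> \<Longrightarrow> L_matrix (- m) (m + 1) = - (z \<bullet> fb m)"
    "\<lbrakk>1 \<le> m; m \<le> n\<rbrakk> \<Longrightarrow> L_matrix (- m) m = - (z \<bullet> kb m)"
  by (simp_all add: L_matrix_upper upper_simps)

lemma simple_exchange_L: "simple_exchange q z n L_matrix"
proof -
  note lower = L_matrix_lower and diag = L_matrix_diag and E = L_matrix_E
  have tri: "triangular q z n L_matrix"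
  proof
    show "L_matrix i i * L_matrix (- i) (- i) = 1" if "i \<in> indices n" for i
    proof -
      have "- i \<in> indices n" using that by (auto simp: indices_def)
      then show ?thesis using diag[of i] diag[of "- i"] that K_inv[of i] K_inv[of "- i"]
        by (cases "0 < i") (auto simp: indices_def)
    qed
    show "z = q - inverse q" by (rule z)
  qed (auto simp: L_matrix_def)
  interpret up: upper_system q z n K f e fb eb kb L_matrix
  proof -
    interpret triangular q z n L_matrix by (rule tri)
    show "upper_system q z n K f e fb eb kb L_matrix"
      by unfold_locales (auto simp: L_matrix_upper E diag indices_def)
  qed
  interpret oup: upper_system "inverse q" "- z" n "\<lambda>m. Opp (K (- m))" "\<lambda>i. Opp (e i)" "\<lambda>i. Opp (f i)"
    "\<lambda>i. - Opp (eb i)" "\<lambda>i. - Opp (fb i)" "\<lambda>i. - Opp (kb i)" "opp_matrix L_matrix"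
  proof -
    interpret triangular "inverse q" "- z" n "opp_matrix L_matrix" by (rule up.tri.triangular_opp)
    show "upper_system (inverse q) (- z) n (\<lambda>m. Opp (K (- m))) (\<lambda>i. Opp (e i)) (\<lambda>i. Opp (f i))
      (\<lambda>i. - Opp (eb i)) (\<lambda>i. - Opp (fb i)) (\<lambda>i. - Opp (kb i)) (opp_matrix L_matrix)"
    proof
      show "opp_matrix L_matrix i j = opp.upper i j" if "i \<noteq> 0" "\<bar>i\<bar> \<le> j" "j \<le> n" for i j
        using that lower[of "- j" "- i"] by (simp add: opp_matrix_def)
      show "opp_matrix L_matrix (- m) (- m) = Opp (K (- (- m)))" if "1 \<le> m" "m \<le> n" for m
        using that diag[of m] by (simp add: opp_matrix_def indices_def)
      show "opp_matrix L_matrix (- m - 1) (- m) = - (- z \<bullet> Opp (f m))" if "1 \<le> m" "m < n" for m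
        using that by (subst opp_eq_iff) (simp add: opp_matrix_def L_matrix_upper upper_simps add.commute[of 1 m])
      show "opp_matrix L_matrix (- m - 1) m = - (- z \<bullet> - Opp (fb m))" if "1 \<le> m" "m < n" for m
        using that by (subst opp_eq_iff) (simp add: opp_matrix_def L_matrix_upper upper_simps add.commute[of 1 m])
    qed
  qed
  have I: "- 1 \<in> indices n" "1 \<in> indices n" using n1 by (auto simp: indices_def)
  have I': "m \<in> indices n" "m + 1 \<in> indices n" "- m - 1 \<in> indices n" "- m \<in> indices n" if "1 \<le> m" "m < n" for m
    using that by (auto simp: indices_def)
  \<comment> \<open>An entry outside the region |i| \<le> j is moved into it by the symmetry. There
    L_{m,m+1} and L_{-m-1,-m} change roles, which is why parts 2 and 3 of
    \<open>upper_exchange\<close> are swapped for \<open>oup\<close> below.\<close>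
  have *: "exchange q L_matrix i j k l"
    if ij: "i \<in> indices n" "j \<in> indices n" "i \<le> j" and kl: "k \<in> indices n" "l \<in> indices n" "k \<le> l"
      and up: "\<lbrakk>i \<noteq> 0; \<bar>i\<bar> \<le> j; j \<le> n\<rbrakk> \<Longrightarrow> exchange q L_matrix i j k l"
      and lo: "\<lbrakk>- j \<noteq> 0; \<bar>- j\<bar> \<le> - i; - i \<le> n\<rbrakk> \<Longrightarrow> exchange (inverse q) (opp_matrix L_matrix) (- j) (- i) (- l) (- k)"
    for i j k l
  proof (cases "\<bar>i\<bar> \<le> j")
    case True
    then show ?thesis using ij up by (auto simp: indices_def)
  next
    case False
    then have "exchange (inverse q) (opp_matrix L_matrix) (- j) (- i) (- l) (- k)"
      using ij by (intro lo) (auto simp: indices_def)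
    then show ?thesis using up.tri.exchange_opp[of "- j" "- i" "- l" "- k"] ij kl by simp
  qed
  show ?thesis
  proof (intro simple_exchange.intro tri simple_exchange_axioms.intro n1)
    show "exchange q L_matrix i j m m" if "m \<in> indices n" "i \<in> indices n" "j \<in> indices n" "i \<le> j" for m i j
      by (rule *) (use that up.upper_exchange(1)[of i j m] oup.upper_exchange(1)[of "- j" "- i" "- m"] in auto)
    show "exchange q L_matrix i j m (m + 1)" if m: "1 \<le> m" "m < n" and "i \<in> indices n" "j \<in> indices n" "i \<le> j" for m i j
      by (rule *) (use that I'[OF m] up.upper_exchange(2)[of i j m] oup.upper_exchange(3)[of "- j" "- i" m] in auto)
    show "exchange q L_matrix i j (- m - 1) (- m)" if m: "1 \<le> m" "m < n" and "i \<in> indices n" "j \<in> indices n" "i \<le> j" for m i j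
      by (rule *) (use that I'[OF m] up.upper_exchange(3)[of i j m] oup.upper_exchange(2)[of "- j" "- i" m] in \<open>auto simp: add.commute[of 1 m]\<close>)
    show "exchange q L_matrix i j (- 1) 1" if "i \<in> indices n" "j \<in> indices n" "i \<le> j" for i j
      by (rule *) (use that I up.upper_exchange(4)[of i j] oup.upper_exchange(4)[of "- j" "- i"] in auto)
  qed
qed

end

end

section \<open>From the matrix to the Chevalley generators\<close>

locale olshanski = triangular q z n L
  for q z :: ratfun and n :: int and L :: "int \<Rightarrow> int \<Rightarrow> 'a::ratfun_algebra" +
  assumes n1: "1 \<le> n" and q2: "1 + q * q \<noteq> 0"
    and exchange: "\<lbrakk>i \<in> indices n; j \<in> indices n; k \<in> indices n; l \<in> indices n; i \<le> j; k \<le> l\<rbrakk> \<Longrightarrow> exchange q L i j k l"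
begin

definition "K i = L i i"
definition "f i = inverse z \<bullet> L i (i + 1)"
definition "e i = - (inverse z \<bullet> L (- i - 1) (- i))"
definition "fb i = - (inverse z \<bullet> L (- i) (i + 1))"
definition "eb i = - (inverse z \<bullet> L (- i - 1) i)"
definition "kb i = - (inverse z \<bullet> L (- i) i)"

lemma L_gens: "L i (i + 1) = z \<bullet> f i" "L (- i - 1) (- i) = - (z \<bullet> e i)" "L (- i) (i + 1) = - (z \<bullet> fb i)"
  "L (- i - 1) i = - (z \<bullet> eb i)" "L (- i) i = - (z \<bullet> kb i)"
  by (simp_all add: f_def e_def fb_def eb_def kb_def)

lemma L_gens_Suc: "L (- i - 1) (i + 2) = - (z \<bullet> fb (i + 1))" "L (- i - 2) (i + 1) = - (z \<bullet> eb (i + 1))"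
  "L (- i - 1) (i + 1) = - (z \<bullet> kb (i + 1))"
proof -
  have e: "- (i + 1) = - i - 1" "- i - 1 - 1 = - i - 2" "i + 1 + 1 = i + 2" by auto
  show "L (- i - 1) (i + 2) = - (z \<bullet> fb (i + 1))" "L (- i - 2) (i + 1) = - (z \<bullet> eb (i + 1))"
    "L (- i - 1) (i + 1) = - (z \<bullet> kb (i + 1))"
    using L_gens(3)[of "i + 1"] L_gens(4)[of "i + 1"] L_gens(5)[of "i + 1"] unfolding e by blast+
qed

lemma olshanski_opp: "olshanski (inverse q) (- z) n (opp_matrix L)"
proof -
  interpret opp: triangular "inverse q" "- z" n "opp_matrix L" by (rule triangular_opp)
  have "1 + inverse q * inverse q \<noteq> 0"
  proof
    assume "1 + inverse q * inverse q = 0"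
    then have "q * q * (1 + inverse q * inverse q) = 0" by simp
    then show False using q2 by (simp add: distrib_left mult.assoc add.commute)
  qed
  then show ?thesis
    by unfold_locales (simp_all add: n1 exchange_opp exchange)
qed

lemma exch_all: "\<lbrakk>k \<in> indices n; l \<in> indices n; k \<le> l; 0 < l\<rbrakk> \<Longrightarrow> exch_all k l"
  by (simp add: exch_all_iff exchange)

lemma exch_all_F: 
  assumes "1 \<le> m" "m < n"
  shows "exch_all m m" "exch_all (m + 1) (m + 1)" "exch_all m (m + 1)"
  using assms by (auto intro!: exch_all simp: indices_def)

text \<open>The source of every relation with an even \<open>f\<close>: inserting the entry that
  defines another generator gives the relation between the two.\<close>

lemma exchange_f:
  assumes m: "1 \<le> m" "m < n" and ij: "i \<in> indices n" "j \<in> indices n"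
  shows "(if \<bar>j\<bar> = m + 1 then q else 1) \<bullet> (L i j * f m)
      + (if j = m then L i (m + 1) * K m else 0) + (if j = - m then L i (- m - 1) * K m else 0)
    = (if \<bar>i\<bar> = m then q else 1) \<bullet> (f m * L i j)
      + (if i = m + 1 then K (m + 1) * L m j else 0) + (if i = - m - 1 then K (m + 1) * L (- m) j else 0)"
proof -
  \<comment> \<open>The facts on \<open>F\<close> were proved relative to some row k < l on which
    they do not depend; -m is an admissible choice.\<close>
  have k: "- m \<in> indices n" "- m < m" using m by (auto simp: indices_def)
  have F: "F m = f m" by (simp add: F_def[OF m k exch_all_F[OF m]] f_def)
  have phi: "q powi olsh_phi j (m + 1) = (if \<bar>j\<bar> = m + 1 then q else 1)" "q powi olsh_phi i m = (if \<bar>i\<bar> = m then q else 1)"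
    using m by (auto simp: powi_phi)
  show ?thesis
    using exch_F[OF m k exch_all_F[OF m] ij] unfolding F phi K_def by simp
qed

lemma exchange_K:
  assumes m: "1 \<le> m" "m \<le> n" and ij: "i \<in> indices n" "j \<in> indices n"
  shows "(if \<bar>j\<bar> = m then q else 1) \<bullet> (L i j * K m) = (if \<bar>i\<bar> = m then q else 1) \<bullet> (K m * L i j)"
proof -
  have mm: "m \<in> indices n" "0 < m" using m by (auto simp: indices_def)
  have "exch i j m m" using exch_all[OF mm(1,1) order_refl mm(2)] ij by (simp add: exch_all_def)
  moreover have "(if j < m then z \<bullet> (L i m * L m j) else 0) = 0" "(if m < i then z \<bullet> (L i m * L m j) else 0) = 0"
    "(if - j < m then (z * sg m j) \<bullet> (L i (- m) * L m (- j)) else 0) = 0"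
    "(if i < - m then (z * tg m i) \<bullet> (L (- i) m * L (- m) j) else 0) = 0" by simp_all
  moreover have "q powi olsh_phi j m = (if \<bar>j\<bar> = m then q else 1)" "q powi olsh_phi i m = (if \<bar>i\<bar> = m then q else 1)"
    "sg m i = 1" "sg m j = 1"
    using m by (auto simp: powi_phi sg_def)
  ultimately show ?thesis by (simp add: exch_def K_def)
qed

lemma K_L_commute:
  assumes m: "1 \<le> m" "m \<le> n" and ij: "i \<in> indices n" "j \<in> indices n"
  shows "K m * L i j = ((if \<bar>i\<bar> = m then inverse q else 1) * (if \<bar>j\<bar> = m then q else 1)) \<bullet> (L i j * K m)"
proof -
  have "(if \<bar>i\<bar> = m then inverse q else 1) \<bullet> (if \<bar>i\<bar> = m then q else 1) \<bullet> (K m * L i j) = K m * L i j" by simp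
  then show ?thesis using exchange_K[OF assms, symmetric] by (simp only: smul_smul)
qed

text \<open>The relations between two odd generators are instances of this, up to the symmetry. As
  -d < b and -c < a always hold, the last term of either side is unconditional.\<close>

lemma exchange_odd:
  assumes "1 \<le> a" "a \<le> n" "1 \<le> b" "b \<le> n" "1 \<le> c" "c \<le> n" "1 \<le> d" "d \<le> n"
  shows "(if d = b then q else 1) \<bullet> (L (- c) d * L (- a) b) + (if d < b then z \<bullet> (L (- c) b * L (- a) d) else 0)
      + z \<bullet> (L (- c) (- b) * L (- a) (- d))
    = - ((if a = c then inverse q else 1) \<bullet> (L (- a) b * L (- c) d)) + (if c < a then z \<bullet> (L (- c) b * L (- a) d) else 0)
      + z \<bullet> (L c b * L a d)"
proof -
  have mm: "- a \<in> indices n" "b \<in> indices n" "- a \<le> b" "0 < b" "- c \<in> indices n" "d \<in> indices n" "- d < b" "- c < a"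
    using assms by (auto simp: indices_def)
  have "exch (- c) d (- a) b" using exch_all[OF mm(1-4)] mm by (simp add: exch_all_def)
  moreover have "q powi olsh_phi d b = (if d = b then q else 1)" "q powi olsh_phi (- c) (- a) = (if a = c then inverse q else 1)"
    "sg (- a) d = 1" "sg (- a) (- c) = - 1" "tg (- a) (- c) = 1"
    using assms by (auto simp: powi_phi sg_def tg_def)
  ultimately show ?thesis using mm(7,8) unfolding exch_def by (simp cong: if_cong)
qed

lemma mem_indices: "1 \<le> m \<Longrightarrow> m \<le> n \<Longrightarrow> m \<in> indices n" "1 \<le> m \<Longrightarrow> m \<le> n \<Longrightarrow> - m \<in> indices n"
  "1 \<le> m \<Longrightarrow> m < n \<Longrightarrow> m + 1 \<in> indices n" "1 \<le> m \<Longrightarrow> m < n \<Longrightarrow> - m - 1 \<in> indices n"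
  "1 \<le> m \<Longrightarrow> m + 1 < n \<Longrightarrow> m + 2 \<in> indices n" "1 \<le> m \<Longrightarrow> m + 1 < n \<Longrightarrow> - m - 2 \<in> indices n"
  by (auto simp: indices_def)

lemma K_inv: "\<lbrakk>1 \<le> m; m \<le> n\<rbrakk> \<Longrightarrow> K m * K (- m) = 1" "\<lbrakk>1 \<le> m; m \<le> n\<rbrakk> \<Longrightarrow> K (- m) * K m = 1"
  using L_inverse[of m] L_inverse[of "- m"] by (auto simp: K_def mem_indices)

lemma K_K: "\<lbrakk>1 \<le> m; m \<le> n; 1 \<le> i; i \<le> n\<rbrakk> \<Longrightarrow> K m * K i = K i * K m"
  using K_L_commute[of m i i] by (simp add: K_def mem_indices)

lemma K_gen:
  "\<lbrakk>1 \<le> m; m \<le> n; 1 \<le> i; i < n\<rbrakk> \<Longrightarrow> K m * f i = (if m = i then inverse q else if m = i + 1 then q else 1) \<bullet> (f i * K m)"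
  "\<lbrakk>1 \<le> m; m \<le> n; 1 \<le> i; i < n\<rbrakk> \<Longrightarrow> K m * e i = (if m = i then q else if m = i + 1 then inverse q else 1) \<bullet> (e i * K m)"
  "\<lbrakk>1 \<le> m; m \<le> n; 1 \<le> i; i < n\<rbrakk> \<Longrightarrow> K m * fb i = (if m = i then inverse q else if m = i + 1 then q else 1) \<bullet> (fb i * K m)"
  "\<lbrakk>1 \<le> m; m \<le> n; 1 \<le> i; i < n\<rbrakk> \<Longrightarrow> K m * eb i = (if m = i then q else if m = i + 1 then inverse q else 1) \<bullet> (eb i * K m)"
  "\<lbrakk>1 \<le> m; m \<le> n; 1 \<le> i; i \<le> n\<rbrakk> \<Longrightarrow> K m * kb i = kb i * K m"
proof -
  have a: "\<bar>i\<bar> = i" "\<bar>i + 1\<bar> = i + 1" "\<bar>- i\<bar> = i" "\<bar>- i - 1\<bar> = i + 1" if "1 \<le> i" for i :: int using that by auto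
  have c: "i = m \<longleftrightarrow> m = i" "i + 1 = m \<longleftrightarrow> m = i + 1" by auto
  show "K m * f i = (if m = i then inverse q else if m = i + 1 then q else 1) \<bullet> (f i * K m)"
    "K m * e i = (if m = i then q else if m = i + 1 then inverse q else 1) \<bullet> (e i * K m)"
    "K m * fb i = (if m = i then inverse q else if m = i + 1 then q else 1) \<bullet> (fb i * K m)"
    "K m * eb i = (if m = i then q else if m = i + 1 then inverse q else 1) \<bullet> (eb i * K m)"
    if "1 \<le> m" "m \<le> n" "1 \<le> i" "i < n"
    using K_L_commute[OF that(1,2), of i "i + 1"] K_L_commute[OF that(1,2), of "- i - 1" "- i"]
      K_L_commute[OF that(1,2), of "- i" "i + 1"] K_L_commute[OF that(1,2), of "- i - 1" i] that
    unfolding f_def e_def fb_def eb_def by (simp_all add: a c mem_indices mult.commute)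
  show "K m * kb i = kb i * K m" if "1 \<le> m" "m \<le> n" "1 \<le> i" "i \<le> n"
    using K_L_commute[OF that(1,2), of "- i" i] that unfolding kb_def by (simp add: a c mem_indices)
qed

lemma z_cancel: "z \<bullet> x = z \<bullet> y \<longleftrightarrow> x = y" for x y :: 'a
  by (rule smul_cancel) simp

section \<open>Relations with an even f, from the exchange with L_{m,m+1}\<close>

lemma e_f: "\<lbrakk>1 \<le> i; i < n\<rbrakk> \<Longrightarrow> e i * f i - f i * e i = inverse z \<bullet> (K i * K (- (i + 1)) - K (- i) * K (i + 1))"
proof -
  assume i: "1 \<le> i" "i < n"
  have "K (- i) * K (i + 1) = K (i + 1) * K (- i)" "K (- i - 1) * K i = K i * K (- i - 1)"
    using K_L_commute[of "i + 1" "- i" "- i"] K_L_commute[of i "- i - 1" "- i - 1"] i by (simp_all add: K_def mem_indices)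
  moreover have c: "\<bar>- i\<bar> \<noteq> i + 1" "- i \<noteq> i" "\<bar>- i - 1\<bar> \<noteq> i" "- i - 1 \<noteq> i + 1" using i by auto
  have "- (z \<bullet> (e i * f i)) + K (- i - 1) * K i = - (z \<bullet> (f i * e i)) + K (i + 1) * K (- i)"
    using exchange_f[OF i mem_indices(4)[OF i] mem_indices(2)[of i]] i
    by (simp only: c if_False if_True refl L_gens K_def smul_one add_0_right add_0_left mult_minus_left mult_minus_right
        mult_smul_left mult_smul_right order.strict_implies_order)
  ultimately have "z \<bullet> (e i * f i - f i * e i) = K i * K (- (i + 1)) - K (- i) * K (i + 1)"
    by (simp add: smul_diff_right nc_simps)
  from arg_cong[OF this, of "\<lambda>x. inverse z \<bullet> x"] show ?thesis by simp
qed

lemma e_f_up: "\<lbrakk>1 \<le> i; i + 1 < n\<rbrakk> \<Longrightarrow> q \<bullet> (e (i + 1) * f i) = f i * e (i + 1)"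
  by (rule z_cancel[THEN iffD1]) (use exchange_f[of i "- (i + 1) - 1" "- (i + 1)"] L_gens(2)[of "i + 1"] in \<open>simp add: indices_def mult_ac\<close>)
lemma e_f_dn: "\<lbrakk>1 \<le> i; i + 1 < n\<rbrakk> \<Longrightarrow> e i * f (i + 1) = q \<bullet> (f (i + 1) * e i)"
  by (rule z_cancel[THEN iffD1]) (use exchange_f[of "i + 1" "- i - 1" "- i"] L_gens(2)[of i] in \<open>simp add: indices_def mult_ac\<close>)
lemma e_f_far: "\<lbrakk>1 \<le> i; i < n; 1 \<le> j; j < n; \<bar>i - j\<bar> > 1\<rbrakk> \<Longrightarrow> e i * f j = f j * e i"
  using exchange_f[of j "- i - 1" "- i"] L_gens(2)[of i] by (auto simp add: indices_def z_cancel split: if_splits)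

lemma eb_f: "\<lbrakk>1 \<le> i; i < n\<rbrakk> \<Longrightarrow> eb i * f i - f i * eb i = K (i + 1) * kb i - kb (i + 1) * K i"
  by (rule z_cancel[THEN iffD1]) (use exchange_f[of i "- i - 1" i] L_gens(4)[of i] L_gens(5)[of "i + 1"] L_gens(5)[of i] in \<open>simp add: indices_def smul_diff_right mult_ac nc_simps\<close>)
lemma eb_f_up: "\<lbrakk>1 \<le> i; i + 1 < n\<rbrakk> \<Longrightarrow> q \<bullet> (eb (i + 1) * f i) = f i * eb (i + 1)"
  by (rule z_cancel[THEN iffD1]) (use exchange_f[of i "- (i + 1) - 1" "i + 1"] L_gens(4)[of "i + 1"] in \<open>simp add: indices_def mult_ac\<close>)
lemma eb_f_dn: "\<lbrakk>1 \<le> i; i + 1 < n\<rbrakk> \<Longrightarrow> eb i * f (i + 1) = q \<bullet> (f (i + 1) * eb i)"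
  by (rule z_cancel[THEN iffD1]) (use exchange_f[of "i + 1" "- i - 1" i] L_gens(4)[of i] in \<open>simp add: indices_def mult_ac\<close>)
lemma eb_f_far: "\<lbrakk>1 \<le> i; i < n; 1 \<le> j; j < n; \<bar>i - j\<bar> > 1\<rbrakk> \<Longrightarrow> eb i * f j = f j * eb i"
  using exchange_f[of j "- i - 1" i] L_gens(4)[of i] by (auto simp add: indices_def z_cancel split: if_splits)

lemma kb_f: "\<lbrakk>1 \<le> i; i < n\<rbrakk> \<Longrightarrow> kb i * f i - q \<bullet> (f i * kb i) = - (fb i * K i)"
  by (rule z_cancel[THEN iffD1]) (use exchange_f[of i "- i" i] L_gens(3)[of i] L_gens(5)[of i] in \<open>simp add: indices_def smul_diff_right mult_ac nc_simps\<close>)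
lemma kb_f_dn: "\<lbrakk>1 \<le> i; i < n\<rbrakk> \<Longrightarrow> q \<bullet> (kb (i + 1) * f i) - f i * kb (i + 1) = K (i + 1) * fb i"
  by (rule z_cancel[THEN iffD1]) (use exchange_f[of i "- i - 1" "i + 1"] L_gens(3)[of i] L_gens(5)[of "i + 1"] in \<open>simp add: indices_def smul_diff_right mult_ac nc_simps\<close>)
lemma kb_f_far: "\<lbrakk>1 \<le> i; i \<le> n; 1 \<le> j; j < n; i \<noteq> j; i \<noteq> j + 1\<rbrakk> \<Longrightarrow> kb i * f j = f j * kb i"
  using exchange_f[of j "- i" i] L_gens(5)[of i] by (auto simp add: indices_def z_cancel split: if_splits)

lemma f_f_far: "\<lbrakk>1 \<le> i; i < n; 1 \<le> j; j < n; \<bar>i - j\<bar> > 1\<rbrakk> \<Longrightarrow> f i * f j = f j * f i"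
  using exchange_f[of j i "i + 1"] L_gens(1)[of i] by (auto simp add: indices_def z_cancel split: if_splits)
lemma f_fb: "\<lbrakk>1 \<le> i; i < n; 1 \<le> j; j < n; \<bar>i - j\<bar> \<noteq> 1\<rbrakk> \<Longrightarrow> f i * fb j = fb j * f i"
  using exchange_f[of i "- j" "j + 1"] L_gens(3)[of j] by (cases "i = j") (auto simp add: indices_def z_cancel smul_cancel split: if_splits)

text \<open>Entries two steps above the diagonal are brackets of two generators. A Serre relation
  thereby becomes a q-commutation of \<open>f i\<close> or \<open>f (i + 1)\<close> with such an
  entry.\<close>

lemma L_next: "\<lbrakk>1 \<le> i; i + 1 < n\<rbrakk> \<Longrightarrow> L i (i + 2) * K (i + 1) = z \<bullet> (f (i + 1) * f i - f i * f (i + 1))"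
  using exchange_f[of "i + 1" i "i + 1"] L_gens(1)[of i] by (simp add: indices_def smul_diff_right add.assoc) (simp add: algebra_simps)
lemma L_next_odd: "\<lbrakk>1 \<le> i; i + 1 < n\<rbrakk> \<Longrightarrow> L (- i) (i + 2) * K (i + 1) = z \<bullet> (fb i * f (i + 1) - f (i + 1) * fb i)"
  using exchange_f[of "i + 1" "- i" "i + 1"] L_gens(3)[of i] by (simp add: indices_def smul_diff_right add.assoc) (simp add: algebra_simps)

text \<open>The entry L_{-i,i+2} arises in two ways, from L_{-i,i+1} with \<open>f (i + 1)\<close>
  and from L_{-i-1,i+2} with \<open>f i\<close>. The relation compares the results.\<close>

lemma f_fb_next: "\<lbrakk>1 \<le> i; i + 1 < n\<rbrakk> \<Longrightarrow> fb (i + 1) * f i - f i * fb (i + 1) = f (i + 1) * fb i - fb i * f (i + 1)"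
proof -
  assume i: "1 \<le> i" "i + 1 < n"
  have K: "K (i + 1) * L (- i) (i + 2) = L (- i) (i + 2) * K (i + 1)"
    using K_L_commute[of "i + 1" "- i" "i + 2"] i by (simp add: indices_def)
  have "z \<bullet> (fb (i + 1) * f i - f i * fb (i + 1)) = - (K (i + 1) * L (- i) (i + 2))"
    using exchange_f[of i "- i - 1" "i + 2"] L_gens(3)[of "i + 1"] i
    by (simp add: indices_def smul_diff_right add.assoc nc_simps)
  also have "\<dots> = z \<bullet> (f (i + 1) * fb i - fb i * f (i + 1))"
    using L_next_odd[OF i] by (simp add: K smul_diff_right)
  finally show ?thesis by (simp only: z_cancel)
qed

text \<open>The Serre relation is the statement that the commutator of \<open>y\<close> and
  \<open>x\<close> passes \<open>x\<close> with the factor q^2.\<close>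

lemma serre_general:
  fixes x y :: 'a
  assumes "(y * x - x * y) * x = (q * q) \<bullet> (x * (y * x - x * y))"
  shows "q \<bullet> (x * x * y) - (q + inverse q) \<bullet> (x * y * x) + inverse q \<bullet> (y * x * x) = 0"
proof -
  have "y * x * x = x * y * x + (q * q) \<bullet> (x * y * x) - (q * q) \<bullet> (x * x * y)"
    using assms by (simp add: left_diff_distrib right_diff_distrib smul_diff_right mult.assoc) (simp add: algebra_simps)
  from arg_cong[OF this, of "\<lambda>t. inverse q \<bullet> t"] show ?thesis
    by (simp add: smul_add_right smul_diff_right smul_add_left)
qed

lemma serre_general':
  fixes x y :: 'a
  assumes "x * (x * y - y * x) = (q * q) \<bullet> ((x * y - y * x) * x)"
  shows "q \<bullet> (y * x * x) - (q + inverse q) \<bullet> (x * y * x) + inverse q \<bullet> (x * x * y) = 0"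
proof -
  have "x * x * y = x * y * x + (q * q) \<bullet> (x * y * x) - (q * q) \<bullet> (y * x * x)"
    using assms by (simp add: left_diff_distrib right_diff_distrib smul_diff_right mult.assoc) (simp add: algebra_simps)
  from arg_cong[OF this, of "\<lambda>t. inverse q \<bullet> t"] show ?thesis
    by (simp add: smul_add_right smul_diff_right smul_add_left)
qed

text \<open>One factor q comes from the exchange of the entry with \<open>f\<close>, the other from
  \<open>K (i + 1)\<close>.\<close>

lemma L_next_f:
  assumes i: "1 \<le> i" "i + 1 < n" and k: "k = i \<or> k = - i"
  shows "L k (i + 2) * K (i + 1) * f i = (q * q) \<bullet> (f i * (L k (i + 2) * K (i + 1)))"
    "f (i + 1) * (L k (i + 2) * K (i + 1)) = (q * q) \<bullet> (L k (i + 2) * K (i + 1) * f (i + 1))"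
proof -
  have "L k (i + 2) * f i = q \<bullet> (f i * L k (i + 2))" 
    using exchange_f[of i k "i + 2"] i k by (auto simp: indices_def)
  moreover have "K (i + 1) * f i = q \<bullet> (f i * K (i + 1))"
    using K_gen(1)[of "i + 1" i] i by simp
  ultimately show "L k (i + 2) * K (i + 1) * f i = (q * q) \<bullet> (f i * (L k (i + 2) * K (i + 1)))"
    by (metis (no_types, lifting) mult.assoc mult_smul_left mult_smul_right smul_smul)
  have "q \<bullet> (L k (i + 2) * f (i + 1)) = f (i + 1) * L k (i + 2)" 
    using exchange_f[of "i + 1" k "i + 2"] i k by (auto simp: indices_def)
  moreover have "q \<bullet> (K (i + 1) * f (i + 1)) = f (i + 1) * K (i + 1)"
    using K_gen(1)[of "i + 1" "i + 1"] i by simp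
  ultimately show "f (i + 1) * (L k (i + 2) * K (i + 1)) = (q * q) \<bullet> (L k (i + 2) * K (i + 1) * f (i + 1))"
    by (metis (no_types, lifting) mult.assoc mult_smul_left mult_smul_right smul_smul)
qed

lemma brackets:
  assumes i: "1 \<le> i" "i + 1 < n"
  shows "f (i + 1) * f i - f i * f (i + 1) = inverse z \<bullet> (L i (i + 2) * K (i + 1))"
    "fb i * f (i + 1) - f (i + 1) * fb i = inverse z \<bullet> (L (- i) (i + 2) * K (i + 1))"
    "fb (i + 1) * f i - f i * fb (i + 1) = - (inverse z \<bullet> (L (- i) (i + 2) * K (i + 1)))"
  using L_next[OF i] L_next_odd[OF i] f_fb_next[OF i] by (simp_all flip: smul_minus_right)

lemma serre_f: "\<lbrakk>1 \<le> i; i + 1 < n\<rbrakk> \<Longrightarrow>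
    q \<bullet> (f i * f i * f (i + 1)) - (q + inverse q) \<bullet> (f i * f (i + 1) * f i) + inverse q \<bullet> (f (i + 1) * f i * f i) = 0"
  by (rule serre_general) (use L_next_f(1)[of i i] in \<open>simp add: brackets mult_ac\<close>)
lemma serre_fb: "\<lbrakk>1 \<le> i; i + 1 < n\<rbrakk> \<Longrightarrow>
    q \<bullet> (f i * f i * fb (i + 1)) - (q + inverse q) \<bullet> (f i * fb (i + 1) * f i) + inverse q \<bullet> (fb (i + 1) * f i * f i) = 0"
  by (rule serre_general) (use L_next_f(1)[of i "- i"] in \<open>simp add: brackets mult_ac\<close>)
lemma serre_f': "\<lbrakk>1 \<le> i; i + 1 < n\<rbrakk> \<Longrightarrow>
    q \<bullet> (f i * f (i + 1) * f (i + 1)) - (q + inverse q) \<bullet> (f (i + 1) * f i * f (i + 1)) + inverse q \<bullet> (f (i + 1) * f (i + 1) * f i) = 0"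
  by (rule serre_general') (use L_next_f(2)[of i i] in \<open>simp add: brackets mult_ac\<close>)
lemma serre_fb': "\<lbrakk>1 \<le> i; i + 1 < n\<rbrakk> \<Longrightarrow>
    q \<bullet> (fb i * f (i + 1) * f (i + 1)) - (q + inverse q) \<bullet> (f (i + 1) * fb i * f (i + 1)) + inverse q \<bullet> (f (i + 1) * f (i + 1) * fb i) = 0"
proof -
  assume i: "1 \<le> i" "i + 1 < n"
  have "f (i + 1) * fb i - fb i * f (i + 1) = - (inverse z \<bullet> (L (- i) (i + 2) * K (i + 1)))"
    using brackets(2)[OF i] by (metis minus_diff_eq)
  then show ?thesis
    by (intro serre_general') (use i L_next_f(2)[of i "- i"] in \<open>simp add: mult_ac\<close>)
qed

lemma zz_cancel: "(z * z) \<bullet> x = (z * z) \<bullet> y \<longleftrightarrow> x = y" for x y :: 'a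
  by (rule smul_cancel) simp

lemma kb_sq: "\<lbrakk>1 \<le> i; i \<le> n\<rbrakk> \<Longrightarrow> (q * q - inverse q * inverse q) \<bullet> (kb i * kb i) = K i * K i - K (- i) * K (- i)"
proof -
  assume i: "1 \<le> i" "i \<le> n"
  have "q * q - inverse q * inverse q = q * z + inverse q * z" by (simp add: z algebra_simps)
  moreover have "z \<bullet> ((q * z) \<bullet> (kb i * kb i) + (inverse q * z) \<bullet> (kb i * kb i)) = z \<bullet> (K i * K i - K (- i) * K (- i))"
    using exchange_odd[of i i i i] i by (simp add: L_gens(5) K_def smul_add_right smul_diff_right mult_ac algebra_simps)
  ultimately show ?thesis by (simp add: z_cancel smul_add_left)
qed

lemma kb_kb: "\<lbrakk>1 \<le> i; i < j; j \<le> n\<rbrakk> \<Longrightarrow> kb i * kb j = - (kb j * kb i)"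
  by (rule zz_cancel[THEN iffD1]) (use exchange_odd[of j j i i] in \<open>simp add: L_gens(5)\<close>)

text \<open>A product of two odd generators carries the factor z^2. Splitting q = z + q^{-1} matches
  the term with coefficient z in \<open>exchange_odd\<close>.\<close>

lemma zzq: "(z * z) \<bullet> q \<bullet> x = (z * z) \<bullet> z \<bullet> x + (z * z) \<bullet> inverse q \<bullet> (x::'a)"
  unfolding smul_add_right[symmetric] smul_add_left[symmetric] by (simp add: z)

lemma kb_fb: "\<lbrakk>1 \<le> i; i < n\<rbrakk> \<Longrightarrow> kb i * fb i + q \<bullet> (fb i * kb i) = f i * K i"
proof -
  assume i: "1 \<le> i" "i < n"
  have "(z * z) \<bullet> (kb i * fb i) + (z * z * z) \<bullet> (fb i * kb i) = - ((z * z * inverse q) \<bullet> (fb i * kb i)) + (z * z) \<bullet> (f i * K i)"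
    using exchange_odd[of i "i + 1" i i] i L_gens(3)[of i] L_gens(5)[of i] L_gens(1)[of i]
    by (simp add: K_def mult_ac)
  then have "(z * z) \<bullet> (kb i * fb i) + (z * z) \<bullet> q \<bullet> (fb i * kb i) = (z * z) \<bullet> (f i * K i)"
    unfolding zzq by (simp add: nc_simps mult.assoc)
  then show ?thesis by (simp only: zz_cancel flip: smul_add_right)
qed

lemma kb_fb_dn: "\<lbrakk>1 \<le> i; i < n\<rbrakk> \<Longrightarrow> q \<bullet> (kb (i + 1) * fb i) + fb i * kb (i + 1) = K (i + 1) * f i"
  by (rule zz_cancel[THEN iffD1])
    (use exchange_odd[of i "i + 1" "i + 1" "i + 1"] L_gens(3)[of i] L_gens_Suc(3)[of i] L_gens(1)[of i]
      in \<open>simp add: K_def smul_add_right mult_ac nc_simps\<close>)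

lemma kb_fb_far: "\<lbrakk>1 \<le> i; i \<le> n; 1 \<le> j; j < n; i \<noteq> j; i \<noteq> j + 1\<rbrakk> \<Longrightarrow> kb i * fb j = - (fb j * kb i)"
  by (rule zz_cancel[THEN iffD1])
    (use exchange_odd[of j "j + 1" i i] L_gens(3)[of j] L_gens(5)[of i] in \<open>auto split: if_splits\<close>)

lemma fb_sq: "\<lbrakk>1 \<le> i; i < n\<rbrakk> \<Longrightarrow> (q + inverse q) \<bullet> (fb i * fb i) = z \<bullet> (f i * f i)"
  by (rule zz_cancel[THEN iffD1])
    (use exchange_odd[of i "i + 1" i "i + 1"] L_gens(3)[of i] L_gens(1)[of i]
      in \<open>simp add: smul_add_left smul_add_right mult_ac distrib_left distrib_right nc_simps\<close>)

lemma fb_fb_far: "\<lbrakk>1 \<le> i; i < n; 1 \<le> j; j < n; \<bar>i - j\<bar> > 1\<rbrakk> \<Longrightarrow> fb i * fb j = - (fb j * fb i)"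
  by (rule zz_cancel[THEN iffD1])
    (use exchange_odd[of j "j + 1" i "i + 1"] L_gens(3)[of j] L_gens(3)[of i] in \<open>auto split: if_splits\<close>)

text \<open>Both sides are z^{-1} L_{i,i+2} K_{i+1}: the left one by \<open>L_next\<close>, the
  right one by the exchange of L_{-i,i+1} with L_{-i-1,i+2}.\<close>

lemma f_f_next: "\<lbrakk>1 \<le> i; i + 1 < n\<rbrakk> \<Longrightarrow> f (i + 1) * f i - f i * f (i + 1) = fb i * fb (i + 1) + fb (i + 1) * fb i"
proof -
  assume i: "1 \<le> i" "i + 1 < n"
  have "(z * z) \<bullet> (fb i * fb (i + 1) + fb (i + 1) * fb i) = z \<bullet> (L i (i + 2) * K (i + 1))"
    using exchange_odd[of "i + 1" "i + 2" i "i + 1"] i L_gens(3)[of i] L_gens_Suc(1)[of i]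
    by (simp add: K_def smul_add_right add.assoc nc_simps)
  then show ?thesis using L_next[OF i] by (simp add: zz_cancel)
qed

text \<open>In the exchange of L_{-i-1,i} with L_{-i,i+1} the extra quadratic term is z L_{-i-1,i+1}
  L_{-i,i}; \<open>kb_kb\<close> reverses its order.\<close>

lemma eb_fb: "\<lbrakk>1 \<le> i; i < n\<rbrakk> \<Longrightarrow> eb i * fb i + fb i * eb i
    = inverse z \<bullet> (K i * K (i + 1) - K (- i) * K (- (i + 1))) + z \<bullet> (kb i * kb (i + 1))"
proof -
  assume i: "1 \<le> i" "i < n"
  have K: "K (i + 1) * K i = K i * K (i + 1)" "K (- i - 1) * K (- i) = K (- i) * K (- i - 1)"
    using K_K[of i "i + 1"] commute_inverse[of "K i" "K (i + 1)" 1 "K (- i)"]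
      commute_inverse[of "K (i + 1)" "K (- i)" 1 "K (- i - 1)"] K_inv[of i] K_inv[of "i + 1"] i by simp_all
  have "(z * z) \<bullet> (eb i * fb i + fb i * eb i) = z \<bullet> (K i * K (i + 1) - K (- i) * K (- (i + 1))) + (z * z * z) \<bullet> (kb i * kb (i + 1))"
    using exchange_odd[of i "i + 1" "i + 1" i] i L_gens(3)[of i] L_gens(4)[of i] L_gens(5)[of i] L_gens_Suc(3)[of i]
      kb_kb[of i "i + 1"] K
    by (simp add: smul_add_right smul_diff_right mult_ac nc_simps flip: K_def)
  also have "\<dots> = (z * z) \<bullet> (inverse z \<bullet> (K i * K (i + 1) - K (- i) * K (- (i + 1))) + z \<bullet> (kb i * kb (i + 1)))"
    by (simp add: smul_add_right mult.assoc)
  finally show ?thesis by (simp only: zz_cancel)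
qed

lemma eb_fb_up: "\<lbrakk>1 \<le> i; i + 1 < n\<rbrakk> \<Longrightarrow> q \<bullet> (eb (i + 1) * fb i) = - (fb i * eb (i + 1))"
  by (rule zz_cancel[THEN iffD1])
    (use exchange_odd[of i "i + 1" "i + 2" "i + 1"] L_gens(3)[of i] L_gens_Suc(2)[of i] in \<open>simp add: mult_ac\<close>)

lemma eb_fb_dn: "\<lbrakk>1 \<le> i; i + 1 < n\<rbrakk> \<Longrightarrow> eb i * fb (i + 1) = - (q \<bullet> (fb (i + 1) * eb i))"
proof -
  assume i: "1 \<le> i" "i + 1 < n"
  have "(z * z) \<bullet> (eb i * fb (i + 1)) + (z * z * z) \<bullet> (fb (i + 1) * eb i) = - ((z * z * inverse q) \<bullet> (fb (i + 1) * eb i))"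
    using exchange_odd[of "i + 1" "i + 2" "i + 1" i] i L_gens_Suc(1)[of i] L_gens(4)[of i]
    by (simp add: mult_ac)
  then have "(z * z) \<bullet> (eb i * fb (i + 1)) + (z * z) \<bullet> q \<bullet> (fb (i + 1) * eb i) = 0"
    unfolding zzq by (simp add: eq_neg_iff_add_eq_0 add.assoc mult.assoc)
  then have "(z * z) \<bullet> (eb i * fb (i + 1) + q \<bullet> (fb (i + 1) * eb i)) = (z * z) \<bullet> 0"
    by (simp only: smul_add_right smul_zero_right)
  then show ?thesis by (simp only: zz_cancel add_eq_0_iff2)
qed

lemma eb_fb_far: "\<lbrakk>1 \<le> i; i < n; 1 \<le> j; j < n; \<bar>i - j\<bar> > 1\<rbrakk> \<Longrightarrow> eb i * fb j = - (fb j * eb i)"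
  by (rule zz_cancel[THEN iffD1])
    (use exchange_odd[of j "j + 1" "i + 1" i] L_gens(3)[of j] L_gens(4)[of i] in \<open>auto split: if_splits\<close>)

lemma q_cancel: "q \<bullet> x = q \<bullet> y \<longleftrightarrow> x = y" for x y :: 'a
  by (rule smul_cancel) simp

lemma Ki_commute:
  assumes "1 \<le> m" "m \<le> n" "K m * x = c \<bullet> (x * K m)" "c \<noteq> 0"
  shows "K (- m) * x = inverse c \<bullet> (x * K (- m))"
  using commute_inverse[OF assms(3) K_inv] assms by blast

lemma Ki_gen:
  assumes "1 \<le> m" "m \<le> n" "1 \<le> i"
  shows "i < n \<Longrightarrow> K (- m) * e i = (if m = i then inverse q else if m = i + 1 then q else 1) \<bullet> (e i * K (- m))"
    "i < n \<Longrightarrow> K (- m) * eb i = (if m = i then inverse q else if m = i + 1 then q else 1) \<bullet> (eb i * K (- m))"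
    "i \<le> n \<Longrightarrow> K (- m) * kb i = kb i * K (- m)"
  using Ki_commute[OF assms(1,2) K_gen(2)[OF assms]] Ki_commute[OF assms(1,2) K_gen(4)[OF assms]]
    Ki_commute[of m "kb i" 1] K_gen(5)[OF assms] assms by (auto split: if_splits)

section \<open>Relations with e, by the symmetry\<close>

context
begin

interpretation opp: olshanski "inverse q" "- z" n "opp_matrix L"
  by (rule olshanski_opp)

text \<open>The dictionary by which a relation already proved, applied to the opposite matrix,
  becomes one with e and f interchanged.\<close>

lemma opp_gens: "opp.K i = Opp (K (- i))" "opp.f i = Opp (e i)" "opp.e i = Opp (f i)" "opp.fb i = - Opp (eb i)"
  "opp.eb i = - Opp (fb i)" "opp.kb i = - Opp (kb i)"
  by (simp_all add: opp.K_def K_def opp.f_def e_def opp.e_def f_def opp.fb_def eb_def opp.eb_def fb_def opp.kb_def kb_def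
      opp_matrix_def opp_eq_iff inverse_minus_eq add.commute[of 1])

lemmas opp_simps = opp_gens opp_eq_iff

lemma e_fb: "\<lbrakk>1 \<le> i; i < n\<rbrakk> \<Longrightarrow> e i * fb i - fb i * e i = K (- (i + 1)) * kb i - kb (i + 1) * K (- i)"
  using opp.eb_f[of i] Ki_gen(3)[of "i + 1" i] Ki_gen(3)[of i "i + 1"] by (simp add: opp_simps) (metis minus_diff_eq)
lemma e_fb_up: "\<lbrakk>1 \<le> i; i + 1 < n\<rbrakk> \<Longrightarrow> q \<bullet> (e (i + 1) * fb i) = fb i * e (i + 1)"
  using opp.eb_f_dn[of i] by (simp add: opp_simps)
lemma e_fb_dn: "\<lbrakk>1 \<le> i; i + 1 < n\<rbrakk> \<Longrightarrow> e i * fb (i + 1) = q \<bullet> (fb (i + 1) * e i)"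
  by (rule sym) (use opp.eb_f_up[of i] in \<open>simp add: opp_simps flip: q_cancel[of "inverse q \<bullet> _"]\<close>)
lemma e_fb_far: "\<lbrakk>1 \<le> i; i < n; 1 \<le> j; j < n; \<bar>i - j\<bar> > 1\<rbrakk> \<Longrightarrow> e i * fb j = fb j * e i"
  using opp.eb_f_far[of j i] by (simp add: opp_simps abs_minus_commute)

lemma kb_e: "\<lbrakk>1 \<le> i; i < n\<rbrakk> \<Longrightarrow> kb i * e i - q \<bullet> (e i * kb i) = eb i * K (- i)"
  using arg_cong[OF opp.kb_f[of i], of "\<lambda>x. q \<bullet> unop x"] Ki_gen(2)[of i i]
  by (simp add: opp_simps smul_diff_right smul_add_right)
lemma kb_e_dn: "\<lbrakk>1 \<le> i; i < n\<rbrakk> \<Longrightarrow> q \<bullet> (kb (i + 1) * e i) - e i * kb (i + 1) = - (K (- (i + 1)) * eb i)"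
  using arg_cong[OF opp.kb_f_dn[of i], of "\<lambda>x. q \<bullet> unop x"] Ki_gen(2)[of "i + 1" i]
  by (simp add: opp_simps smul_diff_right smul_add_right)
lemma kb_e_far: "\<lbrakk>1 \<le> i; i \<le> n; 1 \<le> j; j < n; i \<noteq> j; i \<noteq> j + 1\<rbrakk> \<Longrightarrow> kb i * e j = e j * kb i"
  using opp.kb_f_far[of i j] by (simp add: opp_simps)

lemma kb_eb: "\<lbrakk>1 \<le> i; i < n\<rbrakk> \<Longrightarrow> kb i * eb i + q \<bullet> (eb i * kb i) = e i * K (- i)"
  using arg_cong[OF opp.kb_fb[of i], of "\<lambda>x. q \<bullet> unop x"] Ki_gen(1)[of i i]
  by (simp add: opp_simps smul_diff_right smul_add_right add.commute)
lemma kb_eb_dn: "\<lbrakk>1 \<le> i; i < n\<rbrakk> \<Longrightarrow> q \<bullet> (kb (i + 1) * eb i) + eb i * kb (i + 1) = K (- (i + 1)) * e i"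
  using arg_cong[OF opp.kb_fb_dn[of i], of "\<lambda>x. q \<bullet> unop x"] Ki_gen(1)[of "i + 1" i]
  by (simp add: opp_simps smul_diff_right smul_add_right) (simp add: add_ac)
lemma kb_eb_far: "\<lbrakk>1 \<le> i; i \<le> n; 1 \<le> j; j < n; i \<noteq> j; i \<noteq> j + 1\<rbrakk> \<Longrightarrow> kb i * eb j = - (eb j * kb i)"
  using opp.kb_fb_far[of i j] by (simp add: opp_simps)

lemma eb_sq: "\<lbrakk>1 \<le> i; i < n\<rbrakk> \<Longrightarrow> (q + inverse q) \<bullet> (eb i * eb i) = - (z \<bullet> (e i * e i))"
  using opp.fb_sq[of i] by (simp add: opp_simps add.commute)
lemma e_e_far: "\<lbrakk>1 \<le> i; i < n; 1 \<le> j; j < n; \<bar>i - j\<bar> > 1\<rbrakk> \<Longrightarrow> e i * e j = e j * e i"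
  using opp.f_f_far[of i j] by (simp add: opp_simps)
lemma eb_eb_far: "\<lbrakk>1 \<le> i; i < n; 1 \<le> j; j < n; \<bar>i - j\<bar> > 1\<rbrakk> \<Longrightarrow> eb i * eb j = - (eb j * eb i)"
  using opp.fb_fb_far[of i j] by (simp add: opp_simps)
lemma e_eb: "\<lbrakk>1 \<le> i; i < n; 1 \<le> j; j < n; \<bar>i - j\<bar> \<noteq> 1\<rbrakk> \<Longrightarrow> e i * eb j = eb j * e i"
  using opp.f_fb[of i j] by (simp add: opp_simps)
lemma e_e_next: "\<lbrakk>1 \<le> i; i + 1 < n\<rbrakk> \<Longrightarrow> e i * e (i + 1) - e (i + 1) * e i = eb i * eb (i + 1) + eb (i + 1) * eb i"
  using opp.f_f_next[of i] by (simp add: opp_simps add.commute)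
lemma e_eb_next: "\<lbrakk>1 \<le> i; i + 1 < n\<rbrakk> \<Longrightarrow> e i * eb (i + 1) - eb (i + 1) * e i = eb i * e (i + 1) - e (i + 1) * eb i"
  using opp.f_fb_next[of i] by (simp add: opp_simps) (metis minus_diff_eq)

lemma serre_e: "\<lbrakk>1 \<le> i; i + 1 < n\<rbrakk> \<Longrightarrow>
    q \<bullet> (e i * e i * e (i + 1)) - (q + inverse q) \<bullet> (e i * e (i + 1) * e i) + inverse q \<bullet> (e (i + 1) * e i * e i) = 0"
  using opp.serre_f[of i] by (simp add: opp_simps mult.assoc nc_simps add.commute[of q])
lemma serre_eb: "\<lbrakk>1 \<le> i; i + 1 < n\<rbrakk> \<Longrightarrow>
    q \<bullet> (e i * e i * eb (i + 1)) - (q + inverse q) \<bullet> (e i * eb (i + 1) * e i) + inverse q \<bullet> (eb (i + 1) * e i * e i) = 0"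
  using opp.serre_fb[of i] by (simp add: opp_simps mult.assoc nc_simps add.commute[of q])
lemma serre_e': "\<lbrakk>1 \<le> i; i + 1 < n\<rbrakk> \<Longrightarrow>
    q \<bullet> (e i * e (i + 1) * e (i + 1)) - (q + inverse q) \<bullet> (e (i + 1) * e i * e (i + 1)) + inverse q \<bullet> (e (i + 1) * e (i + 1) * e i) = 0"
  using opp.serre_f'[of i] by (simp add: opp_simps mult.assoc nc_simps add.commute[of q])
lemma serre_eb': "\<lbrakk>1 \<le> i; i + 1 < n\<rbrakk> \<Longrightarrow>
    q \<bullet> (eb i * e (i + 1) * e (i + 1)) - (q + inverse q) \<bullet> (e (i + 1) * eb i * e (i + 1)) + inverse q \<bullet> (e (i + 1) * e (i + 1) * eb i) = 0"
  using opp.serre_fb'[of i] by (simp add: opp_simps mult.assoc nc_simps add.commute[of q])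

end

lemma chev_system: "chev_system q z n K f e fb eb kb"
proof -
  have 1: "(q * q - inverse q * inverse q) \<bullet> (kb 1 * kb 1) = K 1 * K 1 - K (- 1) * K (- 1)"
    using kb_sq[of 1] n1 by simp
  have 2: "kb 1 * kb i = - (kb i * kb 1)" if "2 \<le> i" "i \<le> n" for i using kb_kb[of 1 i] that by simp
  have 3: "kb 1 * fb 1 + q \<bullet> (fb 1 * kb 1) = f 1 * K 1" "kb 1 * eb 1 + q \<bullet> (eb 1 * kb 1) = e 1 * K (- 1)" if "1 < n"
    using kb_fb[of 1] kb_eb[of 1] that by simp_all
  have 4: "kb 1 * fb i = - (fb i * kb 1)" "kb 1 * eb i = - (eb i * kb 1)" if "2 \<le> i" "i < n" for i
    using kb_fb_far[of 1 i] kb_eb_far[of 1 i] that by simp_all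
  show ?thesis
    by (rule chev_system.intro)
      (fact q0 z0 z q2 n1 K_inv K_K K_gen e_f e_f_up e_f_dn e_f_far e_fb e_fb_up e_fb_dn e_fb_far
        eb_f eb_f_up eb_f_dn eb_f_far kb_e kb_e_dn kb_e_far kb_f kb_f_dn kb_f_far 1 2 3 4
        e_e_far f_f_far e_eb f_fb e_eb_next f_fb_next serre_e serre_f serre_e' serre_f' serre_eb serre_fb serre_eb' serre_fb')+
qed

end

sublocale olshanski \<subseteq> chev: chev_system q z n K f e fb eb kb
  by (rule chev_system)

section \<open>Uniqueness of the matrix\<close>

context olshanski
begin

text \<open>Solving the exchange relation with L_{b,b+1} for the new entry gives back the recursion,
  so the generators determine the entries.\<close>

lemma L_Suc:
  assumes "k \<noteq> 0" "\<bar>k\<bar> \<le> b" "b < n"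
  shows "L k (b + 1) = ((if \<bar>k\<bar> = b then q else 1) \<bullet> (f b * L k b) - L k b * f b) * K (- b)"
proof -
  have b: "1 \<le> b" using assms by linarith
  have "L k b * f b + L k (b + 1) * K b = (if \<bar>k\<bar> = b then q else 1) \<bullet> (f b * L k b)"
    using exchange_f[OF b assms(3), of k b] assms b by (auto simp: indices_def)
  then have "L k (b + 1) * K b = (if \<bar>k\<bar> = b then q else 1) \<bullet> (f b * L k b) - L k b * f b"
    by (simp only: eq_diff_eq add.commute)
  from arg_cong[OF this, of "\<lambda>x. x * K (- b)"] show ?thesis
    using b assms by (simp add: mult.assoc K_inv)
qed

lemma L_upper:
  assumes "k \<noteq> 0" "\<bar>k\<bar> \<le> b" "b \<le> n"
  shows "L k b = chev.upper k b"
  using assms(2,3)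
proof (induction b rule: int_ge_induct)
  case base
  have "L k k = K k" "L k (- k) = - (z \<bullet> kb (- k))" using L_gens(5)[of "- k"] by (simp_all add: K_def)
  then show ?case using assms(1) by (cases "0 < k") (simp_all add: chev.upper_def)
next
  case (step b)
  then show ?case using assms(1) L_Suc[of k b]
    by (cases "0 < k") (auto simp: chev.upper_def chev.even.V_Suc chev.odd.V_Suc)
qed

lemma L_eq_L_matrix: "L = chev.L_matrix"
proof (intro ext)
  fix i j
  interpret opp: olshanski "inverse q" "- z" n "opp_matrix L" by (rule olshanski_opp)
  show "L i j = chev.L_matrix i j"
  proof (cases "i \<in> indices n \<and> j \<in> indices n \<and> i \<le> j")
    case True
    show ?thesis
    proof (cases "\<bar>i\<bar> \<le> j")
      case le: True
      then show ?thesis using True L_upper[of i j] by (simp add: chev.L_matrix_def indices_def)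
    next
      case False
      then have "opp_matrix L (- j) (- i) = opp.chev.upper (- j) (- i)"
        using True by (intro opp.L_upper) (auto simp: indices_def)
      then show ?thesis
        using True False unfolding chev.L_matrix_def
        by (simp add: opp_matrix_def opp_gens[abs_def] opp_eq_iff)
    qed
  next
    case False
    then show ?thesis by (auto simp: chev.L_matrix_def L_zero)
  qed
qed

end

text \<open>By \<open>L_eq_L_matrix\<close> either matrix is a function of \<open>K\<close>,
  \<open>f\<close>, \<open>e\<close> and \<open>kb\<close>, so only these have to be
  compared.\<close>

lemma olshanski_eqI:
  assumes L: "olshanski q z n L" and L': "olshanski q z n L'"
    and diag: "\<And>m. \<lbrakk>1 \<le> m; m \<le> n\<rbrakk> \<Longrightarrow> L m m = L' m m \<and> L (- m) (- m) = L' (- m) (- m) \<and> L (- m) m = L' (- m) m"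
    and next_diag: "\<And>m. \<lbrakk>1 \<le> m; m < n\<rbrakk> \<Longrightarrow> L m (m + 1) = L' m (m + 1) \<and> L (- m - 1) (- m) = L' (- m - 1) (- m)
      \<and> L (- m) (m + 1) = L' (- m) (m + 1) \<and> L (- m - 1) m = L' (- m - 1) m"
  shows "L = L'"
proof -
  interpret A: olshanski q z n L by (rule L)
  interpret B: olshanski q z n L' by (rule L')
  \<comment> \<open>The generators are functions on all integers and must agree also at indices out
    of range, where both entries are zero.\<close>
  have z: "L i j = L' i j" if "\<not> (i \<in> indices n \<and> j \<in> indices n \<and> i \<le> j)" for i j
    using A.L_zero[OF that] B.L_zero[OF that] by simp
  have K: "L i i = L' i i" for i
  proof -
    consider "1 \<le> i" "i \<le> n" | "1 \<le> - i" "- i \<le> n" | "\<not> (i \<in> indices n \<and> i \<in> indices n \<and> i \<le> i)"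
      by (force simp: indices_def)
    then show ?thesis using diag[of i] diag[of "- i"] z[of i i] by cases auto
  qed
  have kb: "L (- i) i = L' (- i) i" for i
  proof -
    consider "1 \<le> i" "i \<le> n" | "\<not> (- i \<in> indices n \<and> i \<in> indices n \<and> - i \<le> i)"
      by (force simp: indices_def)
    then show ?thesis using diag[of i] z[of "- i" i] by cases auto
  qed
  have f: "L i (i + 1) = L' i (i + 1)" for i
  proof -
    \<comment> \<open>At a negative index \<open>f\<close> reads an entry that belongs to
      \<open>e\<close>, hence the second case.\<close>
    consider "1 \<le> i" "i < n" | "1 \<le> - i - 1" "- i - 1 < n" | "\<not> (i \<in> indices n \<and> i + 1 \<in> indices n \<and> i \<le> i + 1)"
      unfolding indices_def mem_Collect_eq by (smt (verit))
    then show ?thesis using next_diag[of i] next_diag[of "- i - 1"] z[of i "i + 1"] by cases (auto simp: add.commute[of 1])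
  qed
  have e: "L (- i - 1) (- i) = L' (- i - 1) (- i)" for i using f[of "- i - 1"] by simp
  have fb: "L (- i) (i + 1) = L' (- i) (i + 1)" for i
  proof -
    consider "1 \<le> i" "i < n" | "\<not> (- i \<in> indices n \<and> i + 1 \<in> indices n \<and> - i \<le> i + 1)"
      by (force simp: indices_def)
    then show ?thesis using next_diag[of i] z[of "- i" "i + 1"] by cases auto
  qed
  have eb: "L (- i - 1) i = L' (- i - 1) i" for i
  proof -
    consider "1 \<le> i" "i < n" | "\<not> (- i - 1 \<in> indices n \<and> i \<in> indices n \<and> - i - 1 \<le> i)"
      by (force simp: indices_def)
    then show ?thesis using next_diag[of i] z[of "- i - 1" i] by cases auto
  qed
  have "A.K = B.K" "A.f = B.f" "A.e = B.e" "A.kb = B.kb"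
    by (simp_all add: fun_eq_iff A.K_def B.K_def A.f_def B.f_def A.e_def B.e_def A.kb_def B.kb_def K f e kb)
  then show ?thesis using A.L_eq_L_matrix B.L_eq_L_matrix by simp
qed

lemma (in chev_system) olshanski_L_matrix: "olshanski q z n L_matrix"
proof -
  interpret simple_exchange q z n L_matrix by (rule simple_exchange_L)
  show ?thesis by unfold_locales (simp_all add: q2 n1 exchange_all)
qed

section \<open>Presented algebras as types\<close>

lemma sum_single_lookup: "p = (\<Sum>w\<in>Poly_Mapping.keys p. Poly_Mapping.single w (Poly_Mapping.lookup p w))"
  by (rule poly_mapping_eqI)
    (simp add: lookup_sum lookup_single when_def in_keys_iff)

definition ev_word :: "('g \<Rightarrow> 'a) \<Rightarrow> 'g word \<Rightarrow> 'a::ratfun_algebra" where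
  "ev_word h w = prod_list (map h (letters w))"

lemma ev_word_simps [simp]: "ev_word h 0 = 1" "ev_word h (u + v) = ev_word h u * ev_word h v" "ev_word h (Word [g]) = h g"
  by (simp_all add: ev_word_def zero_word_def plus_word_def)

text \<open>The extension of \<open>h\<close> to a homomorphism. It does not refer to a generating
  set, so its laws carry no membership conditions.\<close>

definition ev :: "('g \<Rightarrow> 'a) \<Rightarrow> 'g ncpoly \<Rightarrow> 'a::ratfun_algebra" where
  "ev h p = (\<Sum>w\<in>Poly_Mapping.keys p. Poly_Mapping.lookup p w \<bullet> ev_word h w)"

lemma ev_zero [simp]: "ev h 0 = 0"
  by (simp add: ev_def)

lemma ev_add [simp]: "ev h (p + p') = ev h p + ev h p'"
  unfolding ev_def by (rule setsum_keys_plus_distrib) (simp_all add: smul_add_left)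

lemma ev_sum: "ev h (\<Sum>i\<in>A. g i) = (\<Sum>i\<in>A. ev h (g i))"
  by (induction A rule: infinite_finite_induct) simp_all

lemma ev_uminus [simp]: "ev h (- p) = - ev h p"
  using ev_add[of h p "- p"] by (simp add: eq_neg_iff_add_eq_0 add.commute)

lemma ev_diff [simp]: "ev h (p - p') = ev h p - ev h p'"
  using ev_add[of h p "- p'"] by simp

lemma ev_single [simp]: "ev h (Poly_Mapping.single w c) = c \<bullet> ev_word h w"
  by (simp add: ev_def)

lemma ev_one [simp]: "ev h 1 = 1"
  using ev_single[of h 0 1] by simp

lemma ev_mult [simp]: "ev h (p * p') = ev h p * ev h p'"
proof -
  let ?s = "\<lambda>p w. Poly_Mapping.single w (Poly_Mapping.lookup p w)"
  have "ev h (p * p') = ev h ((\<Sum>w\<in>Poly_Mapping.keys p. ?s p w) * (\<Sum>w\<in>Poly_Mapping.keys p'. ?s p' w))"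
    by (simp only: sum_single_lookup[symmetric])
  also have "\<dots> = (\<Sum>u\<in>Poly_Mapping.keys p. \<Sum>v\<in>Poly_Mapping.keys p'. (Poly_Mapping.lookup p u \<bullet> ev_word h u) * (Poly_Mapping.lookup p' v \<bullet> ev_word h v))"
    unfolding sum_product ev_sum by (simp add: mult_single mult.commute[of "Poly_Mapping.lookup p _"])
  also have "\<dots> = ev h p * ev h p'"
    by (simp only: ev_def sum_product)
  finally show ?thesis .
qed

lemma ev_scale [simp]: "ev h (c \<cdot> p) = c \<bullet> ev h p"
  by (simp add: scale_def)

lemma ev_gen [simp]: "ev h (gen g) = h g"
  by (simp add: gen_def)

lemma ev_power [simp]: "ev h (p ^ k) = ev h p ^ k"
  by (induction k) simp_all

lemma ev_cong: "(\<And>g. g \<in> G \<Longrightarrow> h g = h' g) \<Longrightarrow> p \<in> carrier (free_algebra G) \<Longrightarrow> ev h p = ev h' p"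
  unfolding ev_def ev_word_def free_algebra_def
  by (intro sum.cong refl arg_cong2[where f = smul] arg_cong[where f = prod_list] map_cong) auto

lemma free_algebra_simps [simp]: "monoid.mult (free_algebra G) = (*)" "monoid.one (free_algebra G) = 1"
  "ring.zero (free_algebra G) = 0" "ring.add (free_algebra G) = (+)" "module.smult (free_algebra G) = scale"
  by (simp_all add: free_algebra_def)

lemma mem_free_algebra: "x \<in> carrier (free_algebra G) \<longleftrightarrow> (\<forall>w \<in> Poly_Mapping.keys x. set (letters w) \<subseteq> G)"
  by (simp add: free_algebra_def)

lemma free_algebra_closed:
  "0 \<in> carrier (free_algebra G)" "1 \<in> carrier (free_algebra G)"
  "x \<in> carrier (free_algebra G) \<Longrightarrow> y \<in> carrier (free_algebra G) \<Longrightarrow> x + y \<in> carrier (free_algebra G)"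
  "x \<in> carrier (free_algebra G) \<Longrightarrow> y \<in> carrier (free_algebra G) \<Longrightarrow> x * y \<in> carrier (free_algebra G)"
  "x \<in> carrier (free_algebra G) \<Longrightarrow> - x \<in> carrier (free_algebra G)"
  "x \<in> carrier (free_algebra G) \<Longrightarrow> y \<in> carrier (free_algebra G) \<Longrightarrow> x - y \<in> carrier (free_algebra G)"
  "x \<in> carrier (free_algebra G) \<Longrightarrow> c \<cdot> x \<in> carrier (free_algebra G)"
  "x \<in> carrier (free_algebra G) \<Longrightarrow> x ^ k \<in> carrier (free_algebra G)"
  "g \<in> G \<Longrightarrow> gen g \<in> carrier (free_algebra G)"
proof -
  show add: "x + y \<in> carrier (free_algebra G)" if "x \<in> carrier (free_algebra G)" "y \<in> carrier (free_algebra G)" for x y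
    using that keys_add[of x y] unfolding mem_free_algebra by blast
  show mult: "x * y \<in> carrier (free_algebra G)" if "x \<in> carrier (free_algebra G)" "y \<in> carrier (free_algebra G)" for x y
    using that keys_mult[of x y] unfolding mem_free_algebra by (fastforce simp: plus_word_def)
  have keys_minus: "Poly_Mapping.keys (- x) = Poly_Mapping.keys x" for x :: "'g ncpoly"
    by (auto simp: in_keys_iff)
  show minus: "- x \<in> carrier (free_algebra G)" if "x \<in> carrier (free_algebra G)" for x
    using that unfolding mem_free_algebra keys_minus .
  show "x - y \<in> carrier (free_algebra G)" if "x \<in> carrier (free_algebra G)" "y \<in> carrier (free_algebra G)" for x y
    using add[OF that(1) minus[OF that(2)]] by simp
  show one: "1 \<in> carrier (free_algebra G)" by (simp add: mem_free_algebra zero_word_def)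
  show "0 \<in> carrier (free_algebra G)" by (simp add: mem_free_algebra)
  have "Poly_Mapping.single 0 c \<in> carrier (free_algebra G)" for c
    by (simp add: mem_free_algebra zero_word_def)
  then show "c \<cdot> x \<in> carrier (free_algebra G)" if "x \<in> carrier (free_algebra G)" for x
    using that by (simp add: scale_def mult)
  show "x ^ k \<in> carrier (free_algebra G)" if "x \<in> carrier (free_algebra G)" for x
    using that by (induction k) (simp_all add: one mult)
  show "gen g \<in> carrier (free_algebra G)" if "g \<in> G" using that by (simp add: mem_free_algebra gen_def)
qed

lemma ring_free_algebra: "ring (free_algebra G)"
proof (rule ringI)
  show "abelian_group (free_algebra G)"
    by (rule abelian_groupI) (auto simp: free_algebra_closed add_ac intro!: bexI[of _ "- _"])
  show "monoid (free_algebra G)"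
    by (rule monoidI) (auto simp: free_algebra_closed mult.assoc)
qed (auto simp: distrib_left distrib_right free_algebra_closed)

lemma a_minus_free_algebra:
  assumes "x \<in> carrier (free_algebra G)" "y \<in> carrier (free_algebra G)"
  shows "x \<ominus>\<^bsub>free_algebra G\<^esub> y = x - y"
proof -
  interpret ring "free_algebra G" by (rule ring_free_algebra)
  have "\<ominus>\<^bsub>free_algebra G\<^esub> y = - y"
    using minus_equality[of "- y" y] assms by (simp add: free_algebra_closed)
  then show ?thesis by (simp add: a_minus_def)
qed

lemma scale_simps: "c \<cdot> (x + y) = c \<cdot> x + c \<cdot> y" "(c + d) \<cdot> x = c \<cdot> x + d \<cdot> x" "c \<cdot> d \<cdot> x = (c * d) \<cdot> x" "1 \<cdot> x = x"
  "c \<cdot> (x - y) = c \<cdot> x - c \<cdot> y" "(c \<cdot> x) * y = c \<cdot> (x * y)"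
  by (simp_all add: scale_def distrib_left distrib_right right_diff_distrib single_add mult_single flip: mult.assoc)

lemma single_zero_commute: "Poly_Mapping.single 0 c * x = x * Poly_Mapping.single 0 (c::ratfun)" for x :: "'g ncpoly"
proof -
  have "Poly_Mapping.single 0 c * (\<Sum>w\<in>A. Poly_Mapping.single w (g w)) = (\<Sum>w\<in>A. Poly_Mapping.single w (g w)) * Poly_Mapping.single 0 c"
    for A :: "'g word set" and g
    by (simp add: sum_distrib_left sum_distrib_right mult_single mult.commute)
  from this[where A = "Poly_Mapping.keys x" and g = "Poly_Mapping.lookup x"] show ?thesis
    by (simp only: sum_single_lookup[symmetric])
qed

lemma mult_scale: "x * (c \<cdot> y) = c \<cdot> (x * y)"
  by (simp add: scale_def single_zero_commute[of c x] flip: mult.assoc)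

text \<open>A presentation is attached to the type of its generators, because the quotient is to
  become a type with that type as its only parameter.\<close>

class presentation =
  fixes pgens :: "'a set" and prel :: "'a ncpoly \<Rightarrow> 'a ncpoly \<Rightarrow> bool"
  assumes prel_carrier: "prel x y \<Longrightarrow> x \<in> carrier (free_algebra pgens) \<and> y \<in> carrier (free_algebra pgens)"

abbreviation FA :: "(ratfun, 'g::presentation ncpoly) module" where
  "FA \<equiv> free_algebra pgens"

abbreviation RI :: "'g::presentation ncpoly set" where
  "RI \<equiv> rel_ideal pgens prel"

lemma rel_subset: "{x - y | x y. prel x y} \<subseteq> carrier FA"
  using prel_carrier by (fastforce intro: free_algebra_closed)

lemma ideal_RI: "ideal RI FA"
  unfolding rel_ideal_def by (rule ring.genideal_ideal[OF ring_free_algebra rel_subset])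

lemma prel_RI: "prel x y \<Longrightarrow> x - y \<in> RI"
  unfolding rel_ideal_def using ring.genideal_self[OF ring_free_algebra rel_subset] by blast

lemma coset_eq_iff:
  assumes "x \<in> carrier FA" "y \<in> carrier FA"
  shows "presented_class pgens prel x = presented_class pgens prel y \<longleftrightarrow> x - y \<in> RI"
  unfolding presented_class_def
  using ring.quotient_eq_iff_same_a_r_cos[OF ring_free_algebra ideal_RI assms] a_minus_free_algebra[OF assms] by simp

text \<open>Scaling is multiplication by an element of the free algebra, so the ideal is a
  subspace.\<close>

lemma RI_scale:
  assumes "x \<in> RI" shows "c \<cdot> x \<in> RI"
proof -
  interpret ideal RI FA by (rule ideal_RI)
  have "Poly_Mapping.single 0 c \<in> carrier FA" by (simp add: mem_free_algebra zero_word_def)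
  then show ?thesis using I_l_closed[OF assms] by (simp add: scale_def)
qed

lemma mem_coset: "y \<in> presented_class pgens prel x \<longleftrightarrow> y - x \<in> RI" if "x \<in> carrier FA" "y \<in> carrier FA"
proof -
  have "y \<in> presented_class pgens prel x \<longleftrightarrow> (\<exists>i \<in> RI. y = i + x)"
    by (auto simp: presented_class_def a_r_coset_def')
  then show ?thesis by (metis add_diff_cancel diff_add_cancel)
qed

lemma coset_subset: "x \<in> carrier FA \<Longrightarrow> presented_class pgens prel x \<subseteq> carrier FA"
  using ideal.Icarr[OF ideal_RI] by (fastforce simp: presented_class_def a_r_coset_def' intro: free_algebra_closed)

lemma carrier_presented: "carrier (presented_algebra pgens prel) = presented_class pgens prel ` carrier FA"
  by (auto simp: presented_algebra_def quot_algebra_def FactRing_def A_RCOSETS_def' presented_class_def)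

lemma presented_ops:
  assumes "x \<in> carrier FA" "y \<in> carrier FA"
  shows "presented_class pgens prel x \<otimes>\<^bsub>presented_algebra pgens prel\<^esub> presented_class pgens prel y = presented_class pgens prel (x * y)"
    "presented_class pgens prel x \<oplus>\<^bsub>presented_algebra pgens prel\<^esub> presented_class pgens prel y = presented_class pgens prel (x + y)"
    "c \<odot>\<^bsub>presented_algebra pgens prel\<^esub> presented_class pgens prel x = presented_class pgens prel (c \<cdot> x)"
    "\<one>\<^bsub>presented_algebra pgens prel\<^esub> = presented_class pgens prel 1"
proof -
  interpret ideal RI FA by (rule ideal_RI)
  note d = presented_algebra_def quot_algebra_def presented_class_def FactRing_def
  show "presented_class pgens prel x \<otimes>\<^bsub>presented_algebra pgens prel\<^esub> presented_class pgens prel y = presented_class pgens prel (x * y)"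
    using rcoset_mult_add[OF assms] by (simp add: d)
  show "presented_class pgens prel x \<oplus>\<^bsub>presented_algebra pgens prel\<^esub> presented_class pgens prel y = presented_class pgens prel (x + y)"
    using a_rcos_sum[OF assms] by (simp add: d)
  show "\<one>\<^bsub>presented_algebra pgens prel\<^esub> = presented_class pgens prel 1" by (simp add: d)
  \<comment> \<open>Scalar multiples in the quotient are defined as a union over all
    representatives; each of them contributes the same coset.\<close>
  have 1: "presented_class pgens prel (c \<cdot> y) = presented_class pgens prel (c \<cdot> x)"
    if "y \<in> presented_class pgens prel x" for y
  proof -
    have y: "y \<in> carrier FA" using that coset_subset assms by blast
    then have "c \<cdot> (y - x) \<in> RI" using that mem_coset[OF assms(1) y] RI_scale by blast
    then show ?thesis using y assms by (simp add: coset_eq_iff free_algebra_closed scale_simps)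
  qed
  have 2: "x \<in> presented_class pgens prel x"
    using mem_coset[OF assms(1,1)] additive_subgroup.zero_closed[OF additive_subgroup_axioms] by simp
  have 3: "c \<odot>\<^bsub>presented_algebra pgens prel\<^esub> X = (\<Union>y\<in>X. presented_class pgens prel (c \<cdot> y))" for X
    by (simp add: presented_algebra_def quot_algebra_def presented_class_def)
  show "c \<odot>\<^bsub>presented_algebra pgens prel\<^esub> presented_class pgens prel x = presented_class pgens prel (c \<cdot> x)"
    unfolding 3 using 2 by (subst SUP_cong[OF refl 1]) auto
qed

typedef (overloaded) 'g pres = "carrier (presented_algebra (pgens :: 'g::presentation set) prel)"
  using carrier_presented free_algebra_closed(2) by blast

definition cls :: "'g::presentation ncpoly \<Rightarrow> 'g pres" where
  "cls x = Abs_pres (presented_class pgens prel x)"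

lemma Rep_cls: "x \<in> carrier FA \<Longrightarrow> Rep_pres (cls x) = presented_class pgens prel x"
  unfolding cls_def by (rule Abs_pres_inverse) (auto simp: carrier_presented)

lemma cls_cases:
  obtains x where "x \<in> carrier FA" "X = cls x"
  using Rep_pres[of X] unfolding carrier_presented cls_def by (metis Rep_pres_inverse imageE)

lemma cls_eq_iff: "x \<in> carrier FA \<Longrightarrow> y \<in> carrier FA \<Longrightarrow> cls x = cls y \<longleftrightarrow> x - y \<in> RI"
  by (simp add: coset_eq_iff[symmetric] Rep_pres_inject[symmetric] Rep_cls)

instantiation pres :: (presentation) ratfun_algebra
begin

definition zero_pres :: "'a pres" where "0 = cls 0"
definition one_pres :: "'a pres" where "1 = cls 1"
definition plus_pres :: "'a pres \<Rightarrow> 'a pres \<Rightarrow> 'a pres" where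
  "X + Y = Abs_pres (Rep_pres X \<oplus>\<^bsub>presented_algebra pgens prel\<^esub> Rep_pres Y)"
definition times_pres :: "'a pres \<Rightarrow> 'a pres \<Rightarrow> 'a pres" where
  "X * Y = Abs_pres (Rep_pres X \<otimes>\<^bsub>presented_algebra pgens prel\<^esub> Rep_pres Y)"
definition smul_pres :: "ratfun \<Rightarrow> 'a pres \<Rightarrow> 'a pres" where
  "c \<bullet> X = Abs_pres (c \<odot>\<^bsub>presented_algebra pgens prel\<^esub> Rep_pres X)"
definition uminus_pres :: "'a pres \<Rightarrow> 'a pres" where "uminus_pres X = (- 1) \<bullet> X"
definition minus_pres :: "'a pres \<Rightarrow> 'a pres \<Rightarrow> 'a pres" where "X - Y = X + (- 1) \<bullet> (Y :: 'a pres)"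

lemma cls_add: "x \<in> carrier FA \<Longrightarrow> y \<in> carrier FA \<Longrightarrow> cls x + cls y = cls (x + y)"
  and cls_mult: "x \<in> carrier FA \<Longrightarrow> y \<in> carrier FA \<Longrightarrow> cls x * cls y = cls (x * y)"
  and cls_smul: "x \<in> carrier FA \<Longrightarrow> c \<bullet> cls x = cls (c \<cdot> x)"
  by (simp_all add: plus_pres_def times_pres_def smul_pres_def Rep_cls presented_ops) (simp_all add: cls_def)

lemmas cls_ops = cls_add cls_mult cls_smul

lemma minus_one_scale: "(- 1) \<cdot> x = - x"
proof -
  have "Poly_Mapping.single (0::'b word) (- 1 :: ratfun) = - 1" by (metis single_one single_uminus)
  then show ?thesis by (simp add: scale_def)
qed

instance
proof
  fix X Y Z :: "'a pres" and c d :: ratfun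
  obtain x y t where x: "x \<in> carrier FA" "y \<in> carrier FA" "t \<in> carrier FA" and X: "X = cls x" "Y = cls y" "Z = cls t"
    by (metis cls_cases)
  note s = X zero_pres_def one_pres_def uminus_pres_def minus_pres_def cls_ops x free_algebra_closed
  show "X + Y + Z = X + (Y + Z)" "X + Y = Y + X" "0 + X = X" "X * Y * Z = X * (Y * Z)"
    "1 * X = X" "X * 1 = X" "(X + Y) * Z = X * Z + Y * Z" "X * (Y + Z) = X * Y + X * Z" "X - Y = X + - Y"
    by (simp_all add: s add_ac mult.assoc distrib_left distrib_right)
  show "- X + X = 0" by (simp add: s minus_one_scale)
  show "c \<bullet> (X + Y) = c \<bullet> X + c \<bullet> Y" "(c + d) \<bullet> X = c \<bullet> X + d \<bullet> X" "c \<bullet> d \<bullet> X = (c * d) \<bullet> X" "1 \<bullet> X = X"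
    "c \<bullet> X * Y = c \<bullet> (X * Y)" "X * c \<bullet> Y = c \<bullet> (X * Y)"
    by (simp_all add: s scale_simps mult_scale)
qed

end

lemma cls_zero: "cls 0 = 0" and cls_one: "cls 1 = 1"
  by (rule zero_pres_def[symmetric], rule one_pres_def[symmetric])

lemma cls_sum: "(\<And>i. i \<in> A \<Longrightarrow> g i \<in> carrier FA) \<Longrightarrow> cls (sum g A) = (\<Sum>i\<in>A. cls (g i)) \<and> sum g A \<in> carrier FA"
  by (induction A rule: infinite_finite_induct) (simp_all add: cls_zero free_algebra_closed flip: cls_add)

lemma cls_rel: "prel x y \<Longrightarrow> cls x = cls y"
  using prel_carrier[of x y] prel_RI[of x y] by (simp add: cls_eq_iff)

text \<open>Makes the quotient map an instance of \<open>ev\<close>, so that each defining relation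
  turns into an equation between classes by the laws of \<open>ev\<close>.\<close>

lemma ev_cls: 
  assumes "p \<in> carrier FA"
  shows "ev (\<lambda>g. cls (gen g)) p = cls p"
proof -
  have word: "ev_word (\<lambda>g. cls (gen g)) (Word gs) = cls (Poly_Mapping.single (Word gs) 1) \<and> Poly_Mapping.single (Word gs) 1 \<in> carrier FA"
    if "set gs \<subseteq> pgens" for gs
    using that
  proof (induction gs)
    case Nil
    then show ?case by (simp add: cls_one free_algebra_closed(2) flip: zero_word_def)
  next
    case (Cons g gs)
    have s: "Poly_Mapping.single (Word (g # gs)) (1 :: ratfun) = gen g * Poly_Mapping.single (Word gs) 1"
      by (simp add: gen_def mult_single plus_word_def)
    show ?case using Cons unfolding s by (simp add: ev_word_def cls_mult free_algebra_closed)
  qed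
  have mono: "Poly_Mapping.lookup p w \<bullet> ev_word (\<lambda>g. cls (gen g)) w = cls (Poly_Mapping.single w (Poly_Mapping.lookup p w))
     \<and> Poly_Mapping.single w (Poly_Mapping.lookup p w) \<in> carrier FA"
    if "w \<in> Poly_Mapping.keys p" for w
  proof -
    have w: "set (letters w) \<subseteq> pgens" using that assms by (simp add: mem_free_algebra)
    have s: "Poly_Mapping.single w c = c \<cdot> Poly_Mapping.single w (1 :: ratfun)" for c
      by (simp add: scale_def mult_single)
    show ?thesis using word[OF w] unfolding s[of "Poly_Mapping.lookup p w"] by (simp add: cls_smul free_algebra_closed)
  qed
  have "ev (\<lambda>g. cls (gen g)) p = (\<Sum>w\<in>Poly_Mapping.keys p. cls (Poly_Mapping.single w (Poly_Mapping.lookup p w)))"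
    unfolding ev_def using mono by (intro sum.cong) auto
  also have "\<dots> = cls (\<Sum>w\<in>Poly_Mapping.keys p. Poly_Mapping.single w (Poly_Mapping.lookup p w))"
    using cls_sum[of "Poly_Mapping.keys p" "\<lambda>w. Poly_Mapping.single w (Poly_Mapping.lookup p w)"] mono by simp
  finally show ?thesis by (simp only: sum_single_lookup[symmetric])
qed

text \<open>The kernel of evaluation is an ideal containing all differences of related elements,
  hence it contains the ideal that they generate.\<close>

lemma ev_RI:
  fixes h :: "'g::presentation \<Rightarrow> 'a::ratfun_algebra"
  assumes "\<And>x y. prel x y \<Longrightarrow> ev h x = ev h y" and "p \<in> RI"
  shows "ev h p = 0"
proof -
  let ?A = "FA :: (ratfun, 'g ncpoly) module"
  interpret ring ?A by (rule ring_free_algebra)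
  have minus: "\<ominus>\<^bsub>?A\<^esub> y = - y" if "y \<in> carrier ?A" for y
    using minus_equality[of "- y" y] that by (simp add: free_algebra_closed)
  have "ideal {p \<in> carrier ?A. ev h p = 0} ?A"
  proof (rule idealI[OF ring_free_algebra])
    show "subgroup {p \<in> carrier ?A. ev h p = 0} (add_monoid ?A)"
      by (intro add.subgroupI) (auto simp: free_algebra_closed minus a_inv_def[symmetric] intro: exI[of _ 0])
  qed (auto simp: free_algebra_closed)
  moreover have "{x - y | x y. prel x y} \<subseteq> {p \<in> carrier ?A. ev h p = 0}"
    using assms(1) prel_carrier by (fastforce intro: free_algebra_closed)
  ultimately have "RI \<subseteq> {p \<in> carrier ?A. ev h p = 0}"
    unfolding rel_ideal_def by (rule ring.genideal_minimal[OF ring_free_algebra])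
  then show ?thesis using assms(2) by blast
qed

locale ratfun_hom =
  fixes h :: "'a::ratfun_algebra \<Rightarrow> 'b::ratfun_algebra"
  assumes hom_add [simp]: "h (x + y) = h x + h y" and hom_mult [simp]: "h (x * y) = h x * h y"
    and hom_smul [simp]: "h (c \<bullet> x) = c \<bullet> h x" and hom_one [simp]: "h 1 = 1"
begin

lemma hom_zero [simp]: "h 0 = 0"
  using hom_smul[of 0 0] by (simp del: hom_smul)

lemma hom_uminus [simp]: "h (- x) = - h x"
  using hom_smul[of "- 1" x] by (simp del: hom_smul)

lemma hom_sum: "h (sum g A) = (\<Sum>i\<in>A. h (g i))"
  by (induction A rule: infinite_finite_induct) simp_all

lemma hom_power: "h (x ^ k) = h x ^ k"
  by (induction k) simp_all

lemma hom_ev: "h (ev g p) = ev (h \<circ> g) p"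
proof -
  have "h (ev_word g w) = ev_word (h \<circ> g) w" for w
  proof (cases w)
    case (Word gs)
    have "h (prod_list (map g gs)) = prod_list (map (h \<circ> g) gs)" by (induction gs) simp_all
    then show ?thesis by (simp add: Word ev_word_def)
  qed
  then show ?thesis by (simp add: ev_def hom_sum)
qed

end

lemma ratfun_hom_id: "ratfun_hom id"
  by unfold_locales simp_all

lemma ratfun_hom_comp: "ratfun_hom h \<Longrightarrow> ratfun_hom k \<Longrightarrow> ratfun_hom (k \<circ> h)"
  by (simp add: ratfun_hom_def)

lemma ev_rel: "prel x y \<Longrightarrow> ev (\<lambda>g. cls (gen g)) x = ev (\<lambda>g. cls (gen g)) y"
  using cls_rel[of x y] prel_carrier[of x y] by (simp add: ev_cls)

lemma ratfun_hom_eqI: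
  fixes h k :: "'g::presentation pres \<Rightarrow> 'a::ratfun_algebra"
  assumes "ratfun_hom h" "ratfun_hom k" "\<And>g. g \<in> pgens \<Longrightarrow> h (cls (gen g)) = k (cls (gen g))"
  shows "h = k"
proof
  fix X :: "'g pres"
  obtain p where p: "p \<in> carrier FA" "X = ev (\<lambda>g. cls (gen g)) p" by (metis cls_cases ev_cls)
  have "ev (h \<circ> (\<lambda>g. cls (gen g))) p = ev (k \<circ> (\<lambda>g. cls (gen g))) p"
    by (rule ev_cong[OF _ p(1)]) (simp add: assms(3))
  then show "h X = k X"
    by (simp only: p(2) ratfun_hom.hom_ev[OF assms(1)] ratfun_hom.hom_ev[OF assms(2)])
qed

text \<open>The choice of the representative is harmless once \<open>h\<close> respects the
  relations; see \<open>lift_pres_cls\<close>.\<close>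

definition lift_pres :: "('g::presentation \<Rightarrow> 'a::ratfun_algebra) \<Rightarrow> 'g pres \<Rightarrow> 'a" where
  "lift_pres h X = ev h (SOME x. x \<in> carrier FA \<and> cls x = X)"

lemma lift_pres_cls:
  assumes "\<And>x y. prel x y \<Longrightarrow> ev h x = ev h y" and "p \<in> carrier FA"
  shows "lift_pres h (cls p) = ev h p"
proof -
  define x where "x = (SOME x. x \<in> carrier FA \<and> cls x = cls p)"
  have x: "x \<in> carrier FA" "cls x = cls p"
    using someI[of "\<lambda>x. x \<in> carrier FA \<and> cls x = cls p" p] assms(2) by (simp_all add: x_def)
  then have "ev h (x - p) = 0" using assms by (intro ev_RI) (simp_all add: cls_eq_iff)
  then show ?thesis by (simp add: lift_pres_def x_def)
qed


lemma ratfun_hom_lift: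
  fixes h :: "'g::presentation \<Rightarrow> 'a::ratfun_algebra"
  assumes "\<And>x y. prel x y \<Longrightarrow> ev h x = ev h y"
  shows "ratfun_hom (lift_pres h)"
proof
  note l = lift_pres_cls[OF assms]
  fix X Y :: "'g pres" and c
  obtain x y where X: "x \<in> carrier FA" "y \<in> carrier FA" "X = cls x" "Y = cls y" by (metis cls_cases)
  show "lift_pres h (X + Y) = lift_pres h X + lift_pres h Y"
    "lift_pres h (X * Y) = lift_pres h X * lift_pres h Y" "lift_pres h (c \<bullet> X) = c \<bullet> lift_pres h X"
    using X by (simp_all add: cls_ops l free_algebra_closed)
  show "lift_pres h 1 = 1" using l[of 1] by (simp add: cls_one free_algebra_closed)
qed

text \<open>Leads back from the types to the algebras with carrier sets in which the theorem is
  stated.\<close>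

lemma algebra_iso_pres:
  fixes h :: "'g::presentation pres \<Rightarrow> 'k::presentation pres"
  assumes "ratfun_hom h" "bij h"
  shows "(\<lambda>X. Rep_pres (h (Abs_pres X))) \<in> algebra_iso (presented_algebra pgens prel) (presented_algebra pgens prel)"
proof -
  interpret ratfun_hom h by (rule assms(1))
  let ?A = "presented_algebra (pgens :: 'g set) prel" and ?B = "presented_algebra (pgens :: 'k set) prel"
  have ops: "Abs_pres (X \<otimes>\<^bsub>?A\<^esub> Y) = Abs_pres X * Abs_pres Y" "Abs_pres (X \<oplus>\<^bsub>?A\<^esub> Y) = Abs_pres X + Abs_pres Y"
    "Abs_pres (c \<odot>\<^bsub>?A\<^esub> X) = c \<bullet> Abs_pres X" if "X \<in> carrier ?A" "Y \<in> carrier ?A" for X Y c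
    using that by (simp_all add: times_pres_def plus_pres_def smul_pres_def Abs_pres_inverse)
  have reps: "Rep_pres (U * V) = Rep_pres U \<otimes>\<^bsub>?B\<^esub> Rep_pres V \<and> Rep_pres (U + V) = Rep_pres U \<oplus>\<^bsub>?B\<^esub> Rep_pres V
    \<and> Rep_pres (c \<bullet> U) = c \<odot>\<^bsub>?B\<^esub> Rep_pres U" for U V c
  proof -
    obtain u v where u: "u \<in> carrier FA" "v \<in> carrier FA" "U = cls u" "V = cls v" by (metis cls_cases)
    then show ?thesis by (simp add: cls_ops Rep_cls presented_ops free_algebra_closed)
  qed
  have one: "Abs_pres \<one>\<^bsub>?A\<^esub> = (1 :: 'g pres)" "Rep_pres (1 :: 'k pres) = \<one>\<^bsub>?B\<^esub>"
    by (simp_all add: presented_ops(4)[OF free_algebra_closed(1,1)] Rep_cls free_algebra_closed flip: cls_def cls_one)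
  have bij: "bij_betw (\<lambda>X. Rep_pres (h (Abs_pres X))) (carrier ?A) (carrier ?B)"
  proof -
    have 1: "bij_betw Abs_pres (carrier ?A) UNIV"
      by (rule bij_betw_byWitness[where f' = Rep_pres]) (auto simp: Abs_pres_inverse Rep_pres_inverse Rep_pres)
    have 2: "bij_betw Rep_pres UNIV (carrier ?B)"
      by (rule bij_betw_byWitness[where f' = Abs_pres]) (auto simp: Abs_pres_inverse Rep_pres_inverse Rep_pres)
    show ?thesis using bij_betw_trans[OF bij_betw_trans[OF 1 assms(2)] 2] by (simp add: o_def)
  qed
  show ?thesis
    unfolding algebra_iso_def ring_iso_def
    using bij by (auto intro!: ring_hom_memI simp: ops reps one Rep_pres)
qed

text \<open>An integer power of \<open>x\<close> whose inverse is passed as \<open>y\<close>, as a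
  monoid has no inversion.\<close>

definition zpow :: "'a \<Rightarrow> 'a \<Rightarrow> int \<Rightarrow> 'a::monoid_mult" where
  "zpow x y c = (if 0 \<le> c then x ^ nat c else y ^ nat (- c))"

lemma zpow_simps [simp]: "zpow x y 0 = 1" "zpow x y 1 = x" "zpow x y (- 1) = y"
  by (simp_all add: zpow_def)

lemma zpow_Suc:
  assumes "x * y = 1" "y * x = 1"
  shows "zpow x y (c + 1) = x * zpow x y c" "zpow x y (c - 1) = y * zpow x y c"
proof -
  have 1: "zpow x y (c + 1) = x * zpow x y c" for c
  proof (cases "0 \<le> c")
    case True
    then show ?thesis by (simp add: zpow_def nat_add_distrib)
  next
    case False
    then have "nat (- c) = Suc (nat (- (c + 1)))" by simp
    then show ?thesis using False assms by (simp add: zpow_def flip: mult.assoc)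
  qed
  have "y * zpow x y c = y * (x * zpow x y (c - 1))" using 1[of "c - 1"] by simp
  then show "zpow x y (c + 1) = x * zpow x y c" "zpow x y (c - 1) = y * zpow x y c"
    using 1 assms by (simp_all flip: mult.assoc)
qed

lemma zpow_add:
  assumes "x * y = 1" "y * x = 1"
  shows "zpow x y (c + d) = zpow x y c * zpow x y d"
proof (induction c rule: int_induct[of _ 0])
  case (step1 c)
  then show ?case using zpow_Suc(1)[OF assms, of "c + d"] zpow_Suc(1)[OF assms, of c] by (simp add: add_ac mult.assoc)
next
  case (step2 c)
  then show ?case using zpow_Suc(2)[OF assms, of "c + d"] zpow_Suc(2)[OF assms, of c] by (simp add: algebra_simps)
qed simp

lemma zpow_commute:
  fixes x y a :: "'a::ratfun_algebra"
  assumes "x * y = 1" "y * x = 1" "x * a = s \<bullet> (a * x)" "s \<noteq> 0"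
  shows "zpow x y c * a = (s powi c) \<bullet> (a * zpow x y c)"
proof -
  have "y * (x * a) * y = s \<bullet> (y * a * (x * y))" by (simp add: assms(3) mult.assoc)
  then have "s \<bullet> (y * a) = (y * x) * (a * y)" by (simp add: assms(1) mult.assoc)
  then have "y * a = inverse s \<bullet> (a * y)"
    using assms(4) smul_cancel[of s "y * a" "inverse s \<bullet> (a * y)"] by (simp add: assms(2))
  then show ?thesis
  proof (induction c rule: int_induct[of _ 0])
    case (step1 c)
    then show ?case using assms(3,4)
      by (simp add: zpow_Suc[OF assms(1,2)] mult.assoc power_int_add_1 mult_ac assoc_subst[OF assms(3)])
  next
    case (step2 c)
    then show ?case using assms(4)
      by (simp add: zpow_Suc[OF assms(1,2)] mult.assoc power_int_diff divide_inverse mult_ac assoc_subst[OF step2(3)])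
  qed simp
qed

text \<open>The image of $q^h$ when $q^{k_i}$ and $q^{-k_i}$ are sent to \<open>K i\<close> and \<open>K (- i)\<close>.\<close>

primrec cartan :: "(int \<Rightarrow> 'a::ratfun_algebra) \<Rightarrow> nat \<Rightarrow> (nat \<Rightarrow>\<^sub>0 int) \<Rightarrow> 'a" where
  "cartan K 0 h = 1"
| "cartan K (Suc k) h = cartan K k h * zpow (K (int (Suc k))) (K (- int (Suc k))) (Poly_Mapping.lookup h (Suc k))"

lemma cartan_zero [simp]: "cartan K k 0 = 1"
  by (induction k) simp_all

lemma cartan_cong: "(\<And>m. m \<in> {1..k} \<Longrightarrow> K (int m) = K' (int m) \<and> K (- int m) = K' (- int m)) \<Longrightarrow> cartan K k h = cartan K' k h"
  by (induction k) (simp_all del: of_nat_Suc)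

lemma (in ratfun_hom) hom_zpow: "h (zpow x y c) = zpow (h x) (h y) c"
  by (simp add: zpow_def hom_power)

lemma (in ratfun_hom) hom_cartan: "h (cartan K k x) = cartan (h \<circ> K) k x"
  by (induction k) (simp_all add: hom_zpow)

lemma cartan_single: "cartan K k (Poly_Mapping.single i c) = (if i \<in> {1..k} then zpow (K (int i)) (K (- int i)) c else 1)"
  by (induction k) (auto simp: lookup_single when_def le_Suc_eq)

lemma cartan_cow: "i \<in> {1..k} \<Longrightarrow> cartan K k (cow i) = K (int i)" "i \<in> {1..k} \<Longrightarrow> cartan K k (- cow i) = K (- int i)"
  by (simp_all add: cow_def cartan_single flip: single_uminus)

text \<open>If \<open>a\<close> has weight \<open>w m\<close> at each k_m, then its weight at
  \<open>h\<close> is the pairing of \<open>w\<close> with \<open>h\<close>.\<close>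

lemma cartan_commute:
  assumes "c \<noteq> 0" "\<And>m. m \<in> {1..k} \<Longrightarrow> K (int m) * K (- int m) = 1 \<and> K (- int m) * K (int m) = 1"
    and "\<And>m. m \<in> {1..k} \<Longrightarrow> K (int m) * a = (c powi w m) \<bullet> (a * K (int m))"
  shows "cartan K k h * a = (c powi (\<Sum>m=1..k. w m * Poly_Mapping.lookup h m)) \<bullet> (a * cartan K k h)"
  using assms(2,3)
proof (induction k)
  case (Suc k)
  let ?x = "zpow (K (int (Suc k))) (K (- int (Suc k))) (Poly_Mapping.lookup h (Suc k))"
  have IH: "cartan K k h * a = (c powi (\<Sum>m=1..k. w m * Poly_Mapping.lookup h m)) \<bullet> (a * cartan K k h)"
    using Suc by (simp del: of_nat_Suc)
  have x: "?x * a = ((c powi w (Suc k)) powi Poly_Mapping.lookup h (Suc k)) \<bullet> (a * ?x)"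
    using Suc.prems(1)[of "Suc k"] Suc.prems(2)[of "Suc k"] assms(1) by (intro zpow_commute) (auto simp del: of_nat_Suc)
  show ?case
    by (simp only: cartan.simps mult.assoc x mult_smul_right IH[THEN assoc_subst] mult_smul_left smul_smul)
      (simp add: power_int_add assms(1) mult_ac power_int_mult)
qed simp

lemma cartan_add:
  assumes "\<And>m. m \<in> {1..k} \<Longrightarrow> K (int m) * K (- int m) = 1 \<and> K (- int m) * K (int m) = 1"
    and "\<And>m m'. \<lbrakk>m \<in> {1..k}; m' \<in> {1..k}\<rbrakk> \<Longrightarrow> K (int m) * K (int m') = K (int m') * K (int m)"
  shows "cartan K k (h + h') = cartan K k h * cartan K k h'"
  using assms
proof (induction k)
  case (Suc k)
  let ?x = "zpow (K (int (Suc k))) (K (- int (Suc k)))"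
  have x: "?x c * a = a * ?x c" if "K (int (Suc k)) * a = a * K (int (Suc k))" for a c
    using zpow_commute[of "K (int (Suc k))" "K (- int (Suc k))" a 1 c] Suc.prems(1)[of "Suc k"] that by simp
  have "cartan K k h' * ?x c = ?x c * cartan K k h'" for c
    using cartan_commute[of 1 k K "?x c" "\<lambda>_. 0" h'] Suc.prems by (simp add: x del: of_nat_Suc)
  then have c: "?x c * cartan K k h' = cartan K k h' * ?x c" for c by simp
  have "?x (d + d') = ?x d * ?x d'" for d d' using Suc.prems(1)[of "Suc k"] by (intro zpow_add) auto
  moreover have "cartan K k (h + h') = cartan K k h * cartan K k h'" using Suc by (simp del: of_nat_Suc)
  ultimately show ?case by (simp only: cartan.simps lookup_add mult.assoc assoc_subst[OF c])
qed simp

lemma coweights_closed: "0 \<in> coweights n" "h \<in> coweights n \<Longrightarrow> h' \<in> coweights n \<Longrightarrow> h + h' \<in> coweights n"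
  "h \<in> coweights n \<Longrightarrow> - h \<in> coweights n" "h \<in> coweights n \<Longrightarrow> h' \<in> coweights n \<Longrightarrow> h - h' \<in> coweights n"
  "i \<in> {1..n} \<Longrightarrow> Poly_Mapping.single i c \<in> coweights n" "i \<in> {1..n} \<Longrightarrow> cow i \<in> coweights n"
proof -
  have mem: "h \<in> coweights n \<longleftrightarrow> (\<forall>i. i \<notin> {1..n} \<longrightarrow> Poly_Mapping.lookup h i = 0)" for h
    by (auto simp: coweights_def free_Abelian_group_def subset_iff in_keys_iff)
  show "0 \<in> coweights n" "h \<in> coweights n \<Longrightarrow> h' \<in> coweights n \<Longrightarrow> h + h' \<in> coweights n"
    "h \<in> coweights n \<Longrightarrow> - h \<in> coweights n" "h \<in> coweights n \<Longrightarrow> h' \<in> coweights n \<Longrightarrow> h - h' \<in> coweights n"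
    by (simp_all add: mem lookup_add lookup_minus)
  show "i \<in> {1..n} \<Longrightarrow> Poly_Mapping.single i c \<in> coweights n" "i \<in> {1..n} \<Longrightarrow> cow i \<in> coweights n"
    unfolding mem cow_def by (auto simp: lookup_single when_def)
qed

lemma coweights_sum: "h \<in> coweights n \<Longrightarrow> h = (\<Sum>m=1..n. Poly_Mapping.single m (Poly_Mapping.lookup h m))"
  by (rule poly_mapping_eqI)
    (auto simp: lookup_sum lookup_single when_def coweights_def free_Abelian_group_def subset_iff in_keys_iff)

text \<open>\<open>Q\<close> is multiplicative on a free abelian group, so its values on the basis
  and on the negatives of the basis determine it.\<close>

lemma cartan_unique:
  fixes Q :: "(nat \<Rightarrow>\<^sub>0 int) \<Rightarrow> 'a::ratfun_algebra"
  assumes "Q 0 = 1" "\<And>h h'. \<lbrakk>h \<in> coweights n; h' \<in> coweights n\<rbrakk> \<Longrightarrow> Q (h + h') = Q h * Q h'"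
    and K: "\<And>m. m \<in> {1..n} \<Longrightarrow> K (int m) = Q (cow m) \<and> K (- int m) = Q (- cow m)" and "h \<in> coweights n"
  shows "Q h = cartan K n h"
proof -
  have single: "Q (Poly_Mapping.single m c) = zpow (K (int m)) (K (- int m)) c" if m: "m \<in> {1..n}" for m c
  proof -
    have inv: "Q (cow m) * Q (- cow m) = 1" "Q (- cow m) * Q (cow m) = 1"
      using assms(1) assms(2)[of "cow m" "- cow m"] assms(2)[of "- cow m" "cow m"] m
      by (simp_all add: coweights_closed)
    have "Q (Poly_Mapping.single m c) = zpow (Q (cow m)) (Q (- cow m)) c"
    proof (induction c rule: int_induct[of _ 0])
      case base
      then show ?case by (simp add: assms(1))
    next
      case (step1 c)
      then show ?case
        using assms(2)[of "cow m" "Poly_Mapping.single m c"] m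
        by (simp add: zpow_Suc[OF inv, unfolded cow_def] coweights_closed cow_def add.commute[of 1] flip: single_add)
    next
      case (step2 c)
      have "Q (Poly_Mapping.single m (c - 1)) = Q (- cow m) * Q (Poly_Mapping.single m c)"
        using assms(2)[of "- cow m" "Poly_Mapping.single m c"] m
        by (simp add: coweights_closed cow_def add.commute[of "- 1"] flip: single_add single_uminus)
      then show ?case using step2 by (simp add: zpow_Suc[OF inv])
    qed
    then show ?thesis using K[OF m] by simp
  qed
  \<comment> \<open>Partial sums of the expansion of \<open>h\<close> in the basis, in the order in
    which \<open>cartan\<close> multiplies its factors.\<close>
  let ?s = "\<lambda>k. \<Sum>m=1..k. Poly_Mapping.single m (Poly_Mapping.lookup h m)"
  have "k \<le> n \<Longrightarrow> ?s k \<in> coweights n \<and> Q (?s k) = cartan K k h" for k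
  proof (induction k)
    case (Suc k)
    then show ?case
      using assms(2)[of "?s k" "Poly_Mapping.single (Suc k) (Poly_Mapping.lookup h (Suc k))"] single[of "Suc k"]
      by (simp add: coweights_closed)
  qed (simp add: coweights_closed assms(1))
  from this[OF order_refl] show ?thesis by (simp only: coweights_sum[OF assms(4), symmetric])
qed

section \<open>The isomorphism\<close>

text \<open>The conclusion of the theorem as a predicate on the rank, so that a rank can be singled
  out by it before the types are formed.\<close>

definition presentations_iso :: "nat \<Rightarrow> bool" where
  "presentations_iso n \<longleftrightarrow> (\<exists>\<Phi> \<in> algebra_iso (Uq_chev n) (Uq_queer n).
    (\<forall>i \<in> {1..n}.
      \<Phi> (chev_class n (qpow (cow i))) = Uq_class n (\<L> (int i) (int i)) \<and>
      \<Phi> (chev_class n (qpow (- cow i))) = Uq_class n (\<L> (- int i) (- int i)) \<and>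
      \<Phi> (chev_class n (\<kk>bar i))
        = Uq_class n ((- (1 / (\<q> - inverse \<q>))) \<cdot> \<L> (- int i) (int i))) \<and>
    (\<forall>i \<in> {1..<n}.
      \<Phi> (chev_class n (\<ee> i))
        = Uq_class n ((- (1 / (\<q> - inverse \<q>))) \<cdot> \<L> (- int i - 1) (- int i)) \<and>
      \<Phi> (chev_class n (\<ff> i))
        = Uq_class n ((1 / (\<q> - inverse \<q>)) \<cdot> \<L> (int i) (int i + 1)) \<and>
      \<Phi> (chev_class n (\<ee>bar i))
        = Uq_class n ((- (1 / (\<q> - inverse \<q>))) \<cdot> \<L> (- int i - 1) (int i)) \<and>
      \<Phi> (chev_class n (\<ff>bar i))
        = Uq_class n ((- (1 / (\<q> - inverse \<q>))) \<cdot> \<L> (- int i) (int i + 1))))"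

text \<open>The two algebras are needed as types, and a type cannot depend on \<open>n\<close>. The rank is therefore
  fixed once and for all as a counterexample to the theorem, if there is one.\<close>

definition crit_rank :: nat where
  "crit_rank = (if \<exists>n\<ge>1. \<not> presentations_iso n then SOME n. n \<ge> 1 \<and> \<not> presentations_iso n else 1)"

lemma crit_rank_pos: "1 \<le> crit_rank"
  unfolding crit_rank_def by (auto intro: someI2_ex)

text \<open>If some rank failed, \<open>crit_rank\<close> would be a failing rank itself.\<close>

lemma presentations_iso_if_crit_rank: "presentations_iso crit_rank \<Longrightarrow> 1 \<le> n \<Longrightarrow> presentations_iso n"
  by (rule ccontr) (use someI[of "\<lambda>n. n \<ge> 1 \<and> \<not> presentations_iso n" n] in \<open>auto simp: crit_rank_def split: if_splits\<close>)

instantiation olsh_gen :: presentation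
begin

definition pgens_olsh_gen :: "olsh_gen set" where "pgens_olsh_gen = olsh_gens crit_rank"
definition prel_olsh_gen :: "olsh_gen ncpoly \<Rightarrow> olsh_gen ncpoly \<Rightarrow> bool" where "prel_olsh_gen = olsh_rel crit_rank"

instance
proof
  fix x y :: "olsh_gen ncpoly"
  have gen: "i \<in> olsh_index crit_rank \<Longrightarrow> j \<in> olsh_index crit_rank \<Longrightarrow> i \<le> j \<Longrightarrow> \<L> i j \<in> carrier (free_algebra pgens)" for i j
    by (rule free_algebra_closed) (auto simp: pgens_olsh_gen_def olsh_gens_def)
  have neg: "i \<in> olsh_index crit_rank \<Longrightarrow> - i \<in> olsh_index crit_rank" for i by (auto simp: olsh_index_def)
  \<comment> \<open>A monomial with indices out of order lies outside the free algebra on the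
    generators, but its coefficient is then zero.\<close>
  have mono: "(of_bool P * c * d) \<cdot> (\<L> i j * \<L> k l) \<in> carrier (free_algebra pgens)"
    if "P \<Longrightarrow> i \<le> j \<and> k \<le> l" "i \<in> olsh_index crit_rank" "j \<in> olsh_index crit_rank" "k \<in> olsh_index crit_rank" "l \<in> olsh_index crit_rank"
    for P c d i j k l
  proof (cases P)
    case True
    then show ?thesis using that by (intro free_algebra_closed(7) free_algebra_closed(4) gen) auto
  next
    case False
    then show ?thesis using free_algebra_closed(1) by (simp add: scale_def)
  qed
  assume "prel x y"
  then have "olsh_rel crit_rank x y" by (simp add: prel_olsh_gen_def)
  then show "x \<in> carrier (free_algebra pgens) \<and> y \<in> carrier (free_algebra pgens)"
  proof (cases rule: olsh_rel.cases)
    case (exchange i j k l)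
    show ?thesis unfolding exchange(1,2)
      by (intro conjI free_algebra_closed(3);
        (rule mono, use exchange in force, (use exchange neg in blast)+ | intro free_algebra_closed(7) free_algebra_closed(4) gen exchange(3-8)))
  qed (auto intro: gen neg free_algebra_closed)
qed

end

instantiation chev_gen :: presentation
begin

definition pgens_chev_gen :: "chev_gen set" where "pgens_chev_gen = chev_gens crit_rank"
definition prel_chev_gen :: "chev_gen ncpoly \<Rightarrow> chev_gen ncpoly \<Rightarrow> bool" where "prel_chev_gen = chev_rel crit_rank"

instance
proof
  fix x y :: "chev_gen ncpoly"
  have gen: "i \<in> {1..<crit_rank} \<Longrightarrow> \<ee> i \<in> carrier (free_algebra pgens)" "i \<in> {1..<crit_rank} \<Longrightarrow> \<ff> i \<in> carrier (free_algebra pgens)"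
    "i \<in> {1..<crit_rank} \<Longrightarrow> \<ee>bar i \<in> carrier (free_algebra pgens)" "i \<in> {1..<crit_rank} \<Longrightarrow> \<ff>bar i \<in> carrier (free_algebra pgens)"
    "i \<in> {1..crit_rank} \<Longrightarrow> \<kk>bar i \<in> carrier (free_algebra pgens)" "h \<in> coweights crit_rank \<Longrightarrow> qpow h \<in> carrier (free_algebra pgens)" for i h
    by (rule free_algebra_closed; simp add: pgens_chev_gen_def chev_gens_def)+
  show "x \<in> carrier (free_algebra pgens) \<and> y \<in> carrier (free_algebra pgens)" if "prel x y"
    using that unfolding prel_chev_gen_def
    by (cases rule: chev_rel.cases)
      (intro conjI; hypsubst; intro gen free_algebra_closed(1-8) coweights_closed; simp)+
qed

end

lemma q_nonzero: "\<q> \<noteq> 0" "1 + \<q> * \<q> \<noteq> 0" "\<q> - inverse \<q> \<noteq> 0" "\<q> + inverse \<q> \<noteq> 0"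
proof -
  show q: "\<q> \<noteq> 0" by (simp add: \<q>_def Zero_fract_def eq_fract)
  show p: "1 + \<q> * \<q> \<noteq> 0" by (simp add: \<q>_def Zero_fract_def One_fract_def eq_fract one_pCons)
  have m: "\<q> * \<q> - 1 \<noteq> 0" by (simp add: \<q>_def Zero_fract_def One_fract_def eq_fract one_pCons)
  have "\<q> - inverse \<q> = inverse \<q> * (\<q> * \<q> - 1)" "\<q> + inverse \<q> = inverse \<q> * (1 + \<q> * \<q>)"
    using q by (simp_all add: field_simps)
  then show "\<q> - inverse \<q> \<noteq> 0" "\<q> + inverse \<q> \<noteq> 0" using p m q by simp_all
qed

lemma q_square: "\<q> ^ 2 - inverse \<q> ^ 2 \<noteq> 0"
proof -
  have "\<q> ^ 2 - inverse \<q> ^ 2 = (\<q> - inverse \<q>) * (\<q> + inverse \<q>)" by (simp add: power2_eq_square algebra_simps)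
  then show ?thesis using q_nonzero(3,4) by simp
qed

lemma indices_olsh_index: "indices (int n) = olsh_index n"
  by (simp add: indices_def olsh_index_def)

lemma (in olshanski) olshanski_hom:
  assumes "ratfun_hom h"
  shows "olshanski q z n (\<lambda>i j. h (L i j))"
proof -
  interpret ratfun_hom h by (rule assms)
  show ?thesis
  proof
    show "exchange q (\<lambda>i j. h (L i j)) i j k l"
      if "i \<in> indices n" "j \<in> indices n" "k \<in> indices n" "l \<in> indices n" "i \<le> j" "k \<le> l" for i j k l
      using arg_cong[OF exchange[OF that, unfolded exchange_def], of h] by (simp add: exchange_def)
    show "h (L i i) * h (L (- i) (- i)) = 1" if "i \<in> indices n" for i
      using L_inverse[OF that] by (simp flip: hom_mult)
  qed (simp_all add: L_zero n1 q2, rule z)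
qed

abbreviation rank :: int where "rank \<equiv> int crit_rank"

abbreviation chev_cls :: "chev_gen \<Rightarrow> chev_gen pres" where "chev_cls g \<equiv> cls (gen g)"

lemma chev_rel: "chev_rel crit_rank x y \<Longrightarrow> ev (\<lambda>g. chev_cls g) x = ev (\<lambda>g. chev_cls g) y"
  by (rule ev_rel) (simp add: prel_chev_gen_def)

lemma qpow_add: "\<lbrakk>h \<in> coweights crit_rank; h' \<in> coweights crit_rank\<rbrakk> \<Longrightarrow>
    chev_cls (Q_gen (h + h')) = chev_cls (Q_gen h) * chev_cls (Q_gen h')"
  using chev_rel[OF chev_rel.q_add] by simp

lemma qpow_diff: "\<lbrakk>h \<in> coweights crit_rank; h' \<in> coweights crit_rank\<rbrakk> \<Longrightarrow>
    chev_cls (Q_gen (h - h')) = chev_cls (Q_gen h) * chev_cls (Q_gen (- h'))"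
  using qpow_add[of h "- h'"] by (simp add: coweights_closed)

lemma qpow_qpow: "\<lbrakk>h \<in> coweights crit_rank; h' \<in> coweights crit_rank\<rbrakk> \<Longrightarrow>
    chev_cls (Q_gen (- h)) * chev_cls (Q_gen h') = chev_cls (Q_gen h') * chev_cls (Q_gen (- h))"
  using qpow_add[of "- h" h'] qpow_add[of h' "- h"] by (simp add: coweights_closed)

lemma qpow_zero: "chev_cls (Q_gen 0) = 1"
  using chev_rel[OF chev_rel.q_zero] by simp

lemma qpow_minus: "h \<in> coweights crit_rank \<Longrightarrow> chev_cls (Q_gen (- h)) * chev_cls (Q_gen h) = 1"
  using qpow_add[of "- h" h] by (simp add: qpow_zero coweights_closed)

lemma qpow_commute:
  assumes "h \<in> coweights crit_rank" "chev_cls (Q_gen h) * x * chev_cls (Q_gen (- h)) = c \<bullet> x"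
  shows "chev_cls (Q_gen h) * x = c \<bullet> (x * chev_cls (Q_gen h))"
  using arg_cong[OF assms(2), of "\<lambda>y. y * chev_cls (Q_gen h)"] by (simp add: mult.assoc qpow_minus[OF assms(1)])

definition cK :: "int \<Rightarrow> chev_gen pres" where
  "cK i = chev_cls (Q_gen (if 0 \<le> i then cow (nat i) else - cow (nat (- i))))"

lemma cK_simps: "1 \<le> i \<Longrightarrow> cK i = chev_cls (Q_gen (cow (nat i)))" "1 \<le> i \<Longrightarrow> cK (- i) = chev_cls (Q_gen (- cow (nat i)))"
  "1 \<le> i \<Longrightarrow> cK (i + 1) = chev_cls (Q_gen (cow (nat i + 1)))" "1 \<le> i \<Longrightarrow> cK (- (i + 1)) = chev_cls (Q_gen (- cow (nat i + 1)))"
  "1 \<le> i \<Longrightarrow> cK (- i - 1) = chev_cls (Q_gen (- cow (nat i + 1)))"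
  by (simp_all add: cK_def nat_add_distrib)

abbreviation "ce i \<equiv> chev_cls (E_gen (nat i))"
abbreviation "cf i \<equiv> chev_cls (F_gen (nat i))"
abbreviation "ceb i \<equiv> chev_cls (Ebar_gen (nat i))"
abbreviation "cfb i \<equiv> chev_cls (Fbar_gen (nat i))"
abbreviation "ckb i \<equiv> chev_cls (Kbar_gen (nat i))"

lemma nat_mem: "1 \<le> i \<Longrightarrow> i < rank \<Longrightarrow> nat i \<in> {1..<crit_rank}" "1 \<le> i \<Longrightarrow> i \<le> rank \<Longrightarrow> nat i \<in> {1..crit_rank}"
  "1 \<le> i \<Longrightarrow> i + 1 < rank \<Longrightarrow> nat i \<in> {1..<crit_rank}" "1 \<le> i \<Longrightarrow> i + 1 < rank \<Longrightarrow> nat i + 1 \<in> {1..<crit_rank}"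
  "1 \<le> i \<Longrightarrow> i < rank \<Longrightarrow> nat i + 1 \<in> {1..crit_rank}"
  "1 \<le> i \<Longrightarrow> Suc 0 \<le> nat i" "1 \<le> i \<Longrightarrow> i < rank \<Longrightarrow> nat i < crit_rank" "1 \<le> i \<Longrightarrow> i \<le> rank \<Longrightarrow> nat i \<le> crit_rank"
  by auto

lemma nat_Suc: "1 \<le> i \<Longrightarrow> nat (i + 1) = nat i + 1"
  by (simp add: nat_add_distrib)

lemma nat_apart: "\<lbrakk>1 \<le> i; 1 \<le> j; \<bar>i - j\<bar> > 1\<rbrakk> \<Longrightarrow> apart (nat i) (nat j)"
  by (simp add: apart_def)

lemma simple_root_cow: "simple_root i (cow m) = (if m = i then 1 else if m = i + 1 then - 1 else 0)"
  by (auto simp: simple_root_def eps_def cow_def lookup_single when_def)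

lemma eq_0_iff: "x - y = 0 \<longleftrightarrow> x = y" "x + y = 0 \<longleftrightarrow> x = - y" for x y :: "'a::ratfun_algebra"
  by (simp_all add: eq_neg_iff_add_eq_0)

text \<open>Each axiom is a defining relation evaluated at the classes of the generators; the sums
  of coweights occurring in it are split by \<open>qpow_add\<close>.\<close>

lemma chev_system_cls: "chev_system \<q> (\<q> - inverse \<q>) rank cK cf ce cfb ceb ckb"
proof (rule chev_system.intro)
  note chev_simps = nat_mem nat_Suc cK_simps power2_eq_square mult.assoc
  show "\<q> \<noteq> 0" "\<q> - inverse \<q> \<noteq> 0" "1 + \<q> * \<q> \<noteq> 0" by (fact q_nonzero)+
  show "\<q> - inverse \<q> = \<q> - inverse \<q>" by (rule refl)
  show "1 \<le> rank" using crit_rank_pos by simp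
  have cow: "cow (nat m) \<in> coweights crit_rank" "- cow (nat m) \<in> coweights crit_rank" if "1 \<le> m" "m \<le> rank" for m
    using nat_mem(2)[OF that] by (simp_all add: coweights_closed)
  have cow': "cow (nat m + 1) \<in> coweights crit_rank" "- cow (nat m + 1) \<in> coweights crit_rank" if "1 \<le> m" "m < rank" for m
    using nat_mem(5)[OF that] by (simp_all add: coweights_closed)
  show "cK m * cK (- m) = 1" "cK (- m) * cK m = 1" if "1 \<le> m" "m \<le> rank" for m
    using qpow_minus[OF cow(1)[OF that]] qpow_minus[OF cow(2)[OF that]] that by (simp_all add: cK_simps)
  show "cK m * cK i = cK i * cK m" if "1 \<le> m" "m \<le> rank" "1 \<le> i" "i \<le> rank" for m i
    using qpow_add[OF cow(1)[OF that(1,2)] cow(1)[OF that(3,4)]] qpow_add[OF cow(1)[OF that(3,4)] cow(1)[OF that(1,2)]] that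
    by (simp add: cK_simps add.commute)
  have idx: "nat m = nat i \<longleftrightarrow> m = i" "nat m = nat i + 1 \<longleftrightarrow> m = i + 1" if "1 \<le> m" "1 \<le> i" for m i
    using that by auto

  show "cK m * cf i = (if m = i then inverse \<q> else if m = i + 1 then \<q> else 1) \<bullet> (cf i * cK m)"
    if "1 \<le> m" "m \<le> rank" "1 \<le> i" "i < rank" for m i
    using qpow_commute[OF cow(1)[OF that(1,2)] chev_rel[OF chev_rel.q_f[OF cow(1)[OF that(1,2)] nat_mem(1)[OF that(3,4)]], simplified]] that
    by (simp add: cK_simps simple_root_cow idx[OF that(1,3), simplified] split: if_splits)
  show "cK m * ce i = (if m = i then \<q> else if m = i + 1 then inverse \<q> else 1) \<bullet> (ce i * cK m)"
    if "1 \<le> m" "m \<le> rank" "1 \<le> i" "i < rank" for m i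
    using qpow_commute[OF cow(1)[OF that(1,2)] chev_rel[OF chev_rel.q_e[OF cow(1)[OF that(1,2)] nat_mem(1)[OF that(3,4)]], simplified]] that
    by (simp add: cK_simps simple_root_cow idx[OF that(1,3), simplified] split: if_splits)
  show "cK m * cfb i = (if m = i then inverse \<q> else if m = i + 1 then \<q> else 1) \<bullet> (cfb i * cK m)"
    if "1 \<le> m" "m \<le> rank" "1 \<le> i" "i < rank" for m i
    using qpow_commute[OF cow(1)[OF that(1,2)] chev_rel[OF chev_rel.q_fb[OF cow(1)[OF that(1,2)] nat_mem(1)[OF that(3,4)]], simplified]] that
    by (simp add: cK_simps simple_root_cow idx[OF that(1,3), simplified] split: if_splits)
  show "cK m * ceb i = (if m = i then \<q> else if m = i + 1 then inverse \<q> else 1) \<bullet> (ceb i * cK m)"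
    if "1 \<le> m" "m \<le> rank" "1 \<le> i" "i < rank" for m i
    using qpow_commute[OF cow(1)[OF that(1,2)] chev_rel[OF chev_rel.q_eb[OF cow(1)[OF that(1,2)] nat_mem(1)[OF that(3,4)]], simplified]] that
    by (simp add: cK_simps simple_root_cow idx[OF that(1,3), simplified] split: if_splits)
  show "cK m * ckb i = ckb i * cK m"
    if "1 \<le> m" "m \<le> rank" "1 \<le> i" "i \<le> rank" for m i
    using qpow_commute[OF cow(1)[OF that(1,2)], of "ckb i" 1] chev_rel[OF chev_rel.q_kb[OF cow(1)[OF that(1,2)] nat_mem(2)[OF that(3,4)]]] that
    by (simp add: cK_simps)
  show "ce i * cf i - cf i * ce i = inverse (\<q> - inverse \<q>) \<bullet> (cK i * cK (- (i + 1)) - cK (- i) * cK (i + 1))" if "1 \<le> i" "i < rank" for i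
    using chev_rel[OF chev_rel.e_f[OF nat_mem(1)[OF that]]] that
    by (simp add: eq_0_iff chev_simps qpow_diff qpow_qpow cow cow' coweights_closed divide_inverse)
  show "\<q> \<bullet> (ce (i + 1) * cf i) = cf i * ce (i + 1)" if "1 \<le> i" "i + 1 < rank" for i
    using chev_rel[OF chev_rel.e_f_up[of "nat i"]] that
    by (simp add: eq_0_iff chev_simps)
  show "ce i * cf (i + 1) = \<q> \<bullet> (cf (i + 1) * ce i)" if "1 \<le> i" "i + 1 < rank" for i
    using chev_rel[OF chev_rel.e_f_dn[of "nat i"]] that
    by (simp add: eq_0_iff chev_simps)
  show "ce i * cf j = cf j * ce i" if "1 \<le> i" "i < rank" "1 \<le> j" "j < rank" "\<bar>i - j\<bar> > 1" for i j
    using chev_rel[OF chev_rel.e_f_apart[of "nat i" _ "nat j"]] that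
    by (simp add: eq_0_iff chev_simps nat_apart)
  show "ce i * cfb i - cfb i * ce i = cK (- (i + 1)) * ckb i - ckb (i + 1) * cK (- i)" if "1 \<le> i" "i < rank" for i
    using chev_rel[OF chev_rel.e_fb[of "nat i"]] that
    by (simp add: eq_0_iff chev_simps)
  show "\<q> \<bullet> (ce (i + 1) * cfb i) = cfb i * ce (i + 1)" if "1 \<le> i" "i + 1 < rank" for i
    using chev_rel[OF chev_rel.e_fb_up[of "nat i"]] that
    by (simp add: eq_0_iff chev_simps)
  show "ce i * cfb (i + 1) = \<q> \<bullet> (cfb (i + 1) * ce i)" if "1 \<le> i" "i + 1 < rank" for i
    using chev_rel[OF chev_rel.e_fb_dn[of "nat i"]] that
    by (simp add: eq_0_iff chev_simps)
  show "ce i * cfb j = cfb j * ce i" if "1 \<le> i" "i < rank" "1 \<le> j" "j < rank" "\<bar>i - j\<bar> > 1" for i j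
    using chev_rel[OF chev_rel.e_fb_apart[of "nat i" _ "nat j"]] that
    by (simp add: eq_0_iff chev_simps nat_apart)
  show "ceb i * cf i - cf i * ceb i = cK (i + 1) * ckb i - ckb (i + 1) * cK i" if "1 \<le> i" "i < rank" for i
    using chev_rel[OF chev_rel.eb_f[of "nat i"]] that
    by (simp add: eq_0_iff chev_simps)
  show "\<q> \<bullet> (ceb (i + 1) * cf i) = cf i * ceb (i + 1)" if "1 \<le> i" "i + 1 < rank" for i
    using chev_rel[OF chev_rel.eb_f_up[of "nat i"]] that
    by (simp add: eq_0_iff chev_simps)
  show "ceb i * cf (i + 1) = \<q> \<bullet> (cf (i + 1) * ceb i)" if "1 \<le> i" "i + 1 < rank" for i
    using chev_rel[OF chev_rel.eb_f_dn[of "nat i"]] that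
    by (simp add: eq_0_iff chev_simps)
  show "ceb i * cf j = cf j * ceb i" if "1 \<le> i" "i < rank" "1 \<le> j" "j < rank" "\<bar>i - j\<bar> > 1" for i j
    using chev_rel[OF chev_rel.eb_f_apart[of "nat i" _ "nat j"]] that
    by (simp add: eq_0_iff chev_simps nat_apart)
  show "ckb i * ce i - \<q> \<bullet> (ce i * ckb i) = ceb i * cK (- i)" if "1 \<le> i" "i < rank" for i
    using chev_rel[OF chev_rel.kb_e[of "nat i"]] that
    by (simp add: eq_0_iff chev_simps)
  show "\<q> \<bullet> (ckb (i + 1) * ce i) - ce i * ckb (i + 1) = - (cK (- (i + 1)) * ceb i)" if "1 \<le> i" "i < rank" for i
    using chev_rel[OF chev_rel.kb_e_dn[of "nat i + 1"]] that
    by (simp add: eq_0_iff chev_simps)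
  show "ckb i * ce j = ce j * ckb i" if "1 \<le> i" "i \<le> rank" "1 \<le> j" "j < rank" "i \<noteq> j" "i \<noteq> j + 1" for i j
    using chev_rel[OF chev_rel.kb_e_apart[of "nat i" _ "nat j"]] that
    by (simp add: eq_0_iff chev_simps)
  show "ckb i * cf i - \<q> \<bullet> (cf i * ckb i) = - (cfb i * cK i)" if "1 \<le> i" "i < rank" for i
    using chev_rel[OF chev_rel.kb_f[of "nat i"]] that
    by (simp add: eq_0_iff chev_simps)
  show "\<q> \<bullet> (ckb (i + 1) * cf i) - cf i * ckb (i + 1) = cK (i + 1) * cfb i" if "1 \<le> i" "i < rank" for i
    using chev_rel[OF chev_rel.kb_f_dn[of "nat i + 1"]] that
    by (simp add: eq_0_iff chev_simps)
  show "ckb i * cf j = cf j * ckb i" if "1 \<le> i" "i \<le> rank" "1 \<le> j" "j < rank" "i \<noteq> j" "i \<noteq> j + 1" for i j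
    using chev_rel[OF chev_rel.kb_f_apart[of "nat i" _ "nat j"]] that
    by (simp add: eq_0_iff chev_simps)
  show "(\<q> * \<q> - inverse \<q> * inverse \<q>) \<bullet> (ckb 1 * ckb 1) = cK 1 * cK 1 - cK (- 1) * cK (- 1)"
  proof -
    have 1: "1 \<in> {1..crit_rank}" using crit_rank_pos by simp
    let ?x = "chev_cls (Kbar_gen 1)" and ?Q = "\<lambda>h. chev_cls (Q_gen h)"
    \<comment> \<open>In the defining relation q^{2 k_1} is a single generator; it has to be
      identified with the square of q^{k_1}.\<close>
    have "?Q (cow 1 + cow 1) = ?Q (cow 1) * ?Q (cow 1)" "?Q (- (cow 1 + cow 1)) = ?Q (- cow 1) * ?Q (- cow 1)"
      using 1 qpow_add[of "cow 1" "cow 1"] qpow_add[of "- cow 1" "- cow 1"] by (simp_all add: coweights_closed)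
    then have "?x * ?x = (1 / (\<q> ^ 2 - inverse \<q> ^ 2)) \<bullet> (?Q (cow 1) * ?Q (cow 1) - ?Q (- cow 1) * ?Q (- cow 1))"
      using chev_rel[OF chev_rel.kb_sq[OF 1]] by (simp only: ev_power ev_scale ev_diff ev_gen power2_eq_square[of ?x])
    from arg_cong[OF this, of "smul (\<q> ^ 2 - inverse \<q> ^ 2)"]
    show ?thesis using q_square unfolding smul_smul by (simp add: cK_simps power2_eq_square)
  qed
  show "ckb 1 * ckb i = - (ckb i * ckb 1)" if "2 \<le> i" "i \<le> rank" for i
    using chev_rel[OF chev_rel.kb_kb[of 1 _ "nat i"]] that
    by (simp add: eq_0_iff chev_simps)
  show "ckb 1 * cfb 1 + \<q> \<bullet> (cfb 1 * ckb 1) = cf 1 * cK 1" if "1 < rank"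
    using chev_rel[OF chev_rel.kb_fb[of 1]] that
    by (simp add: eq_0_iff chev_simps)
  show "ckb 1 * cfb i = - (cfb i * ckb 1)" if "2 \<le> i" "i < rank" for i
    using chev_rel[OF chev_rel.kb_fb_apart[of 1 _ "nat i"]] that
    by (simp add: eq_0_iff chev_simps)
  show "ckb 1 * ceb 1 + \<q> \<bullet> (ceb 1 * ckb 1) = ce 1 * cK (- 1)" if "1 < rank"
    using chev_rel[OF chev_rel.kb_eb[of 1]] that
    by (simp add: eq_0_iff chev_simps)
  show "ckb 1 * ceb i = - (ceb i * ckb 1)" if "2 \<le> i" "i < rank" for i
    using chev_rel[OF chev_rel.kb_eb_apart[of 1 _ "nat i"]] that
    by (simp add: eq_0_iff chev_simps)
  show "ce i * ce j = ce j * ce i" if "1 \<le> i" "i < rank" "1 \<le> j" "j < rank" "\<bar>i - j\<bar> > 1" for i j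
    using chev_rel[OF chev_rel.e_e_apart[of "nat i" _ "nat j"]] that
    by (simp add: eq_0_iff chev_simps nat_apart)
  show "cf i * cf j = cf j * cf i" if "1 \<le> i" "i < rank" "1 \<le> j" "j < rank" "\<bar>i - j\<bar> > 1" for i j
    using chev_rel[OF chev_rel.f_f_apart[of "nat i" _ "nat j"]] that
    by (simp add: eq_0_iff chev_simps nat_apart)
  show "ce i * ceb j = ceb j * ce i" if "1 \<le> i" "i < rank" "1 \<le> j" "j < rank" "\<bar>i - j\<bar> \<noteq> 1" for i j
    using chev_rel[OF chev_rel.e_eb[of "nat i" _ "nat j"]] that
    by (simp add: eq_0_iff chev_simps)
  show "cf i * cfb j = cfb j * cf i" if "1 \<le> i" "i < rank" "1 \<le> j" "j < rank" "\<bar>i - j\<bar> \<noteq> 1" for i j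
    using chev_rel[OF chev_rel.f_fb[of "nat i" _ "nat j"]] that
    by (simp add: eq_0_iff chev_simps)
  show "ce i * ceb (i + 1) - ceb (i + 1) * ce i = ceb i * ce (i + 1) - ce (i + 1) * ceb i" if "1 \<le> i" "i + 1 < rank" for i
    using chev_rel[OF chev_rel.e_eb_next[of "nat i"]] that
    by (simp add: eq_0_iff chev_simps)
  show "cfb (i + 1) * cf i - cf i * cfb (i + 1) = cf (i + 1) * cfb i - cfb i * cf (i + 1)" if "1 \<le> i" "i + 1 < rank" for i
    using chev_rel[OF chev_rel.f_fb_next[of "nat i"]] that
    by (simp add: eq_0_iff chev_simps)
  show "\<q> \<bullet> (ce i * ce i * ce (i + 1)) - (\<q> + inverse \<q>) \<bullet> (ce i * ce (i + 1) * ce i) + inverse \<q> \<bullet> (ce (i + 1) * ce i * ce i) = 0" if "1 \<le> i" "i + 1 < rank" for i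
    using chev_rel[OF chev_rel.serre_e[of "nat i"]] that
    by (simp add: eq_0_iff chev_simps)
  show "\<q> \<bullet> (cf i * cf i * cf (i + 1)) - (\<q> + inverse \<q>) \<bullet> (cf i * cf (i + 1) * cf i) + inverse \<q> \<bullet> (cf (i + 1) * cf i * cf i) = 0" if "1 \<le> i" "i + 1 < rank" for i
    using chev_rel[OF chev_rel.serre_f[of "nat i"]] that
    by (simp add: eq_0_iff chev_simps)
  show "\<q> \<bullet> (ce i * ce (i + 1) * ce (i + 1)) - (\<q> + inverse \<q>) \<bullet> (ce (i + 1) * ce i * ce (i + 1)) + inverse \<q> \<bullet> (ce (i + 1) * ce (i + 1) * ce i) = 0" if "1 \<le> i" "i + 1 < rank" for i
    using chev_rel[OF chev_rel.serre_e'[of "nat i"]] that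
    by (simp add: eq_0_iff chev_simps)
  show "\<q> \<bullet> (cf i * cf (i + 1) * cf (i + 1)) - (\<q> + inverse \<q>) \<bullet> (cf (i + 1) * cf i * cf (i + 1)) + inverse \<q> \<bullet> (cf (i + 1) * cf (i + 1) * cf i) = 0" if "1 \<le> i" "i + 1 < rank" for i
    using chev_rel[OF chev_rel.serre_f'[of "nat i"]] that
    by (simp add: eq_0_iff chev_simps)
  show "\<q> \<bullet> (ce i * ce i * ceb (i + 1)) - (\<q> + inverse \<q>) \<bullet> (ce i * ceb (i + 1) * ce i) + inverse \<q> \<bullet> (ceb (i + 1) * ce i * ce i) = 0" if "1 \<le> i" "i + 1 < rank" for i
    using chev_rel[OF chev_rel.serre_eb[of "nat i"]] that
    by (simp add: eq_0_iff chev_simps)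
  show "\<q> \<bullet> (cf i * cf i * cfb (i + 1)) - (\<q> + inverse \<q>) \<bullet> (cf i * cfb (i + 1) * cf i) + inverse \<q> \<bullet> (cfb (i + 1) * cf i * cf i) = 0" if "1 \<le> i" "i + 1 < rank" for i
    using chev_rel[OF chev_rel.serre_fb[of "nat i"]] that
    by (simp add: eq_0_iff chev_simps)
  show "\<q> \<bullet> (ceb i * ce (i + 1) * ce (i + 1)) - (\<q> + inverse \<q>) \<bullet> (ce (i + 1) * ceb i * ce (i + 1)) + inverse \<q> \<bullet> (ce (i + 1) * ce (i + 1) * ceb i) = 0" if "1 \<le> i" "i + 1 < rank" for i
    using chev_rel[OF chev_rel.serre_eb'[of "nat i"]] that
    by (simp add: eq_0_iff chev_simps)
  show "\<q> \<bullet> (cfb i * cf (i + 1) * cf (i + 1)) - (\<q> + inverse \<q>) \<bullet> (cf (i + 1) * cfb i * cf (i + 1)) + inverse \<q> \<bullet> (cf (i + 1) * cf (i + 1) * cfb i) = 0" if "1 \<le> i" "i + 1 < rank" for i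
    using chev_rel[OF chev_rel.serre_fb'[of "nat i"]] that
    by (simp add: eq_0_iff chev_simps)
qed

definition olsh_L :: "int \<Rightarrow> int \<Rightarrow> olsh_gen pres" where
  "olsh_L i j = (if i \<in> indices rank \<and> j \<in> indices rank \<and> i \<le> j then cls (\<L> i j) else 0)"

lemma olsh_rel_cls: "olsh_rel crit_rank x y \<Longrightarrow> ev (\<lambda>g. cls (gen g)) x = ev (\<lambda>g. cls (gen g)) y"
  by (rule ev_rel) (simp add: prel_olsh_gen_def)

lemma olshanski_L: "olshanski \<q> (\<q> - inverse \<q>) rank olsh_L"
proof
  note rel = olsh_rel_cls
  show "\<q> \<noteq> 0" "\<q> - inverse \<q> \<noteq> 0" "1 + \<q> * \<q> \<noteq> 0" by (fact q_nonzero)+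
  show "\<q> - inverse \<q> = \<q> - inverse \<q>" by (rule refl)
  show "1 \<le> rank" using crit_rank_pos by simp
  have neg: "i \<in> indices rank \<Longrightarrow> - i \<in> indices rank" for i by (auto simp: indices_def)
  show "olsh_L i i * olsh_L (- i) (- i) = 1" if "i \<in> indices rank" for i
    using rel[OF olsh_rel.diag[of i]] that neg by (simp add: olsh_L_def indices_olsh_index)
  show "exchange \<q> olsh_L i j k l"
    if I: "i \<in> indices rank" "j \<in> indices rank" "k \<in> indices rank" "l \<in> indices rank" and le: "i \<le> j" "k \<le> l" for i j k l
  proof -
    \<comment> \<open>Where the indices are out of order, \<open>olsh_L\<close> is zero and
      \<open>\<L>\<close> is not a generator; the two may be exchanged because the coefficient is
      zero.\<close>
    have cond: "(of_bool P * c * d) \<bullet> (cls (\<L> a b) * cls (\<L> a' b')) = (of_bool P * c * d) \<bullet> (olsh_L a b * olsh_L a' b')"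
      if "P \<Longrightarrow> a \<le> b \<and> a' \<le> b'" "a \<in> indices rank" "b \<in> indices rank" "a' \<in> indices rank" "b' \<in> indices rank"
      for P c d a b a' b'
      using that by (cases P) (simp_all add: olsh_L_def)
    have 1: "cls (\<L> i j) = olsh_L i j" "cls (\<L> k l) = olsh_L k l" using I le by (simp_all add: olsh_L_def)
    have 2: "(of_bool (k \<le> j \<and> j < l) * c * d) \<bullet> (cls (\<L> i l) * cls (\<L> k j)) = (of_bool (k \<le> j \<and> j < l) * c * d) \<bullet> (olsh_L i l * olsh_L k j)"
      "(of_bool (i \<le> - l \<and> - l < j \<and> j \<le> - k) * c * d) \<bullet> (cls (\<L> i (- l)) * cls (\<L> k (- j)))
        = (of_bool (i \<le> - l \<and> - l < j \<and> j \<le> - k) * c * d) \<bullet> (olsh_L i (- l) * olsh_L k (- j))"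
      "(of_bool (k < i \<and> i \<le> l) * c * d) \<bullet> (cls (\<L> i l) * cls (\<L> k j)) = (of_bool (k < i \<and> i \<le> l) * c * d) \<bullet> (olsh_L i l * olsh_L k j)"
      "(of_bool (- l \<le> i \<and> i < - k \<and> - k \<le> j) * c * d) \<bullet> (cls (\<L> (- i) l) * cls (\<L> (- k) j))
        = (of_bool (- l \<le> i \<and> i < - k \<and> - k \<le> j) * c * d) \<bullet> (olsh_L (- i) l * olsh_L (- k) j)" for c d
      by (rule cond; use I le neg in force)+
    show ?thesis
      using rel[OF olsh_rel.exchange[OF I[unfolded indices_olsh_index] le]]
      unfolding exchange_def ev_add ev_scale ev_mult ev_gen 1 2 .
  qed
qed (auto simp: olsh_L_def)

section \<open>The two homomorphisms\<close>

interpretation O: olshanski "\<q>" "\<q> - inverse \<q>" rank olsh_L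
  by (rule olshanski_L)

fun chev_img :: "chev_gen \<Rightarrow> olsh_gen pres" where
  "chev_img (E_gen i) = O.e (int i)"
| "chev_img (F_gen i) = O.f (int i)"
| "chev_img (Ebar_gen i) = O.eb (int i)"
| "chev_img (Fbar_gen i) = O.fb (int i)"
| "chev_img (Kbar_gen i) = O.kb (int i)"
| "chev_img (Q_gen h) = cartan O.K crit_rank h"

abbreviation "oQ h \<equiv> cartan O.K crit_rank h"

lemma K_inv_nat: "m \<in> {1..crit_rank} \<Longrightarrow> O.K (int m) * O.K (- int m) = 1 \<and> O.K (- int m) * O.K (int m) = 1"
  using O.K_inv[of "int m"] by simp

lemma oQ_add: "oQ (h + h') = oQ h * oQ h'"
  by (rule cartan_add) (use K_inv_nat O.K_K in auto)

lemma oQ_diff: "oQ (h - h') = oQ h * oQ (- h')"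
  using oQ_add[of h "- h'"] by simp

lemma oQ_commute:
  assumes "\<And>m. m \<in> {1..crit_rank} \<Longrightarrow> O.K (int m) * a = (\<q> powi w m) \<bullet> (a * O.K (int m))"
  shows "oQ h * a * oQ (- h) = (\<q> powi (\<Sum>m=1..crit_rank. w m * Poly_Mapping.lookup h m)) \<bullet> a"
  using cartan_commute[of \<q> crit_rank O.K a w h, OF q_nonzero(1) K_inv_nat assms] oQ_add[of h "- h"]
  by (simp add: mult.assoc)

lemma sum_simple_root:
  assumes "i \<in> {1..<crit_rank}"
  shows "(\<Sum>m=1..crit_rank. (if m = i then 1 else if m = i + 1 then - 1 else 0) * Poly_Mapping.lookup h m) = simple_root i h"
    "(\<Sum>m=1..crit_rank. (if m = i then - 1 else if m = i + 1 then 1 else 0) * Poly_Mapping.lookup h m) = - simple_root i h"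
proof -
  have 1: "(if m = i then 1 else if m = i + 1 then - 1 else 0) * Poly_Mapping.lookup h m =
      (if m = i then Poly_Mapping.lookup h m else 0) - (if m = i + 1 then Poly_Mapping.lookup h m else 0)"
    "(if m = i then - 1 else if m = i + 1 then 1 else 0) * Poly_Mapping.lookup h m =
      (if m = i + 1 then Poly_Mapping.lookup h m else 0) - (if m = i then Poly_Mapping.lookup h m else 0)" for m
    by auto
  show "(\<Sum>m=1..crit_rank. (if m = i then 1 else if m = i + 1 then - 1 else 0) * Poly_Mapping.lookup h m) = simple_root i h"
    "(\<Sum>m=1..crit_rank. (if m = i then - 1 else if m = i + 1 then 1 else 0) * Poly_Mapping.lookup h m) = - simple_root i h"
    unfolding 1 sum_subtractf using assms by (simp_all add: sum.delta simple_root_def eps_def)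
qed

lemma oQ_gens:
  "i \<in> {1..<crit_rank} \<Longrightarrow> oQ h * O.e (int i) * oQ (- h) = (\<q> powi simple_root i h) \<bullet> O.e (int i)"
  "i \<in> {1..<crit_rank} \<Longrightarrow> oQ h * O.f (int i) * oQ (- h) = (\<q> powi (- simple_root i h)) \<bullet> O.f (int i)"
  "i \<in> {1..<crit_rank} \<Longrightarrow> oQ h * O.eb (int i) * oQ (- h) = (\<q> powi simple_root i h) \<bullet> O.eb (int i)"
  "i \<in> {1..<crit_rank} \<Longrightarrow> oQ h * O.fb (int i) * oQ (- h) = (\<q> powi (- simple_root i h)) \<bullet> O.fb (int i)"
  "i \<in> {1..crit_rank} \<Longrightarrow> oQ h * O.kb (int i) * oQ (- h) = O.kb (int i)"
proof -
  have p: "\<q> powi (if m = i then 1 else if m = i + 1 then - 1 else 0) = (if int m = int i then \<q> else if int m = int i + 1 then inverse \<q> else 1)"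
    "\<q> powi (if m = i then - 1 else if m = i + 1 then 1 else 0) = (if int m = int i then inverse \<q> else if int m = int i + 1 then \<q> else 1)" for m
    by auto
  show "oQ h * O.e (int i) * oQ (- h) = (\<q> powi simple_root i h) \<bullet> O.e (int i)"
    "oQ h * O.eb (int i) * oQ (- h) = (\<q> powi simple_root i h) \<bullet> O.eb (int i)" if i: "i \<in> {1..<crit_rank}"
    unfolding sum_simple_root(1)[OF i, symmetric]
    by (rule oQ_commute, unfold p, rule O.K_gen; use i in simp)+
  show "oQ h * O.f (int i) * oQ (- h) = (\<q> powi (- simple_root i h)) \<bullet> O.f (int i)"
    "oQ h * O.fb (int i) * oQ (- h) = (\<q> powi (- simple_root i h)) \<bullet> O.fb (int i)" if i: "i \<in> {1..<crit_rank}"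
    unfolding sum_simple_root(2)[OF i, symmetric]
    by (rule oQ_commute, unfold p, rule O.K_gen; use i in simp)+
  show "oQ h * O.kb (int i) * oQ (- h) = O.kb (int i)" if "i \<in> {1..crit_rank}"
    using oQ_commute[of "O.kb (int i)" "\<lambda>_. 0" h] O.K_gen(5) that by simp
qed

lemma chev_img_rel: "chev_rel crit_rank x y \<Longrightarrow> ev chev_img x = ev chev_img y"
proof (induction rule: chev_rel.induct)
  case q_zero
  show ?case by simp
next
  case (q_add h h')
  show ?case by (simp add: oQ_add)
next
  case (q_e h i)
  then show ?case by (simp add: oQ_gens)
next
  case (q_f h i)
  then show ?case by (simp add: oQ_gens)
next
  case (q_kb h i)
  then show ?case by (simp add: oQ_gens)
next
  case (q_eb h i)
  then show ?case by (simp add: oQ_gens)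
next
  case (q_fb h i)
  then show ?case by (simp add: oQ_gens)
next
  case (e_f i)
  then show ?case using O.e_f[of "int i"] oQ_add[of "cow (i + 1)" "- cow i"] oQ_add[of "- cow i" "cow (i + 1)"] by (simp add: eq_0_iff power2_eq_square mult.assoc add.commute[of 1 "int _"] cartan_cow oQ_add oQ_diff divide_inverse)
next
  case (e_f_up i)
  then show ?case using O.e_f_up[of "int i"] by (simp add: eq_0_iff power2_eq_square mult.assoc add.commute[of 1 "int _"] cartan_cow)
next
  case (e_f_dn i)
  then show ?case using O.e_f_dn[of "int i"] by (simp add: eq_0_iff power2_eq_square mult.assoc add.commute[of 1 "int _"] cartan_cow)
next
  case (e_f_apart i j)
  then show ?case using O.e_f_far[of "int i" "int j"] by (simp add: eq_0_iff power2_eq_square mult.assoc add.commute[of 1 "int _"] cartan_cow apart_def)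
next
  case (e_fb i)
  then show ?case using O.e_fb[of "int i"] by (simp add: eq_0_iff power2_eq_square mult.assoc add.commute[of 1 "int _"] cartan_cow)
next
  case (e_fb_up i)
  then show ?case using O.e_fb_up[of "int i"] by (simp add: eq_0_iff power2_eq_square mult.assoc add.commute[of 1 "int _"] cartan_cow)
next
  case (e_fb_dn i)
  then show ?case using O.e_fb_dn[of "int i"] by (simp add: eq_0_iff power2_eq_square mult.assoc add.commute[of 1 "int _"] cartan_cow)
next
  case (e_fb_apart i j)
  then show ?case using O.e_fb_far[of "int i" "int j"] by (simp add: eq_0_iff power2_eq_square mult.assoc add.commute[of 1 "int _"] cartan_cow apart_def)
next
  case (eb_f i)
  then show ?case using O.eb_f[of "int i"] by (simp add: eq_0_iff power2_eq_square mult.assoc add.commute[of 1 "int _"] cartan_cow)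
next
  case (eb_f_up i)
  then show ?case using O.eb_f_up[of "int i"] by (simp add: eq_0_iff power2_eq_square mult.assoc add.commute[of 1 "int _"] cartan_cow)
next
  case (eb_f_dn i)
  then show ?case using O.eb_f_dn[of "int i"] by (simp add: eq_0_iff power2_eq_square mult.assoc add.commute[of 1 "int _"] cartan_cow)
next
  case (eb_f_apart i j)
  then show ?case using O.eb_f_far[of "int i" "int j"] by (simp add: eq_0_iff power2_eq_square mult.assoc add.commute[of 1 "int _"] cartan_cow apart_def)
next
  case (kb_e i)
  then show ?case using O.kb_e[of "int i"] by (simp add: eq_0_iff power2_eq_square mult.assoc add.commute[of 1 "int _"] cartan_cow)
next
  case (kb_e_dn i)
  \<comment> \<open>The matrix relations are stated at index j + 1, so the index i - 1 is rewritten
    as j.\<close>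
  then obtain j where "i = j + 1" by (cases i) auto
  then show ?case using kb_e_dn O.kb_e_dn[of "int j"] by (simp add: eq_0_iff power2_eq_square mult.assoc add.commute[of 1 "int _"] cartan_cow)
next
  case (kb_e_apart i j)
  then show ?case using O.kb_e_far[of "int i" "int j"] by (simp add: eq_0_iff power2_eq_square mult.assoc add.commute[of 1 "int _"] cartan_cow apart_def)
next
  case (kb_f i)
  then show ?case using O.kb_f[of "int i"] by (simp add: eq_0_iff power2_eq_square mult.assoc add.commute[of 1 "int _"] cartan_cow)
next
  case (kb_f_dn i)
  then obtain j where "i = j + 1" by (cases i) auto
  then show ?case using kb_f_dn O.kb_f_dn[of "int j"] by (simp add: eq_0_iff power2_eq_square mult.assoc add.commute[of 1 "int _"] cartan_cow)
next
  case (kb_f_apart i j)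
  then show ?case using O.kb_f_far[of "int i" "int j"] by (simp add: eq_0_iff power2_eq_square mult.assoc add.commute[of 1 "int _"] cartan_cow apart_def)
next
  case (kb_sq i)
  have "(\<q> ^ 2 - inverse \<q> ^ 2) \<bullet> (O.kb (int i) * O.kb (int i)) = O.K (int i) * O.K (int i) - O.K (- int i) * O.K (- int i)"
    using O.kb_sq[of "int i"] kb_sq by (simp add: power2_eq_square)
  from arg_cong[OF this, of "smul (1 / (\<q> ^ 2 - inverse \<q> ^ 2))"]
  have "O.kb (int i) * O.kb (int i) = (1 / (\<q> ^ 2 - inverse \<q> ^ 2)) \<bullet> (O.K (int i) * O.K (int i) - O.K (- int i) * O.K (- int i))"
    using q_square by (simp only: smul_smul) (simp del: diff_eq_eq)
  moreover have "oQ (- (cow i + cow i)) = oQ (- cow i) * oQ (- cow i)" using oQ_add[of "- cow i" "- cow i"] by simp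
  ultimately show ?case using kb_sq by (simp only: ev_power ev_scale ev_diff ev_gen chev_img.simps power2_eq_square[where 'a = "olsh_gen pres"] oQ_add cartan_cow)
next
  case (kb_kb i j)
  then show ?case using O.kb_kb[of "int i" "int j"] O.kb_kb[of "int j" "int i"]
    by (cases "i < j") simp_all
next
  case (eb_fb i)
  then show ?case using O.eb_fb[of "int i"] by (simp add: eq_0_iff power2_eq_square mult.assoc add.commute[of 1 "int _"] cartan_cow oQ_add oQ_diff divide_inverse)
next
  case (eb_fb_up i)
  then show ?case using O.eb_fb_up[of "int i"] by (simp add: eq_0_iff power2_eq_square mult.assoc add.commute[of 1 "int _"] cartan_cow)
next
  case (eb_fb_dn i)
  then show ?case using O.eb_fb_dn[of "int i"] by (simp add: eq_0_iff power2_eq_square mult.assoc add.commute[of 1 "int _"] cartan_cow)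
next
  case (eb_fb_apart i j)
  then show ?case using O.eb_fb_far[of "int i" "int j"] by (simp add: eq_0_iff power2_eq_square mult.assoc add.commute[of 1 "int _"] cartan_cow apart_def)
next
  case (kb_eb i)
  then show ?case using O.kb_eb[of "int i"] by (simp add: eq_0_iff power2_eq_square mult.assoc add.commute[of 1 "int _"] cartan_cow)
next
  case (kb_eb_dn i)
  then obtain j where "i = j + 1" by (cases i) auto
  then show ?case using kb_eb_dn O.kb_eb_dn[of "int j"] by (simp add: eq_0_iff power2_eq_square mult.assoc add.commute[of 1 "int _"] cartan_cow)
next
  case (kb_eb_apart i j)
  then show ?case using O.kb_eb_far[of "int i" "int j"] by (simp add: eq_0_iff power2_eq_square mult.assoc add.commute[of 1 "int _"] cartan_cow apart_def)
next
  case (kb_fb i)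
  then show ?case using O.kb_fb[of "int i"] by (simp add: eq_0_iff power2_eq_square mult.assoc add.commute[of 1 "int _"] cartan_cow)
next
  case (kb_fb_dn i)
  then obtain j where "i = j + 1" by (cases i) auto
  then show ?case using kb_fb_dn O.kb_fb_dn[of "int j"] by (simp add: eq_0_iff power2_eq_square mult.assoc add.commute[of 1 "int _"] cartan_cow)
next
  case (kb_fb_apart i j)
  then show ?case using O.kb_fb_far[of "int i" "int j"] by (simp add: eq_0_iff power2_eq_square mult.assoc add.commute[of 1 "int _"] cartan_cow apart_def)
next
  case (eb_sq i)
  have "(\<q> + inverse \<q>) \<bullet> (O.eb (int i) * O.eb (int i)) = (- (\<q> - inverse \<q>)) \<bullet> (O.e (int i) * O.e (int i))"
    using O.eb_sq[of "int i"] eb_sq by (simp del: minus_diff_eq)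
  from arg_cong[OF this, of "smul (1 / (\<q> + inverse \<q>))"] show ?case
    using q_nonzero(4) by (simp add: power2_eq_square del: minus_diff_eq)
next
  case (fb_sq i)
  have "(\<q> + inverse \<q>) \<bullet> (O.fb (int i) * O.fb (int i)) = ((\<q> - inverse \<q>)) \<bullet> (O.f (int i) * O.f (int i))"
    using O.fb_sq[of "int i"] fb_sq by simp
  from arg_cong[OF this, of "smul (1 / (\<q> + inverse \<q>))"] show ?case
    using q_nonzero(4) by (simp add: power2_eq_square del: minus_diff_eq)
next
  case (e_e_apart i j)
  then show ?case using O.e_e_far[of "int i" "int j"] by (simp add: eq_0_iff power2_eq_square mult.assoc add.commute[of 1 "int _"] cartan_cow apart_def)
next
  case (f_f_apart i j)
  then show ?case using O.f_f_far[of "int i" "int j"] by (simp add: eq_0_iff power2_eq_square mult.assoc add.commute[of 1 "int _"] cartan_cow apart_def)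
next
  case (eb_eb_apart i j)
  then show ?case using O.eb_eb_far[of "int i" "int j"] by (simp add: eq_0_iff power2_eq_square mult.assoc add.commute[of 1 "int _"] cartan_cow apart_def)
next
  case (fb_fb_apart i j)
  then show ?case using O.fb_fb_far[of "int i" "int j"] by (simp add: eq_0_iff power2_eq_square mult.assoc add.commute[of 1 "int _"] cartan_cow apart_def)
next
  case (e_eb i j)
  then show ?case using O.e_eb[of "int i" "int j"] by (simp add: eq_0_iff power2_eq_square mult.assoc add.commute[of 1 "int _"] cartan_cow)
next
  case (f_fb i j)
  then show ?case using O.f_fb[of "int i" "int j"] by (simp add: eq_0_iff power2_eq_square mult.assoc add.commute[of 1 "int _"] cartan_cow)
next
  case (e_e_next i)
  then show ?case using O.e_e_next[of "int i"] by (simp add: eq_0_iff power2_eq_square mult.assoc add.commute[of 1 "int _"] cartan_cow)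
next
  case (f_f_next i)
  then show ?case using O.f_f_next[of "int i"] by (simp add: eq_0_iff power2_eq_square mult.assoc add.commute[of 1 "int _"] cartan_cow)
next
  case (e_eb_next i)
  then show ?case using O.e_eb_next[of "int i"] by (simp add: eq_0_iff power2_eq_square mult.assoc add.commute[of 1 "int _"] cartan_cow)
next
  case (f_fb_next i)
  then show ?case using O.f_fb_next[of "int i"] by (simp add: eq_0_iff power2_eq_square mult.assoc add.commute[of 1 "int _"] cartan_cow)
next
  case (serre_e i)
  then show ?case using O.serre_e[of "int i"] by (simp add: eq_0_iff power2_eq_square mult.assoc add.commute[of 1 "int _"] cartan_cow)
next
  case (serre_f i)
  then show ?case using O.serre_f[of "int i"] by (simp add: eq_0_iff power2_eq_square mult.assoc add.commute[of 1 "int _"] cartan_cow)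
next
  case (serre_e' i)
  then show ?case using O.serre_e'[of "int i"] by (simp add: eq_0_iff power2_eq_square mult.assoc add.commute[of 1 "int _"] cartan_cow)
next
  case (serre_f' i)
  then show ?case using O.serre_f'[of "int i"] by (simp add: eq_0_iff power2_eq_square mult.assoc add.commute[of 1 "int _"] cartan_cow)
next
  case (serre_eb i)
  then show ?case using O.serre_eb[of "int i"] by (simp add: eq_0_iff power2_eq_square mult.assoc add.commute[of 1 "int _"] cartan_cow)
next
  case (serre_fb i)
  then show ?case using O.serre_fb[of "int i"] by (simp add: eq_0_iff power2_eq_square mult.assoc add.commute[of 1 "int _"] cartan_cow)
next
  case (serre_eb' i)
  then show ?case using O.serre_eb'[of "int i"] by (simp add: eq_0_iff power2_eq_square mult.assoc add.commute[of 1 "int _"] cartan_cow)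
next
  case (serre_fb' i)
  then show ?case using O.serre_fb'[of "int i"] by (simp add: eq_0_iff power2_eq_square mult.assoc add.commute[of 1 "int _"] cartan_cow)
qed

interpretation C: chev_system "\<q>" "\<q> - inverse \<q>" rank cK "\<lambda>i. cf i" "\<lambda>i. ce i" "\<lambda>i. cfb i" "\<lambda>i. ceb i" "\<lambda>i. ckb i"
  by (rule chev_system_cls)

fun olsh_img :: "olsh_gen \<Rightarrow> chev_gen pres" where
  "olsh_img (L_gen i j) = C.L_matrix i j"

lemma olsh_img_rel: "olsh_rel crit_rank x y \<Longrightarrow> ev olsh_img x = ev olsh_img y"
proof (induction rule: olsh_rel.induct)
  interpret M: olshanski "\<q>" "\<q> - inverse \<q>" rank C.L_matrix by (rule C.olshanski_L_matrix)
  fix i :: int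
  assume "i \<in> olsh_index crit_rank"
  then show "ev olsh_img (\<L> i i * \<L> (- i) (- i)) = ev olsh_img 1" "ev olsh_img (\<L> (- i) (- i) * \<L> i i) = ev olsh_img 1"
    using M.L_inverse[of i] M.L_inverse[of "- i"] by (auto simp: indices_olsh_index olsh_index_def)
next
  interpret M: olshanski "\<q>" "\<q> - inverse \<q>" rank C.L_matrix by (rule C.olshanski_L_matrix)
  case (exchange i j k l)
  then show ?case using M.exchange[of i j k l] by (simp add: exchange_def indices_olsh_index)
qed

definition chev_to_olsh :: "chev_gen pres \<Rightarrow> olsh_gen pres" where
  "chev_to_olsh = lift_pres chev_img"

definition olsh_to_chev :: "olsh_gen pres \<Rightarrow> chev_gen pres" where
  "olsh_to_chev = lift_pres olsh_img"

lemma chev_img_prel: "prel x y \<Longrightarrow> ev chev_img x = ev chev_img y"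
  by (rule chev_img_rel) (simp add: prel_chev_gen_def)

lemma olsh_img_prel: "prel x y \<Longrightarrow> ev olsh_img x = ev olsh_img y"
  by (rule olsh_img_rel) (simp add: prel_olsh_gen_def)

interpretation to_olsh: ratfun_hom chev_to_olsh
  unfolding chev_to_olsh_def by (rule ratfun_hom_lift) (rule chev_img_prel)

interpretation to_chev: ratfun_hom olsh_to_chev
  unfolding olsh_to_chev_def by (rule ratfun_hom_lift) (rule olsh_img_prel)

lemma gen_carrier: "g \<in> pgens \<Longrightarrow> gen g \<in> carrier (free_algebra pgens)"
  by (rule free_algebra_closed)

lemma chev_to_olsh_gen: "g \<in> chev_gens crit_rank \<Longrightarrow> chev_to_olsh (chev_cls g) = chev_img g"
  using lift_pres_cls[OF chev_img_prel gen_carrier, of g] by (simp add: chev_to_olsh_def pgens_chev_gen_def)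

lemma chev_gens_mem: "i \<in> {1..<crit_rank} \<Longrightarrow> E_gen i \<in> chev_gens crit_rank" "i \<in> {1..<crit_rank} \<Longrightarrow> F_gen i \<in> chev_gens crit_rank"
  "i \<in> {1..<crit_rank} \<Longrightarrow> Ebar_gen i \<in> chev_gens crit_rank" "i \<in> {1..<crit_rank} \<Longrightarrow> Fbar_gen i \<in> chev_gens crit_rank"
  "i \<in> {1..crit_rank} \<Longrightarrow> Kbar_gen i \<in> chev_gens crit_rank" "h \<in> coweights crit_rank \<Longrightarrow> Q_gen h \<in> chev_gens crit_rank"
  by (simp_all add: chev_gens_def)

lemma olsh_to_chev_L: "olsh_to_chev (olsh_L i j) = C.L_matrix i j"
proof (cases "i \<in> indices rank \<and> j \<in> indices rank \<and> i \<le> j")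
  case True
  then have "L_gen i j \<in> pgens" by (auto simp: pgens_olsh_gen_def olsh_gens_def indices_olsh_index)
  then show ?thesis using True unfolding olsh_L_def olsh_to_chev_def
    by (simp add: lift_pres_cls olsh_img_prel gen_carrier)
next
  case False
  then show ?thesis by (auto simp: olsh_L_def C.L_matrix_def)
qed

lemma chev_to_olsh_K: "\<lbrakk>1 \<le> m; m \<le> rank\<rbrakk> \<Longrightarrow> chev_to_olsh (cK m) = olsh_L m m"
  "\<lbrakk>1 \<le> m; m \<le> rank\<rbrakk> \<Longrightarrow> chev_to_olsh (cK (- m)) = olsh_L (- m) (- m)"
  using nat_mem(2)[of m] cartan_cow[of "nat m" crit_rank O.K]
  by (simp_all add: cK_simps chev_to_olsh_gen chev_gens_mem coweights_closed O.K_def)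

text \<open>A homomorphism preserves the exchange relations, so by \<open>olshanski_eqI\<close> the
  image of \<open>C.L_matrix\<close> need only be compared with \<open>olsh_L\<close> at the
  generators.\<close>

lemma chev_to_olsh_L_matrix: "chev_to_olsh (C.L_matrix i j) = olsh_L i j"
proof -
  have "(\<lambda>i j. chev_to_olsh (C.L_matrix i j)) = olsh_L"
  proof (rule olshanski_eqI[OF olshanski.olshanski_hom[OF C.olshanski_L_matrix to_olsh.ratfun_hom_axioms] olshanski_L])
    fix m :: int
    assume m: "1 \<le> m" "m \<le> rank"
    then have "m \<in> indices rank" "- m \<in> indices rank" by (auto simp: indices_def)
    then show "chev_to_olsh (C.L_matrix m m) = olsh_L m m \<and> chev_to_olsh (C.L_matrix (- m) (- m)) = olsh_L (- m) (- m) \<and>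
      chev_to_olsh (C.L_matrix (- m) m) = olsh_L (- m) m"
      using m by (simp add: C.L_matrix_diag C.L_matrix_F chev_to_olsh_K chev_to_olsh_gen[OF chev_gens_mem(5)[OF nat_mem(2)[OF m]]] O.L_gens(5))
  next
    fix m :: int
    assume m: "1 \<le> m" "m < rank"
    then show "chev_to_olsh (C.L_matrix m (m + 1)) = olsh_L m (m + 1) \<and>
      chev_to_olsh (C.L_matrix (- m - 1) (- m)) = olsh_L (- m - 1) (- m) \<and>
      chev_to_olsh (C.L_matrix (- m) (m + 1)) = olsh_L (- m) (m + 1) \<and>
      chev_to_olsh (C.L_matrix (- m - 1) m) = olsh_L (- m - 1) m"
      using nat_mem(1)[OF m]
      by (simp add: C.L_matrix_E C.L_matrix_F chev_to_olsh_gen chev_gens_mem O.L_gens)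
  qed
  then show ?thesis by (simp add: fun_eq_iff)
qed

lemma chev_to_olsh_inverse: "chev_to_olsh \<circ> olsh_to_chev = id"
proof (rule ratfun_hom_eqI[OF ratfun_hom_comp[OF to_chev.ratfun_hom_axioms to_olsh.ratfun_hom_axioms] ratfun_hom_id])
  fix g :: olsh_gen
  assume "g \<in> pgens"
  then obtain i j where g: "g = L_gen i j" "i \<in> indices rank" "j \<in> indices rank" "i \<le> j"
    by (auto simp: pgens_olsh_gen_def olsh_gens_def indices_olsh_index)
  then have "cls (gen g) = olsh_L i j" by (simp add: olsh_L_def)
  then show "(chev_to_olsh \<circ> olsh_to_chev) (cls (gen g)) = id (cls (gen g))"
    by (simp add: olsh_to_chev_L chev_to_olsh_L_matrix)
qed

lemma olsh_to_chev_gens: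
  assumes "i \<in> {1..<crit_rank}"
  shows "olsh_to_chev (O.e (int i)) = chev_cls (E_gen i)" "olsh_to_chev (O.f (int i)) = chev_cls (F_gen i)"
    "olsh_to_chev (O.eb (int i)) = chev_cls (Ebar_gen i)" "olsh_to_chev (O.fb (int i)) = chev_cls (Fbar_gen i)"
proof -
  have z: "inverse (\<q> - inverse \<q>) * (\<q> - inverse \<q>) = 1" using q_nonzero(3) by simp
  have i: "1 \<le> int i" "int i < rank" using assms by auto
  show "olsh_to_chev (O.e (int i)) = chev_cls (E_gen i)" "olsh_to_chev (O.f (int i)) = chev_cls (F_gen i)"
    "olsh_to_chev (O.eb (int i)) = chev_cls (Ebar_gen i)" "olsh_to_chev (O.fb (int i)) = chev_cls (Fbar_gen i)"
    unfolding O.e_def O.f_def O.eb_def O.fb_def to_chev.hom_uminus to_chev.hom_smul olsh_to_chev_L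
      C.L_matrix_E[OF i] C.L_matrix_F(1,2)[OF i]
    by (simp_all add: z)
qed

lemma olsh_to_chev_kb:
  assumes "i \<in> {1..crit_rank}"
  shows "olsh_to_chev (O.kb (int i)) = chev_cls (Kbar_gen i)"
proof -
  have z: "inverse (\<q> - inverse \<q>) * (\<q> - inverse \<q>) = 1" using q_nonzero(3) by simp
  have i: "1 \<le> int i" "int i \<le> rank" using assms by auto
  show ?thesis
    unfolding O.kb_def to_chev.hom_uminus to_chev.hom_smul olsh_to_chev_L C.L_matrix_F(3)[OF i]
    by (simp add: z)
qed

lemma olsh_to_chev_inverse: "olsh_to_chev \<circ> chev_to_olsh = id"
proof (rule ratfun_hom_eqI[OF ratfun_hom_comp[OF to_olsh.ratfun_hom_axioms to_chev.ratfun_hom_axioms] ratfun_hom_id])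
  fix g :: chev_gen
  assume "g \<in> pgens"
  then have g: "g \<in> chev_gens crit_rank" by (simp add: pgens_chev_gen_def)
  \<comment> \<open>For general \<open>h\<close> the element q^h is recovered from the q^{k_m} and
    their inverses: both sides are given by \<open>cartan\<close> with the same values of
    \<open>cK\<close>.\<close>
  have Q: "olsh_to_chev (oQ h) = chev_cls (Q_gen h)" if h: "h \<in> coweights crit_rank" for h
  proof -
    have K: "(olsh_to_chev \<circ> O.K) (int m) = cK (int m) \<and> (olsh_to_chev \<circ> O.K) (- int m) = cK (- int m)"
      if "m \<in> {1..crit_rank}" for m
    proof -
      have "int m \<in> indices rank" "- int m \<in> indices rank" using that by (auto simp: indices_def)
      then show ?thesis by (simp add: O.K_def olsh_to_chev_L C.L_matrix_diag)
    qed
    have "chev_cls (Q_gen h) = cartan cK crit_rank h"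
      by (rule cartan_unique[OF qpow_zero qpow_add _ h]) (auto simp: cK_def)
    then show ?thesis
      using cartan_cong[of crit_rank "olsh_to_chev \<circ> O.K" cK h, OF K] by (simp only: to_chev.hom_cartan)
  qed
  from g have "olsh_to_chev (chev_img g) = chev_cls g"
    unfolding chev_gens_def by (auto simp: olsh_to_chev_gens olsh_to_chev_kb Q)
  then show "(olsh_to_chev \<circ> chev_to_olsh) (chev_cls g) = id (chev_cls g)"
    using chev_to_olsh_gen[OF g] by simp
qed

lemma presentations_iso_crit_rank: "presentations_iso crit_rank"
proof -
  have "bij chev_to_olsh"
    using chev_to_olsh_inverse olsh_to_chev_inverse by (rule o_bij[rotated])
  then have iso: "(\<lambda>X. Rep_pres (chev_to_olsh (Abs_pres X))) \<in> algebra_iso (Uq_chev crit_rank) (Uq_queer crit_rank)" (is "?\<Phi> \<in> _")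
    using algebra_iso_pres[OF to_olsh.ratfun_hom_axioms]
    by (simp add: Uq_chev_def Uq_queer_def pgens_olsh_gen_def prel_olsh_gen_def pgens_chev_gen_def prel_chev_gen_def)
  \<comment> \<open>Reduces every prescribed value of the isomorphism to the value of
    \<open>chev_img\<close> at a generator.\<close>
  have img: "?\<Phi> (chev_class crit_rank (gen g)) = Uq_class crit_rank (c \<cdot> \<L> i j)"
    if "g \<in> chev_gens crit_rank" "chev_img g = c \<bullet> olsh_L i j" "i \<in> indices rank" "j \<in> indices rank" "i \<le> j" for g c i j
  proof -
    have "L_gen i j \<in> pgens" using that by (auto simp: pgens_olsh_gen_def olsh_gens_def indices_olsh_index)
    then have L: "\<L> i j \<in> carrier (free_algebra pgens)" by (rule gen_carrier)
    have "Abs_pres (chev_class crit_rank (gen g)) = chev_cls g"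
      by (simp add: cls_def chev_class_def pgens_chev_gen_def prel_chev_gen_def)
    moreover have "chev_to_olsh (chev_cls g) = cls (c \<cdot> \<L> i j)"
      using that L by (simp add: chev_to_olsh_gen olsh_L_def cls_smul)
    ultimately show ?thesis
      using Rep_cls[OF free_algebra_closed(7)[OF L], of c]
      by (simp add: Uq_class_def pgens_olsh_gen_def prel_olsh_gen_def)
  qed
  have scale_one: "1 \<cdot> x = x" for x :: "olsh_gen ncpoly" by (simp add: scale_simps)
  note d = O.e_def O.f_def O.eb_def O.fb_def O.kb_def O.K_def divide_inverse
  have idx: "int i \<in> indices rank" "- int i \<in> indices rank" if "i \<in> {1..crit_rank}" for i using that by (auto simp: indices_def)
  have idx': "int i \<in> indices rank" "- int i \<in> indices rank" "int i + 1 \<in> indices rank" "- int i - 1 \<in> indices rank"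
    if "i \<in> {1..<crit_rank}" for i using that by (auto simp: indices_def)
  show ?thesis
    unfolding presentations_iso_def
  proof (intro bexI[OF _ iso] conjI ballI)
    fix i
    assume i: "i \<in> {1..crit_rank}"
    show "?\<Phi> (chev_class crit_rank (qpow (cow i))) = Uq_class crit_rank (\<L> (int i) (int i))"
      "?\<Phi> (chev_class crit_rank (qpow (- cow i))) = Uq_class crit_rank (\<L> (- int i) (- int i))"
      using img[of "Q_gen (cow i)" 1 "int i" "int i"] img[of "Q_gen (- cow i)" 1 "- int i" "- int i"] i idx[OF i]
      by (simp_all add: scale_one chev_gens_mem coweights_closed cartan_cow O.K_def)
    show "?\<Phi> (chev_class crit_rank (\<kk>bar i)) = Uq_class crit_rank ((- (1 / (\<q> - inverse \<q>))) \<cdot> \<L> (- int i) (int i))"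
      by (rule img) (use i idx in \<open>simp_all add: chev_gens_mem d\<close>)
  next
    fix i
    assume i: "i \<in> {1..<crit_rank}"
    show "?\<Phi> (chev_class crit_rank (\<ee> i)) = Uq_class crit_rank ((- (1 / (\<q> - inverse \<q>))) \<cdot> \<L> (- int i - 1) (- int i))"
      "?\<Phi> (chev_class crit_rank (\<ff> i)) = Uq_class crit_rank ((1 / (\<q> - inverse \<q>)) \<cdot> \<L> (int i) (int i + 1))"
      "?\<Phi> (chev_class crit_rank (\<ee>bar i)) = Uq_class crit_rank ((- (1 / (\<q> - inverse \<q>))) \<cdot> \<L> (- int i - 1) (int i))"
      "?\<Phi> (chev_class crit_rank (\<ff>bar i)) = Uq_class crit_rank ((- (1 / (\<q> - inverse \<q>))) \<cdot> \<L> (- int i) (int i + 1))"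
      by (rule img; use i idx'[OF i] in \<open>simp add: chev_gens_mem d\<close>)+
  qed
qed

theorem theorem2p1:
  fixes n :: nat
  assumes "n \<ge> 1"
  shows "\<exists>\<Phi> \<in> algebra_iso (Uq_chev n) (Uq_queer n).
    (\<forall>i \<in> {1..n}.
      \<Phi> (chev_class n (qpow (cow i))) = Uq_class n (\<L> (int i) (int i)) \<and>
      \<Phi> (chev_class n (qpow (- cow i))) = Uq_class n (\<L> (- int i) (- int i)) \<and>
      \<Phi> (chev_class n (\<kk>bar i))
        = Uq_class n ((- (1 / (\<q> - inverse \<q>))) \<cdot> \<L> (- int i) (int i))) \<and>
    (\<forall>i \<in> {1..<n}.
      \<Phi> (chev_class n (\<ee> i))
        = Uq_class n ((- (1 / (\<q> - inverse \<q>))) \<cdot> \<L> (- int i - 1) (- int i)) \<and>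
      \<Phi> (chev_class n (\<ff> i))
        = Uq_class n ((1 / (\<q> - inverse \<q>)) \<cdot> \<L> (int i) (int i + 1)) \<and>
      \<Phi> (chev_class n (\<ee>bar i))
        = Uq_class n ((- (1 / (\<q> - inverse \<q>))) \<cdot> \<L> (- int i - 1) (int i)) \<and>
      \<Phi> (chev_class n (\<ff>bar i))
        = Uq_class n ((- (1 / (\<q> - inverse \<q>))) \<cdot> \<L> (- int i) (int i + 1)))"
  using presentations_iso_if_crit_rank[OF presentations_iso_crit_rank assms] by (simp only: presentations_iso_def)

end
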